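(* Let $\mathbf h=(\mathbf p,\nabla,\Delta)$ be a connected Hopf monoid which is commutative and strongly linearized in some finite basis $\mathrm P$ for $\mathbf p$, and let $\mathrm Q=\mathcal P(\mathrm P,\nabla)$. Let $\mathbf q^\circ$ be the connected species, with the same unit and counit as $\mathbf p$, given by the vector subspecies of $\mathbf p$ with $\mathbf q^\circ[\varnothing]=\mathbf p[\varnothing]$ and $\mathbf q^\circ[S]=\mathbb K\mathrm Q[S]$ (the linear span of $\mathrm Q[S]$) for nonempty finite sets $S$. Then restricting $\Delta$ gives $\mathbf q^\circ$ the structure of a linearized connected comonoid $(\mathbf q^\circ,\Delta)$ (linearized in its basis equal to $\mathrm Q[S]$ for $S\neq\varnothing$ and $\{1_{\mathbf p}\}$ for $S=\varnothing$), and there is a unique isomorphism of connected Hopf monoids $\Phi:\mathcal S(\mathbf q^\circ,\Delta)\to\mathbf h$ which restricts to an isomorphism of set species $\mathcal S(\mathrm Q)\to\mathrm P$ commuting with the natural inclusions of $\mathrm Q$ into $\mathcal S(\mathrm Q)$ and $\mathrm P$, i.e. such that $\Phi_I(\{(I,\lambda)\})=\lambda$ for all nonempty finite sets $I$ and all $\lambda\in\mathrm Q[I]$.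
   Context: $\mathbb K$ is a field of characteristic zero. **Species.** A set species (resp. vector species) is a functor from the category of finite sets with bijections to sets (resp. $\mathbb K$-vector spaces); morphisms are natural transformations. A set subspecies of a species $\mathrm P$ assigns to each finite set $S$ a subset of $\mathrm P[S]$, stable under all maps $\mathrm P[\sigma]$. A connected species is a vector species $\mathbf p$ with mutually inverse linear isomorphisms $\mathbb K\to\mathbf p[\varnothing]$ (unit) and $\mathbf p[\varnothing]\to\mathbb K$ (counit); $1_{\mathbf p}$ is the image of $1_{\mathbb K}$ under the unit. Morphisms of connected species are natural transformations $f$ with $f_\varnothing(1_{\mathbf p})=1_{\mathbf p'}$. **Hopf monoids.** A product $\nabla$ (resp. coproduct $\Delta$) on $\mathbf p$ is a family of linear maps $\nabla_{S,T}:\mathbf p[S]\otimes\mathbf p[T]\to\mathbf p[S\sqcup T]$ (resp. $\Delta_{S,T}:\mathbf p[S\sqcup T]\to\mathbf p[S]\otimes\mathbf p[T]$) for all ordered pairs of disjoint finite sets, natural with respect to bijections $S\sqcup T\to S'\sqcup T'$ carrying $S$ to $S'$ and $T$ to $T'$. The product is associative if $\nabla_{R\sqcup S,T}(\nabla_{R,S}\otimes\mathrm{id})=\nabla_{R,S\sqcup T}(\mathrm{id}\otimes\nabla_{S,T})$, and commutative if $\nabla_{S,T}(x\otimes y)=\nabla_{T,S}(y\otimes x)$; coassociativity and cocommutativity of $\Delta$ are the dual conditions. $(\mathbf p,\nabla)$ is a connected monoid if $\nabla$ is associative and $\nabla_{\varnothing,S}(1_{\mathbf p}\otimes\lambda)=\nabla_{S,\varnothing}(\lambda\otimes1_{\mathbf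 p})=\lambda$. $(\mathbf p,\Delta)$ is a connected comonoid if $\Delta$ is coassociative and $\Delta_{\varnothing,S}(\lambda)=1_{\mathbf p}\otimes\lambda$, $\Delta_{S,\varnothing}(\lambda)=\lambda\otimes1_{\mathbf p}$. $(\mathbf p,\nabla,\Delta)$ is a connected Hopf monoid if it is a connected monoid and a connected comonoid and, for any two decompositions $I=R\sqcup R'=S\sqcup S'$, with $A=R\cap S$, $B=R\cap S'$, $A'=R'\cap S$, $B'=R'\cap S'$, one has $\Delta_{S,S'}\circ\nabla_{R,R'}=(\nabla_{A,A'}\otimes\nabla_{B,B'})\circ\tau\circ(\Delta_{A,B}\otimes\Delta_{A',B'})$, where $\tau$ swaps the two middle tensor factors. Morphisms are morphisms of connected species commuting with products and/or coproducts. A connected Hopf monoid is commutative/cocommutative if $\nabla$/$\Delta$ is. **Linearization.** A basis of a connected species $\mathbf p$ is a set subspecies $\mathrm P\subset\mathbf p$ with each $\mathrm P[S]$ a $\mathbb K$-basis of $\mathbf p[S]$ and $\mathrm P[\varnothing]=\{1_{\mathbf p}\}$; it is finite if every $\mathrm P[S]$ is finite. A connected Hopf monoid is linearized in $\mathrm P$ if for all disjoint $S,T$ the map $\nabla_{S,T}$ restricts to a map $\mathrm P[S]\times\mathrm P[T]\to\mathrm P[S\sqcup T]$ and $\Delta_{S,T}$ restricts to a map $\mathrm P[S\sqcup T]\to\mathrm P[S]\times\mathrm P[T]$ (identifying $(a,b)$ with $a\otimes b$). A connected comonoid is linearized in $\mathrm P$ if the second condition holds. $\mathcal P(\mathrm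 P,\nabla)$ is the set subspecies of $\mathrm P$ with $\mathcal P(\mathrm P,\nabla)[\varnothing]=\varnothing$ and, for $I\ne\varnothing$, consisting of the elements of $\mathrm P[I]$ not in the image of $\nabla_{S,T}$ for any decomposition $I=S\sqcup T$ with $S,T$ nonempty. $(\mathbf p,\nabla,\Delta)$ is strongly linearized in $\mathrm P$ if it is linearized in $\mathrm P$ and, with $\mathrm Q=\mathcal P(\mathrm P,\nabla)$, $\Delta_{S,T}$ restricts to a map $\mathrm Q[S\sqcup T]\to\mathrm Q[S]\times\mathrm Q[T]$ for all disjoint nonempty $S,T$. **The Hopf monoid $\mathcal S(\mathbf q,\Delta)$.** For a set species $\mathrm Q$, a $\mathrm Q$-labeled partition of a finite set $I$ is a set $X$ of pairs (blocks) $(B,\lambda)$ with the sets $B$ nonempty, pairwise disjoint, with union $I$ (distinct blocks having disjoint underlying sets), and $\lambda\in\mathrm Q[B]$. These form a set species $\mathcal S(\mathrm Q)$, with $\mathcal S(\mathrm Q)[\sigma]$ sending each block $(B,\lambda)$ to $(\sigma(B),\mathrm Q[\sigma](\lambda))$; it does not depend on $\mathrm Q[\varnothing]$. If $(\mathbf q,\Delta)$ is a connected comonoid linearized in a basis $\mathrm Q$, then $\mathcal S(\mathbf q,\Delta)$ is the connected Hopf monoid with underlying species $\mathbb K\mathcal S(\mathrm Q)$ (free vector species on $\mathcal S(\mathrm Q)$, with $1=\varnothing\in\mathcal S(\mathrm Q)[\varnothing]$), product $\nabla_{S,T}(X\otimes Y)=X\sqcup Y$, and coproduct $\Delta_{S_1,S_2}(Z)=Z_1\otimes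 Z_2$, where for $Z=\{(B_j,\lambda_j)\}_{j\in J}$ one writes $\Delta_{S_1\cap B_j,S_2\cap B_j}(\lambda_j)=\lambda_{1j}\otimes\lambda_{2j}$ with $\lambda_{ij}\in\mathrm Q[S_i\cap B_j]$ and sets $Z_i=\{(S_i\cap B_j,\lambda_{ij}):S_i\cap B_j\neq\varnothing\}$. *)

theory Defs
  imports
    "HOL-Library.FuncSet"
    "HOL-Library.Function_Algebras"
    "HOL-Library.Poly_Mapping"
    "HOL-Library.Infinite_Typeclass"
begin

section \<open>Linear maps between subspaces, tensor products\<close>

text \<open>
  A vector space is given by a scalar multiplication \<open>s\<close> making the type of vectors a
  \<^const>\<open>vector_space\<close>, together with a subspace \<open>A\<close> of that type. Maps are only
  constrained on their domain \<open>A\<close>.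
\<close>

definition linear_on ::
  "('k \<Rightarrow> 'v \<Rightarrow> 'v) \<Rightarrow> ('k \<Rightarrow> 'w \<Rightarrow> 'w) \<Rightarrow> 'v::plus set \<Rightarrow> 'w::plus set \<Rightarrow> ('v \<Rightarrow> 'w) \<Rightarrow> bool" where
  "linear_on s s' A B f \<longleftrightarrow> f \<in> A \<rightarrow> B \<and>
     (\<forall>x\<in>A. \<forall>y\<in>A. f (x + y) = f x + f y) \<and> (\<forall>c. \<forall>x\<in>A. f (s c x) = s' c (f x))"

text \<open>
  The tensor product of \<open>V\<close> and \<open>W\<close> is realized inside the dual of the space of bilinear forms
  on \<open>V \<times> W\<close>: the pure tensor of \<open>x\<close> and \<open>y\<close> is evaluation at \<open>(x, y)\<close>, and the tensor product
  is the span of the pure tensors. Over a field this is a tensor product, and for subspaces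
  \<open>A \<subseteq> V\<close>, \<open>B \<subseteq> W\<close> the span of the pure tensors of elements of \<open>A\<close> and \<open>B\<close> is a tensor product
  of \<open>A\<close> and \<open>B\<close>; the universal property is the theorem \<open>tensor_universal\<close> below.
\<close>

type_synonym ('v, 'w, 'k) tensor = "('v \<Rightarrow> 'w \<Rightarrow> 'k) \<Rightarrow> 'k"

definition bilinear_form ::
  "('k::field \<Rightarrow> 'v \<Rightarrow> 'v) \<Rightarrow> ('k \<Rightarrow> 'w \<Rightarrow> 'w) \<Rightarrow> ('v::ab_group_add \<Rightarrow> 'w::ab_group_add \<Rightarrow> 'k) \<Rightarrow> bool" where
  "bilinear_form s s' \<beta> \<longleftrightarrow> (\<forall>y. Vector_Spaces.linear s (*) (\<lambda>x. \<beta> x y)) \<and>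
     (\<forall>x. Vector_Spaces.linear s' (*) (\<beta> x))"

definition pure_tensor ::
  "('k::field \<Rightarrow> 'v \<Rightarrow> 'v) \<Rightarrow> ('k \<Rightarrow> 'w \<Rightarrow> 'w) \<Rightarrow> 'v::ab_group_add \<Rightarrow> 'w::ab_group_add \<Rightarrow>
     ('v, 'w, 'k) tensor" where
  "pure_tensor s s' x y = (\<lambda>\<beta>. if bilinear_form s s' \<beta> then \<beta> x y else 0)"

definition tensor_scale :: "'k::field \<Rightarrow> ('v, 'w, 'k) tensor \<Rightarrow> ('v, 'w, 'k) tensor" where
  "tensor_scale c t = (\<lambda>\<beta>. c * t \<beta>)"

definition tensor_space ::
  "('k::field \<Rightarrow> 'v \<Rightarrow> 'v) \<Rightarrow> ('k \<Rightarrow> 'w \<Rightarrow> 'w) \<Rightarrow> 'v::ab_group_add set \<Rightarrow> 'w::ab_group_add set \<Rightarrow>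
     ('v, 'w, 'k) tensor set" where
  "tensor_space s s' A B = module.span tensor_scale {pure_tensor s s' x y | x y. x \<in> A \<and> y \<in> B}"

text \<open>The linear map on the tensor product of \<open>A\<close> and \<open>B\<close> induced by a bilinear map \<open>\<phi>\<close> on \<open>A \<times> B\<close>.\<close>

definition tensor_lift ::
  "('k::field \<Rightarrow> 'v \<Rightarrow> 'v) \<Rightarrow> ('k \<Rightarrow> 'w \<Rightarrow> 'w) \<Rightarrow> 'v::ab_group_add set \<Rightarrow> 'w::ab_group_add set \<Rightarrow>
     ('v \<Rightarrow> 'w \<Rightarrow> 'z::ab_group_add) \<Rightarrow> ('v, 'w, 'k) tensor \<Rightarrow> 'z" where
  "tensor_lift s s' A B \<phi> t =
     (THE z. \<exists>xs. set xs \<subseteq> A \<times> B \<and> t = (\<Sum>(x, y)\<leftarrow>xs. pure_tensor s s' x y) \<and>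
        z = (\<Sum>(x, y)\<leftarrow>xs. \<phi> x y))"

lemma vector_space_tensor_scale: "vector_space (tensor_scale :: 'k::field \<Rightarrow> ('v, 'w, 'k) tensor \<Rightarrow> _)"
  by unfold_locales (auto simp: tensor_scale_def fun_eq_iff algebra_simps)

lemma tensor_list_sum_zero:
  fixes s :: "'k::field \<Rightarrow> 'v::ab_group_add \<Rightarrow> 'v" and s' :: "'k \<Rightarrow> 'w::ab_group_add \<Rightarrow> 'w"
    and r :: "'k \<Rightarrow> 'z::ab_group_add \<Rightarrow> 'z"
  assumes vs: "vector_space s" "vector_space s'" "vector_space r"
    and sub: "module.subspace s A" "module.subspace s' B"
    and phi: "\<And>y. y \<in> B \<Longrightarrow> linear_on s r A UNIV (\<lambda>x. \<phi> x y)"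
      "\<And>x. x \<in> A \<Longrightarrow> linear_on s' r B UNIV (\<phi> x)"
    and xs: "set xs \<subseteq> A \<times> B" "(\<Sum>(x, y)\<leftarrow>xs. pure_tensor s s' x y) = 0"
  shows "(\<Sum>(x, y)\<leftarrow>xs. \<phi> x y) = 0"
proof (rule ccontr)
  let ?w = "\<Sum>(x, y)\<leftarrow>xs. \<phi> x y"
  assume nz: "?w \<noteq> 0"
  interpret V: vector_space s by (rule vs)
  interpret W: vector_space s' by (rule vs)
  interpret Z: vector_space r by (rule vs)
  have vk: "vector_space ((*) :: 'k \<Rightarrow> 'k \<Rightarrow> 'k)" by unfold_locales (auto simp: algebra_simps)
  interpret K: vector_space "(*) :: 'k \<Rightarrow> 'k \<Rightarrow> 'k" by (rule vk)
  interpret ZK: vector_space_pair r "(*) :: 'k \<Rightarrow> 'k \<Rightarrow> 'k" by unfold_locales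
  interpret VV: vector_space_pair s s by unfold_locales
  interpret WW: vector_space_pair s' s' by unfold_locales
  have "Z.independent {?w}" using nz by simp
  from ZK.linear_independent_extend[OF this, of "\<lambda>_. 1"]
  obtain l where l: "Vector_Spaces.linear r (*) l" "l ?w = 1" by auto
  obtain bA where bA: "bA \<subseteq> A" "V.independent bA" "A = V.span bA"
    using V.maximal_independent_subset[of A] sub(1) by (metis V.span_minimal subset_antisym)
  obtain bB where bB: "bB \<subseteq> B" "W.independent bB" "B = W.span bB"
    using W.maximal_independent_subset[of B] sub(2) by (metis W.span_minimal subset_antisym)
  obtain pA where pA: "Vector_Spaces.linear s s pA" "\<And>x. x \<in> bA \<Longrightarrow> pA x = x" "range pA \<subseteq> V.span bA"
    using VV.linear_independent_extend_subspace[OF bA(2), of id] by auto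
  obtain pB where pB: "Vector_Spaces.linear s' s' pB" "\<And>x. x \<in> bB \<Longrightarrow> pB x = x" "range pB \<subseteq> W.span bB"
    using WW.linear_independent_extend_subspace[OF bB(2), of id] by auto
  have idA: "pA x = x" if "x \<in> A" for x
    using VV.linear_eq_on[OF pA(1) V.linear_id, of x bA] that bA(3) pA(2) by simp
  have idB: "pB x = x" if "x \<in> B" for x
    using WW.linear_eq_on[OF pB(1) W.linear_id, of x bB] that bB(3) pB(2) by simp
  have inA: "pA x \<in> A" for x using pA(3) bA(3) by auto
  have inB: "pB x \<in> B" for x using pB(3) bB(3) by auto
  define \<beta> where "\<beta> x y = l (\<phi> (pA x) (pB y))" for x y
  have l_simps: "l (x + y) = l x + l y" "l (r c x) = c * l x" for x y c
    using l(1) unfolding Vector_Spaces.linear_iff by auto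
  have pA_simps: "pA (x + y) = pA x + pA y" "pA (s c x) = s c (pA x)" for x y c
    using pA(1) unfolding Vector_Spaces.linear_iff by auto
  have pB_simps: "pB (x + y) = pB x + pB y" "pB (s' c x) = s' c (pB x)" for x y c
    using pB(1) unfolding Vector_Spaces.linear_iff by auto
  have ph1: "\<phi> (x + x') y = \<phi> x y + \<phi> x' y" "\<phi> (s c x) y = r c (\<phi> x y)"
    if "x \<in> A" "x' \<in> A" "y \<in> B" for x x' y c
    using phi(1)[OF that(3)] that unfolding linear_on_def by auto
  have ph2: "\<phi> x (y + y') = \<phi> x y + \<phi> x y'" "\<phi> x (s' c y) = r c (\<phi> x y)"
    if "x \<in> A" "y \<in> B" "y' \<in> B" for x y y' c
    using phi(2)[OF that(1)] that unfolding linear_on_def by auto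
  have bil: "bilinear_form s s' \<beta>"
    unfolding bilinear_form_def Vector_Spaces.linear_iff \<beta>_def
    by (auto simp: vs vk l_simps pA_simps pB_simps ph1(1) ph2(1) ph1(2)[OF inA inA inB] ph2(2)[OF inA inB inB] inA inB)
  have pt: "pure_tensor s s' x y \<beta> = l (\<phi> x y)" if "x \<in> A" "y \<in> B" for x y
    using bil that by (simp add: pure_tensor_def \<beta>_def[of x y] idA idB)
  have "(\<Sum>(x, y)\<leftarrow>ys. pure_tensor s s' x y) \<beta> = l (\<Sum>(x, y)\<leftarrow>ys. \<phi> x y)"
    if "set ys \<subseteq> A \<times> B" for ys
    using that
  proof (induction ys)
    case Nil
    have "l 0 = 0" using l_simps(2)[of 0 0] by simp
    then show ?case by simp
  next
    case (Cons a ys)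
    then show ?case
      by (cases a) (simp add: l_simps pt)
  qed
  from this[OF xs(1)] xs(2) l(2) show False by simp
qed

theorem tensor_universal:
  fixes s :: "'k::field \<Rightarrow> 'v::ab_group_add \<Rightarrow> 'v" and s' :: "'k \<Rightarrow> 'w::ab_group_add \<Rightarrow> 'w"
    and r :: "'k \<Rightarrow> 'z::ab_group_add \<Rightarrow> 'z"
  assumes vs: "vector_space s" "vector_space s'" "vector_space r"
    and sub: "module.subspace s A" "module.subspace s' B" "module.subspace r C"
    and phi: "\<And>y. y \<in> B \<Longrightarrow> linear_on s r A C (\<lambda>x. \<phi> x y)"
      "\<And>x. x \<in> A \<Longrightarrow> linear_on s' r B C (\<phi> x)"
  shows "linear_on tensor_scale r (tensor_space s s' A B) C (tensor_lift s s' A B \<phi>)"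
    and "\<lbrakk>x \<in> A; y \<in> B\<rbrakk> \<Longrightarrow> tensor_lift s s' A B \<phi> (pure_tensor s s' x y) = \<phi> x y"
    and "\<lbrakk>linear_on tensor_scale r (tensor_space s s' A B) C f;
          \<And>x y. x \<in> A \<Longrightarrow> y \<in> B \<Longrightarrow> f (pure_tensor s s' x y) = \<phi> x y; t \<in> tensor_space s s' A B\<rbrakk> \<Longrightarrow>
         f t = tensor_lift s s' A B \<phi> t"
proof -
  interpret V: vector_space s by (rule vs)
  interpret W: vector_space s' by (rule vs)
  interpret Z: vector_space r by (rule vs)
  interpret T: vector_space "tensor_scale :: 'k \<Rightarrow> ('v, 'w, 'k) tensor \<Rightarrow> _"
    by (rule vector_space_tensor_scale)
  let ?T = "\<lambda>xs. \<Sum>(x, y)\<leftarrow>xs. pure_tensor s s' x y"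
  let ?P = "\<lambda>xs. \<Sum>(x, y)\<leftarrow>xs. \<phi> x y"
  let ?m = "\<lambda>c xs. map (\<lambda>(x, y). (s c x, y)) xs"
  let ?L = "tensor_lift s s' A B \<phi>"
  have phi': "linear_on s r A UNIV (\<lambda>x. \<phi> x y)" if "y \<in> B" for y
    using phi(1)[OF that] unfolding linear_on_def by auto
  have phi'': "linear_on s' r B UNIV (\<phi> x)" if "x \<in> A" for x
    using phi(2)[OF that] unfolding linear_on_def by auto
  have pt_scale: "pure_tensor s s' (s c x) y = tensor_scale c (pure_tensor s s' x y)" for c x y
    unfolding pure_tensor_def tensor_scale_def bilinear_form_def Vector_Spaces.linear_iff by auto
  have mT: "?T (?m c xs) = tensor_scale c (?T xs)" for c xs
    by (induction xs) (auto simp: pt_scale tensor_scale_def algebra_simps)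
  have mP: "?P (?m c xs) = r c (?P xs)" if "set xs \<subseteq> A \<times> B" for c xs
    using that phi(1) by (induction xs) (auto simp: linear_on_def Z.scale_right_distrib)
  have mS: "set (?m c xs) \<subseteq> A \<times> B" if "set xs \<subseteq> A \<times> B" for c xs
    using that V.subspace_scale[OF sub(1)] by auto
  have eq: "?P xs = ?P ys" if "set xs \<subseteq> A \<times> B" "set ys \<subseteq> A \<times> B" "?T xs = ?T ys" for xs ys
  proof -
    have "?P (xs @ ?m (-1) ys) = 0"
      by (rule tensor_list_sum_zero[OF vs sub(1,2) phi' phi''])
        (use that mS[of ys "-1"] mT[of "-1" ys] in \<open>auto simp del: map_map\<close>)
    then show ?thesis using mP[OF that(2), of "-1"] by simp
  qed
  have L: "?L (?T xs) = ?P xs" if "set xs \<subseteq> A \<times> B" for xs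
    unfolding tensor_lift_def using that eq by (intro the_equality) metis+
  have ex: "\<exists>xs. set xs \<subseteq> A \<times> B \<and> t = ?T xs" if "t \<in> tensor_space s s' A B" for t
    using that unfolding tensor_space_def
  proof (induction rule: T.span_induct_alt)
    case base
    show ?case by (intro exI[of _ "[]"]) simp
  next
    case (step c a t)
    then obtain x y xs where "x \<in> A" "y \<in> B" "a = pure_tensor s s' x y" "set xs \<subseteq> A \<times> B" "t = ?T xs"
      by auto
    then show ?case
      using V.subspace_scale[OF sub(1)] by (intro exI[of _ "(s c x, y) # xs"]) (auto simp: pt_scale)
  qed
  have inC: "?P xs \<in> C" if "set xs \<subseteq> A \<times> B" for xs
    using that phi(1) Z.subspace_0[OF sub(3)] Z.subspace_add[OF sub(3)]
    by (induction xs) (auto simp: linear_on_def Pi_iff)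
  show 1: "linear_on tensor_scale r (tensor_space s s' A B) C ?L"
    unfolding linear_on_def
  proof (intro conjI ballI allI funcsetI)
    fix t assume "t \<in> tensor_space s s' A B"
    then show "?L t \<in> C" using ex L inC by metis
  next
    fix t u assume "t \<in> tensor_space s s' A B" "u \<in> tensor_space s s' A B"
    then obtain xs ys where x: "set xs \<subseteq> A \<times> B" "t = ?T xs" "set ys \<subseteq> A \<times> B" "u = ?T ys"
      using ex by metis
    then show "?L (t + u) = ?L t + ?L u"
      using L[of "xs @ ys"] L[of xs] L[of ys] by simp
  next
    fix c t assume "t \<in> tensor_space s s' A B"
    then obtain xs where x: "set xs \<subseteq> A \<times> B" "t = ?T xs"
      using ex by metis
    then show "?L (tensor_scale c t) = r c (?L t)"
      using L[OF mS[OF x(1)], of c] mT[of c xs] mP[OF x(1), of c] L[OF x(1)] by simp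
  qed
  show 2: "?L (pure_tensor s s' x y) = \<phi> x y" if "x \<in> A" "y \<in> B" for x y
    using L[of "[(x, y)]"] that by simp
  show "f t = ?L t"
    if f: "linear_on tensor_scale r (tensor_space s s' A B) C f"
      "\<And>x y. x \<in> A \<Longrightarrow> y \<in> B \<Longrightarrow> f (pure_tensor s s' x y) = \<phi> x y" and t: "t \<in> tensor_space s s' A B"
  proof -
    have "t \<in> tensor_space s s' A B \<and> f t = ?L t"
      using t unfolding tensor_space_def
    proof (induction rule: T.span_induct_alt)
      case base
      have 0: "0 \<in> tensor_space s s' A B" unfolding tensor_space_def by (rule T.span_zero)
      have "f (tensor_scale 0 0) = r 0 (f 0)" "?L (tensor_scale 0 0) = r 0 (?L 0)"
        using f(1) 1 0 unfolding linear_on_def by blast+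
      then have "f 0 = ?L 0" by simp
      then show ?case using 0 unfolding tensor_space_def by blast
    next
      case (step c a u)
      then obtain x y where a: "x \<in> A" "y \<in> B" "a = pure_tensor s s' x y" by auto
      have in1: "a \<in> tensor_space s s' A B" unfolding tensor_space_def
        by (rule T.span_base) (use step in auto)
      have in2: "tensor_scale c a \<in> tensor_space s s' A B"
        using in1 unfolding tensor_space_def by (rule T.span_scale)
      have u: "u \<in> tensor_space s s' A B" using step by (simp add: tensor_space_def)
      have "f (tensor_scale c a + u) = ?L (tensor_scale c a + u)"
        using f 1 2 in1 in2 u step a unfolding linear_on_def by simp
      moreover have "tensor_scale c a + u \<in> tensor_space s s' A B"
        using in2 u unfolding tensor_space_def by (rule T.span_add)
      ultimately show ?case unfolding tensor_space_def by blast
    qed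
    then show ?thesis by simp
  qed
qed

text \<open>The map \<open>f \<otimes> g\<close> on the tensor product of \<open>A\<close> and \<open>B\<close>.\<close>

definition tensor_map where
  "tensor_map s s' r r' A B f g = tensor_lift s s' A B (\<lambda>x y. pure_tensor r r' (f x) (g y))"

text \<open>\<open>(a \<otimes> b) \<otimes> c \<mapsto> a \<otimes> (b \<otimes> c)\<close>\<close>

definition tensor_assoc where
  "tensor_assoc s A B C =
     tensor_lift tensor_scale s (tensor_space s s A B) C
       (\<lambda>u c. tensor_lift s s A B (\<lambda>a b. pure_tensor s tensor_scale a (pure_tensor s s b c)) u)"

text \<open>\<open>(a \<otimes> b) \<otimes> (a' \<otimes> b') \<mapsto> (a \<otimes> a') \<otimes> (b \<otimes> b')\<close>\<close>

definition tensor_middle_swap where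
  "tensor_middle_swap s A B A' B' =
     tensor_lift tensor_scale tensor_scale (tensor_space s s A B) (tensor_space s s A' B')
       (\<lambda>u v. tensor_lift s s A B (\<lambda>a b. tensor_lift s s A' B' (\<lambda>a' b'.
          pure_tensor tensor_scale tensor_scale (pure_tensor s s a a') (pure_tensor s s b b')) v) u)"


section \<open>Species\<close>

text \<open>
  The finite sets are the finite subsets of a type \<open>'u\<close>; when \<open>'u\<close> is infinite they form, with
  bijections, a category equivalent to that of all finite sets. A bijection out of \<open>S\<close> is given by
  a function \<open>\<sigma>\<close> injective on \<open>S\<close>, and its target is \<open>\<sigma> ` S\<close>; \<open>sp_map F S \<sigma>\<close> is the map
  \<open>F[\<sigma>] : F[S] \<rightarrow> F[\<sigma> ` S]\<close>, which may only depend on the values of \<open>\<sigma>\<close> on \<open>S\<close>. All data are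
  unconstrained at infinite sets.
\<close>

record ('u, 'x) species =
  sp_obj :: "'u set \<Rightarrow> 'x set"
  sp_map :: "'u set \<Rightarrow> ('u \<Rightarrow> 'u) \<Rightarrow> 'x \<Rightarrow> 'x"

locale set_species =
  fixes F :: "('u, 'x, 'm) species_scheme"
  assumes map_closed: "\<lbrakk>finite S; inj_on \<sigma> S; x \<in> sp_obj F S\<rbrakk> \<Longrightarrow> sp_map F S \<sigma> x \<in> sp_obj F (\<sigma> ` S)"
    and map_cong: "\<lbrakk>finite S; inj_on \<sigma> S; \<And>a. a \<in> S \<Longrightarrow> \<sigma> a = \<rho> a; x \<in> sp_obj F S\<rbrakk> \<Longrightarrow>
      sp_map F S \<sigma> x = sp_map F S \<rho> x"
    and map_id: "\<lbrakk>finite S; x \<in> sp_obj F S\<rbrakk> \<Longrightarrow> sp_map F S id x = x"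
    and map_comp: "\<lbrakk>finite S; inj_on \<sigma> S; inj_on \<tau> (\<sigma> ` S); x \<in> sp_obj F S\<rbrakk> \<Longrightarrow>
      sp_map F S (\<tau> \<circ> \<sigma>) x = sp_map F (\<sigma> ` S) \<tau> (sp_map F S \<sigma> x)"

text \<open>
  Morphisms are extensional functions (undefined at infinite sets and outside of the source), so
  that equality of morphisms is equality of functions.
\<close>

locale species_hom = F: set_species F + G: set_species G
  for F :: "('u, 'x, 'm) species_scheme" and G :: "('u, 'y, 'n) species_scheme" +
  fixes f :: "'u set \<Rightarrow> 'x \<Rightarrow> 'y"
  assumes hom_PiE: "f \<in> (\<Pi>\<^sub>E S\<in>Collect finite. sp_obj F S \<rightarrow>\<^sub>E sp_obj G S)"
    and hom_natural: "\<lbrakk>finite S; inj_on \<sigma> S; x \<in> sp_obj F S\<rbrakk> \<Longrightarrow>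
      f (\<sigma> ` S) (sp_map F S \<sigma> x) = sp_map G S \<sigma> (f S x)"

definition inverse_homs ::
  "('u, 'x, 'm) species_scheme \<Rightarrow> ('u, 'y, 'n) species_scheme \<Rightarrow>
     ('u set \<Rightarrow> 'x \<Rightarrow> 'y) \<Rightarrow> ('u set \<Rightarrow> 'y \<Rightarrow> 'x) \<Rightarrow> bool" where
  "inverse_homs F G f g \<longleftrightarrow> (\<forall>S. finite S \<longrightarrow>
     (\<forall>x\<in>sp_obj F S. g S (f S x) = x) \<and> (\<forall>y\<in>sp_obj G S. f S (g S y) = y))"

definition species_iso where
  "species_iso F G f \<longleftrightarrow> species_hom F G f \<and> (\<exists>g. species_hom G F g \<and> inverse_homs F G f g)"

text \<open>A subspecies of \<open>F\<close> is given by its family of subsets; as a species it inherits the maps of \<open>F\<close>.\<close>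

definition set_subspecies :: "('u, 'x, 'm) species_scheme \<Rightarrow> ('u set \<Rightarrow> 'x set) \<Rightarrow> bool" where
  "set_subspecies F P \<longleftrightarrow> (\<forall>S. finite S \<longrightarrow> P S \<subseteq> sp_obj F S \<and>
     (\<forall>\<sigma>. inj_on \<sigma> S \<longrightarrow> sp_map F S \<sigma> ` P S \<subseteq> P (\<sigma> ` S)))"

definition subspecies :: "('u, 'x, 'm) species_scheme \<Rightarrow> ('u set \<Rightarrow> 'x set) \<Rightarrow> ('u, 'x) species" where
  "subspecies F P = \<lparr>sp_obj = P, sp_map = sp_map F\<rparr>"

text \<open>
  The spaces \<open>p[S]\<close> of a vector species are subspaces of one ambient vector space; any family of
  vector spaces is of this form up to isomorphism, via its direct sum. The spaces for different
  \<open>S\<close> are not required to be independent or disjoint.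
\<close>

record ('u, 'v, 'k) connected_species_data = "('u, 'v) species" +
  sp_scale :: "'k \<Rightarrow> 'v \<Rightarrow> 'v"
  sp_unit :: "'k \<Rightarrow> 'v"
  sp_counit :: "'v \<Rightarrow> 'k"

abbreviation sp_one :: "('u, 'v, 'k::field, 'm) connected_species_data_scheme \<Rightarrow> 'v" where
  "sp_one p \<equiv> sp_unit p 1"

locale connected_species = set_species p + vector_space "sp_scale p"
  for p :: "('u, 'v::ab_group_add, 'k::field, 'm) connected_species_data_scheme" +
  assumes obj_subspace: "finite S \<Longrightarrow> module.subspace (sp_scale p) (sp_obj p S)"
    and map_linear: "\<lbrakk>finite S; inj_on \<sigma> S\<rbrakk> \<Longrightarrow>
      linear_on (sp_scale p) (sp_scale p) (sp_obj p S) (sp_obj p (\<sigma> ` S)) (sp_map p S \<sigma>)"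
    and unit_linear: "linear_on (*) (sp_scale p) UNIV (sp_obj p {}) (sp_unit p)"
    and counit_linear: "linear_on (sp_scale p) (*) (sp_obj p {}) UNIV (sp_counit p)"
    and counit_unit: "sp_counit p (sp_unit p c) = c"
    and unit_counit: "x \<in> sp_obj p {} \<Longrightarrow> sp_unit p (sp_counit p x) = x"

locale connected_species_hom = species_hom p p' f + p: connected_species p + p': connected_species p'
  for p :: "('u, 'v::ab_group_add, 'k::field, 'm) connected_species_data_scheme"
    and p' :: "('u, 'w::ab_group_add, 'k, 'n) connected_species_data_scheme" and f +
  assumes hom_linear: "finite S \<Longrightarrow>
      linear_on (sp_scale p) (sp_scale p') (sp_obj p S) (sp_obj p' S) (f S)"
    and hom_one: "f {} (sp_one p) = sp_one p'"


section \<open>Hopf monoids\<close>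

text \<open>\<open>sp_pure p x y\<close> is \<open>x \<otimes> y\<close>, and \<open>sp_tensor p S T\<close> is \<open>p[S] \<otimes> p[T]\<close>.\<close>

abbreviation sp_pure where
  "sp_pure p \<equiv> pure_tensor (sp_scale p) (sp_scale p)"

abbreviation sp_tensor where
  "sp_tensor p S T \<equiv> tensor_space (sp_scale p) (sp_scale p) (sp_obj p S) (sp_obj p T)"

type_synonym ('u, 'v, 'k) product = "'u set \<Rightarrow> 'u set \<Rightarrow> ('v, 'v, 'k) tensor \<Rightarrow> 'v"
type_synonym ('u, 'v, 'k) coproduct = "'u set \<Rightarrow> 'u set \<Rightarrow> 'v \<Rightarrow> ('v, 'v, 'k) tensor"

locale connected_monoid = connected_species p
  for p :: "('u, 'v::ab_group_add, 'k::field, 'm) connected_species_data_scheme" +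
  fixes nabla :: "('u, 'v, 'k) product"
  assumes nabla_linear: "\<lbrakk>finite S; finite T; S \<inter> T = {}\<rbrakk> \<Longrightarrow>
      linear_on tensor_scale (sp_scale p) (sp_tensor p S T) (sp_obj p (S \<union> T)) (nabla S T)"
    and nabla_natural: "\<lbrakk>finite S; finite T; S \<inter> T = {}; inj_on \<sigma> (S \<union> T); t \<in> sp_tensor p S T\<rbrakk> \<Longrightarrow>
      sp_map p (S \<union> T) \<sigma> (nabla S T t) =
      nabla (\<sigma> ` S) (\<sigma> ` T)
        (tensor_map (sp_scale p) (sp_scale p) (sp_scale p) (sp_scale p) (sp_obj p S) (sp_obj p T)
           (sp_map p S \<sigma>) (sp_map p T \<sigma>) t)"
    and nabla_assoc: "\<lbrakk>finite R; finite S; finite T; R \<inter> S = {}; R \<inter> T = {}; S \<inter> T = {};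
        u \<in> tensor_space tensor_scale (sp_scale p) (sp_tensor p R S) (sp_obj p T)\<rbrakk> \<Longrightarrow>
      nabla (R \<union> S) T
        (tensor_map tensor_scale (sp_scale p) (sp_scale p) (sp_scale p)
           (sp_tensor p R S) (sp_obj p T) (nabla R S) id u) =
      nabla R (S \<union> T)
        (tensor_map (sp_scale p) tensor_scale (sp_scale p) (sp_scale p)
           (sp_obj p R) (sp_tensor p S T) id (nabla S T)
           (tensor_assoc (sp_scale p) (sp_obj p R) (sp_obj p S) (sp_obj p T) u))"
    and nabla_unit_left: "\<lbrakk>finite S; x \<in> sp_obj p S\<rbrakk> \<Longrightarrow> nabla {} S (sp_pure p (sp_one p) x) = x"
    and nabla_unit_right: "\<lbrakk>finite S; x \<in> sp_obj p S\<rbrakk> \<Longrightarrow> nabla S {} (sp_pure p x (sp_one p)) = x"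

locale connected_comonoid = connected_species p
  for p :: "('u, 'v::ab_group_add, 'k::field, 'm) connected_species_data_scheme" +
  fixes Delta :: "('u, 'v, 'k) coproduct"
  assumes Delta_linear: "\<lbrakk>finite S; finite T; S \<inter> T = {}\<rbrakk> \<Longrightarrow>
      linear_on (sp_scale p) tensor_scale (sp_obj p (S \<union> T)) (sp_tensor p S T) (Delta S T)"
    and Delta_natural: "\<lbrakk>finite S; finite T; S \<inter> T = {}; inj_on \<sigma> (S \<union> T); x \<in> sp_obj p (S \<union> T)\<rbrakk> \<Longrightarrow>
      Delta (\<sigma> ` S) (\<sigma> ` T) (sp_map p (S \<union> T) \<sigma> x) =
      tensor_map (sp_scale p) (sp_scale p) (sp_scale p) (sp_scale p) (sp_obj p S) (sp_obj p T)
        (sp_map p S \<sigma>) (sp_map p T \<sigma>) (Delta S T x)"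
    and Delta_coassoc: "\<lbrakk>finite R; finite S; finite T; R \<inter> S = {}; R \<inter> T = {}; S \<inter> T = {};
        x \<in> sp_obj p (R \<union> S \<union> T)\<rbrakk> \<Longrightarrow>
      tensor_assoc (sp_scale p) (sp_obj p R) (sp_obj p S) (sp_obj p T)
        (tensor_map (sp_scale p) (sp_scale p) tensor_scale (sp_scale p)
           (sp_obj p (R \<union> S)) (sp_obj p T) (Delta R S) id (Delta (R \<union> S) T x)) =
      tensor_map (sp_scale p) (sp_scale p) (sp_scale p) tensor_scale
        (sp_obj p R) (sp_obj p (S \<union> T)) id (Delta S T) (Delta R (S \<union> T) x)"
    and Delta_counit_left: "\<lbrakk>finite S; x \<in> sp_obj p S\<rbrakk> \<Longrightarrow> Delta {} S x = sp_pure p (sp_one p) x"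
    and Delta_counit_right: "\<lbrakk>finite S; x \<in> sp_obj p S\<rbrakk> \<Longrightarrow> Delta S {} x = sp_pure p x (sp_one p)"

text \<open>In the compatibility axiom \<open>I = R \<union> R' = S \<union> S'\<close>.\<close>

locale connected_hopf_monoid = connected_monoid p nabla + connected_comonoid p Delta
  for p :: "('u, 'v::ab_group_add, 'k::field, 'm) connected_species_data_scheme"
    and nabla Delta +
  assumes compatible: "\<lbrakk>finite R; finite R'; R \<inter> R' = {}; S \<inter> S' = {}; R \<union> R' = S \<union> S';
        A = R \<inter> S; B = R \<inter> S'; A' = R' \<inter> S; B' = R' \<inter> S'; t \<in> sp_tensor p R R'\<rbrakk> \<Longrightarrow>
      Delta S S' (nabla R R' t) =
      tensor_map tensor_scale tensor_scale (sp_scale p) (sp_scale p)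
        (sp_tensor p A A') (sp_tensor p B B') (nabla A A') (nabla B B')
        (tensor_middle_swap (sp_scale p) (sp_obj p A) (sp_obj p B) (sp_obj p A') (sp_obj p B')
           (tensor_map (sp_scale p) (sp_scale p) tensor_scale tensor_scale
              (sp_obj p R) (sp_obj p R') (Delta A B) (Delta A' B') t))"

definition commutative_product ::
  "('u, 'v::ab_group_add, 'k::field, 'm) connected_species_data_scheme \<Rightarrow> ('u, 'v, 'k) product \<Rightarrow> bool" where
  "commutative_product p nabla \<longleftrightarrow> (\<forall>S T. finite S \<and> finite T \<and> S \<inter> T = {} \<longrightarrow>
     (\<forall>x\<in>sp_obj p S. \<forall>y\<in>sp_obj p T. nabla S T (sp_pure p x y) = nabla T S (sp_pure p y x)))"

locale connected_hopf_monoid_hom = connected_species_hom p p' f +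
    H: connected_hopf_monoid p nabla Delta + H': connected_hopf_monoid p' nabla' Delta'
  for p :: "('u, 'v::ab_group_add, 'k::field, 'm) connected_species_data_scheme" and nabla Delta
    and p' :: "('u, 'w::ab_group_add, 'k, 'n) connected_species_data_scheme" and nabla' Delta' and f +
  assumes hom_nabla: "\<lbrakk>finite S; finite T; S \<inter> T = {}; t \<in> sp_tensor p S T\<rbrakk> \<Longrightarrow>
      f (S \<union> T) (nabla S T t) =
      nabla' S T (tensor_map (sp_scale p) (sp_scale p) (sp_scale p') (sp_scale p')
        (sp_obj p S) (sp_obj p T) (f S) (f T) t)"
    and hom_Delta: "\<lbrakk>finite S; finite T; S \<inter> T = {}; x \<in> sp_obj p (S \<union> T)\<rbrakk> \<Longrightarrow>
      Delta' S T (f (S \<union> T) x) =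
      tensor_map (sp_scale p) (sp_scale p) (sp_scale p') (sp_scale p')
        (sp_obj p S) (sp_obj p T) (f S) (f T) (Delta S T x)"

definition connected_hopf_monoid_iso where
  "connected_hopf_monoid_iso p nabla Delta p' nabla' Delta' f \<longleftrightarrow>
     connected_hopf_monoid_hom p nabla Delta p' nabla' Delta' f \<and>
     (\<exists>g. connected_hopf_monoid_hom p' nabla' Delta' p nabla Delta g \<and> inverse_homs p p' f g)"


section \<open>Linearization\<close>

definition species_basis ::
  "('u, 'v::ab_group_add, 'k::field, 'm) connected_species_data_scheme \<Rightarrow> ('u set \<Rightarrow> 'v set) \<Rightarrow> bool" where
  "species_basis p P \<longleftrightarrow> set_subspecies p P \<and> P {} = {sp_one p} \<and>
     (\<forall>S. finite S \<longrightarrow> \<not> module.dependent (sp_scale p) (P S) \<and>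
        module.span (sp_scale p) (P S) = sp_obj p S)"

definition finite_species_basis ::
  "('u, 'v::ab_group_add, 'k::field, 'm) connected_species_data_scheme \<Rightarrow> ('u set \<Rightarrow> 'v set) \<Rightarrow> bool" where
  "finite_species_basis p P \<longleftrightarrow> species_basis p P \<and> (\<forall>S. finite S \<longrightarrow> finite (P S))"

definition product_restricts ::
  "('u, 'v::ab_group_add, 'k::field, 'm) connected_species_data_scheme \<Rightarrow> ('u, 'v, 'k) product \<Rightarrow>
     ('u set \<Rightarrow> 'v set) \<Rightarrow> 'u set \<Rightarrow> 'u set \<Rightarrow> bool" where
  "product_restricts p nabla P S T \<longleftrightarrow>
     (\<forall>x\<in>P S. \<forall>y\<in>P T. nabla S T (sp_pure p x y) \<in> P (S \<union> T))"

definition coproduct_restricts ::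
  "('u, 'v::ab_group_add, 'k::field, 'm) connected_species_data_scheme \<Rightarrow> ('u, 'v, 'k) coproduct \<Rightarrow>
     ('u set \<Rightarrow> 'v set) \<Rightarrow> 'u set \<Rightarrow> 'u set \<Rightarrow> bool" where
  "coproduct_restricts p Delta P S T \<longleftrightarrow>
     (\<forall>z\<in>P (S \<union> T). \<exists>x\<in>P S. \<exists>y\<in>P T. Delta S T z = sp_pure p x y)"

definition linearized_comonoid ::
  "('u, 'v::ab_group_add, 'k::field, 'm) connected_species_data_scheme \<Rightarrow> ('u, 'v, 'k) coproduct \<Rightarrow>
     ('u set \<Rightarrow> 'v set) \<Rightarrow> bool" where
  "linearized_comonoid p Delta P \<longleftrightarrow> connected_comonoid p Delta \<and> species_basis p P \<and>
     (\<forall>S T. finite S \<and> finite T \<and> S \<inter> T = {} \<longrightarrow> coproduct_restricts p Delta P S T)"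

definition linearized ::
  "('u, 'v::ab_group_add, 'k::field, 'm) connected_species_data_scheme \<Rightarrow> ('u, 'v, 'k) product \<Rightarrow>
     ('u, 'v, 'k) coproduct \<Rightarrow> ('u set \<Rightarrow> 'v set) \<Rightarrow> bool" where
  "linearized p nabla Delta P \<longleftrightarrow> connected_hopf_monoid p nabla Delta \<and> species_basis p P \<and>
     (\<forall>S T. finite S \<and> finite T \<and> S \<inter> T = {} \<longrightarrow>
        product_restricts p nabla P S T \<and> coproduct_restricts p Delta P S T)"

text \<open>\<open>indecomposables p nabla P\<close> is \<open>\<P>(P, \<nabla>)\<close>.\<close>

definition indecomposables ::
  "('u, 'v::ab_group_add, 'k::field, 'm) connected_species_data_scheme \<Rightarrow> ('u, 'v, 'k) product \<Rightarrow>
     ('u set \<Rightarrow> 'v set) \<Rightarrow> 'u set \<Rightarrow> 'v set" where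
  "indecomposables p nabla P I =
     (if I = {} then {}
      else {x \<in> P I. \<forall>S T. S \<union> T = I \<and> S \<inter> T = {} \<and> S \<noteq> {} \<and> T \<noteq> {} \<longrightarrow>
              x \<notin> nabla S T ` sp_tensor p S T})"

definition strongly_linearized ::
  "('u, 'v::ab_group_add, 'k::field, 'm) connected_species_data_scheme \<Rightarrow> ('u, 'v, 'k) product \<Rightarrow>
     ('u, 'v, 'k) coproduct \<Rightarrow> ('u set \<Rightarrow> 'v set) \<Rightarrow> bool" where
  "strongly_linearized p nabla Delta P \<longleftrightarrow> linearized p nabla Delta P \<and>
     (\<forall>S T. finite S \<and> finite T \<and> S \<inter> T = {} \<and> S \<noteq> {} \<and> T \<noteq> {} \<longrightarrow>
        coproduct_restricts p Delta (indecomposables p nabla P) S T)"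

text \<open>
  The connected subspecies \<open>q\<degree>\<close> of \<open>p\<close> spanned by \<open>Q\<close> in nonempty degrees, and its basis. The
  tensor products of its spaces are subspaces of those of \<open>p\<close>, so the restriction of a coproduct
  \<open>\<Delta>\<close> of \<open>p\<close> is \<open>\<Delta>\<close> itself.
\<close>

definition span_connected ::
  "('u, 'v::ab_group_add, 'k::field) connected_species_data \<Rightarrow> ('u set \<Rightarrow> 'v set) \<Rightarrow>
     ('u, 'v, 'k) connected_species_data" where
  "span_connected p Q =
     p\<lparr>sp_obj := (\<lambda>S. if S = {} then sp_obj p {} else module.span (sp_scale p) (Q S))\<rparr>"

definition connected_basis ::
  "('u, 'v, 'k::field, 'm) connected_species_data_scheme \<Rightarrow> ('u set \<Rightarrow> 'v set) \<Rightarrow> 'u set \<Rightarrow> 'v set" where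
  "connected_basis p Q S = (if S = {} then {sp_one p} else Q S)"


section \<open>The Hopf monoid of labeled partitions\<close>

text \<open>
  The free vector species on a set species \<open>X\<close>, with unit \<open>e \<in> X[{}]\<close> (it is connected when
  \<open>X[{}] = {e}\<close>). The element \<open>x\<close> of \<open>X[S]\<close> is identified with \<open>Poly_Mapping.single x 1\<close>.
\<close>

abbreviation free_scale :: "'k::field \<Rightarrow> ('x \<Rightarrow>\<^sub>0 'k) \<Rightarrow> ('x \<Rightarrow>\<^sub>0 'k)" where
  "free_scale c \<equiv> Poly_Mapping.map ((*) c)"

abbreviation free_elem :: "'x \<Rightarrow> ('x \<Rightarrow>\<^sub>0 'k::field)" where
  "free_elem x \<equiv> Poly_Mapping.single x 1"

definition free_connected ::
  "('u, 'x, 'm) species_scheme \<Rightarrow> 'x \<Rightarrow> ('u, 'x \<Rightarrow>\<^sub>0 'k, 'k::field) connected_species_data" where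
  "free_connected X e =
     \<lparr>sp_obj = (\<lambda>S. {u. Poly_Mapping.keys u \<subseteq> sp_obj X S}),
      sp_map = (\<lambda>S \<sigma> u. \<Sum>x\<in>Poly_Mapping.keys u.
                  free_scale (Poly_Mapping.lookup u x) (free_elem (sp_map X S \<sigma> x))),
      sp_scale = free_scale,
      sp_unit = (\<lambda>c. free_scale c (free_elem e)),
      sp_counit = (\<lambda>u. Poly_Mapping.lookup u e)\<rparr>"

definition labeled_partitions :: "('u, 'x, 'm) species_scheme \<Rightarrow> ('u, ('u set \<times> 'x) set) species" where
  "labeled_partitions Q =
     \<lparr>sp_obj = (\<lambda>I. {X. (\<forall>(B, l)\<in>X. B \<noteq> {} \<and> l \<in> sp_obj Q B) \<and>
                       (\<forall>b\<in>X. \<forall>b'\<in>X. b \<noteq> b' \<longrightarrow> fst b \<inter> fst b' = {}) \<and>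
                       (\<Union>b\<in>X. fst b) = I}),
      sp_map = (\<lambda>I \<sigma> X. (\<lambda>(B, l). (\<sigma> ` B, sp_map Q B \<sigma> l)) ` X)\<rparr>"

text \<open>
  Below, \<open>q\<close> is a connected comonoid linearized in the basis \<open>Q\<close>. If \<open>\<lambda> \<in> Q[S \<union> T]\<close>, then
  \<open>coproduct_parts\<close> is the pair \<open>(\<lambda>\<^sub>1, \<lambda>\<^sub>2)\<close> with \<open>\<Delta>\<^sub>S\<^sub>,\<^sub>T(\<lambda>) = \<lambda>\<^sub>1 \<otimes> \<lambda>\<^sub>2\<close>, unique because \<open>Q\<close> is a basis.
\<close>

definition coproduct_parts ::
  "('u, 'v::ab_group_add, 'k::field, 'm) connected_species_data_scheme \<Rightarrow> ('u, 'v, 'k) coproduct \<Rightarrow>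
     ('u set \<Rightarrow> 'v set) \<Rightarrow> 'u set \<Rightarrow> 'u set \<Rightarrow> 'v \<Rightarrow> 'v \<times> 'v" where
  "coproduct_parts q Delta Q S T l =
     (THE ll. fst ll \<in> Q S \<and> snd ll \<in> Q T \<and> Delta S T l = sp_pure q (fst ll) (snd ll))"

definition partition_left where
  "partition_left q Delta Q S T Z =
     {(S \<inter> B, fst (coproduct_parts q Delta Q (S \<inter> B) (T \<inter> B) l)) | B l. (B, l) \<in> Z \<and> S \<inter> B \<noteq> {}}"

definition partition_right where
  "partition_right q Delta Q S T Z =
     {(T \<inter> B, snd (coproduct_parts q Delta Q (S \<inter> B) (T \<inter> B) l)) | B l. (B, l) \<in> Z \<and> T \<inter> B \<noteq> {}}"

definition partition_species ::
  "('u, 'v, 'k::field, 'm) connected_species_data_scheme \<Rightarrow> ('u set \<Rightarrow> 'v set) \<Rightarrow>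
     ('u, ('u set \<times> 'v) set \<Rightarrow>\<^sub>0 'k, 'k) connected_species_data" where
  "partition_species q Q = free_connected (labeled_partitions (subspecies q Q)) {}"

definition partition_product ::
  "('u, 'v, 'k::field, 'm) connected_species_data_scheme \<Rightarrow> ('u set \<Rightarrow> 'v set) \<Rightarrow>
     ('u, ('u set \<times> 'v) set \<Rightarrow>\<^sub>0 'k, 'k) product" where
  "partition_product q Q S T =
     tensor_lift free_scale free_scale
       (sp_obj (partition_species q Q) S) (sp_obj (partition_species q Q) T)
       (\<lambda>u v. \<Sum>X\<in>Poly_Mapping.keys u. \<Sum>Y\<in>Poly_Mapping.keys v.
          free_scale (Poly_Mapping.lookup u X * Poly_Mapping.lookup v Y) (free_elem (X \<union> Y)))"

definition partition_coproduct ::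
  "('u, 'v::ab_group_add, 'k::field, 'm) connected_species_data_scheme \<Rightarrow> ('u, 'v, 'k) coproduct \<Rightarrow>
     ('u set \<Rightarrow> 'v set) \<Rightarrow> ('u, ('u set \<times> 'v) set \<Rightarrow>\<^sub>0 'k, 'k) coproduct" where
  "partition_coproduct q Delta Q S T u =
     (\<Sum>Z\<in>Poly_Mapping.keys u. tensor_scale (Poly_Mapping.lookup u Z)
        (pure_tensor free_scale free_scale
           (free_elem (partition_left q Delta Q S T Z))
           (free_elem (partition_right q Delta Q S T Z))))"

end

theory Submission
  imports Defs
begin

text \<open>
  Everything in a linearized Hopf monoid is determined by what happens on the basis \<open>P\<close>: product
  and coproduct restrict to operations on \<open>P\<close>, and these satisfy the Hopf monoid axioms element by
  element, because a pure tensor of basis elements determines its two factors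
  (\<open>basis_set_hopf_monoid\<close>). So the heart of the matter is a statement about Hopf monoids in set
  species: multiplying the labels of a \<open>Q\<close>-labeled partition of \<open>I\<close> is a bijection onto \<open>P[I]\<close>,
  which turns disjoint union into \<open>\<nabla>\<close> and restriction of the blocks into \<open>\<Delta>\<close>.

  The product of the labels (\<open>block_product\<close>) is well defined because \<open>\<nabla>\<close> is associative and
  commutative. It respects the coproduct by induction on the number of blocks, since \<open>\<Delta>\<close> is
  multiplicative (\<open>block_product_restrict\<close>). It is surjective because an element of \<open>P\<close> outside of
  \<open>Q\<close> is a product of two elements over smaller sets (\<open>block_product_surj\<close>). For injectivity,
  compatibility gives \<open>\<Delta>\<^sub>S\<^sub>,\<^sub>T (\<nabla>\<^sub>S\<^sub>,\<^sub>T (x \<otimes> y)) = x \<otimes> y\<close>, so if \<open>(B, \<lambda>)\<close> is a block of \<open>X\<close>, the left factor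
  of the coproduct of the product of \<open>X\<close> along \<open>I = B \<squnion> (I - B)\<close> is \<open>\<lambda>\<close>. If \<open>Y\<close> has the same product as
  \<open>X\<close>, then \<open>\<lambda>\<close> is also the product of the restrictions to \<open>B\<close> of the labels of \<open>Y\<close>, and by
  strong linearization these restrictions lie in \<open>Q\<close>. As \<open>\<lambda>\<close> is indecomposable, only one block of
  \<open>Y\<close> can meet \<open>B\<close>. Hence each of the two partitions refines the other, they have the same
  blocks, and the labels agree as well (\<open>block_refines\<close>, \<open>block_product_eq_subset\<close>).

  Strong linearization and the counit laws also say that \<open>\<Delta>\<close> preserves \<open>Q\<close> together with the unit,
  so \<open>q\<degree>\<close> is a linearized comonoid.

  Axioms can be pulled back along a bijection that respects the operations, so labeled partitions
  form a Hopf monoid in set species. Linear extension makes \<open>\<S>(q\<degree>, \<Delta>)\<close> a connected Hopf monoid and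
  the linear extension \<open>\<Phi>\<close> of the product of labels an isomorphism onto \<open>p\<close>. There is no other one,
  because every labeled partition is a product of partitions with one block, on which \<open>\<Phi>\<close> is
  prescribed.
\<close>

section \<open>Linear maps on tensor products\<close>

definition subspace_of :: "('k::field \<Rightarrow> 'v::ab_group_add \<Rightarrow> 'v) \<Rightarrow> 'v set \<Rightarrow> bool" where
  "subspace_of s A \<longleftrightarrow> vector_space s \<and> module.subspace s A"

definition bilinear_on where
  "bilinear_on s s' r A B C \<phi> \<longleftrightarrow>
     (\<forall>y\<in>B. linear_on s r A C (\<lambda>x. \<phi> x y)) \<and> (\<forall>x\<in>A. linear_on s' r B C (\<phi> x))"

lemma linear_onD:
  assumes "linear_on s r A C f"
  shows "x \<in> A \<Longrightarrow> f x \<in> C"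
    and "x \<in> A \<Longrightarrow> y \<in> A \<Longrightarrow> f (x + y) = f x + f y"
    and "x \<in> A \<Longrightarrow> f (s c x) = r c (f x)"
  using assms unfolding linear_on_def by auto

lemma linear_on_compose:
  "linear_on s r A B f \<Longrightarrow> linear_on r q B C g \<Longrightarrow> linear_on s q A C (\<lambda>x. g (f x))"
  unfolding linear_on_def by (auto simp: Pi_iff)

lemma linear_on_id: "linear_on s s A A id"
  unfolding linear_on_def by auto

lemma linear_on_mono: "linear_on s r A C f \<Longrightarrow> A' \<subseteq> A \<Longrightarrow> C \<subseteq> C' \<Longrightarrow> linear_on s r A' C' f"
  unfolding linear_on_def by blast

lemma linear_on_zero:
  assumes "vector_space s" "vector_space r" "linear_on s r A C f" "0 \<in> A"
  shows "f 0 = 0"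
proof -
  interpret V: vector_space s by fact
  interpret W: vector_space r by fact
  have "f (s 0 0) = r 0 (f 0)" using linear_onD(3)[OF assms(3,4)] .
  then show ?thesis by simp
qed

lemma linear_on_eq_on_span:
  assumes "vector_space s" "vector_space r"
    and "linear_on s r (module.span s A) C f" "linear_on s r (module.span s A) D g"
    and "\<And>x. x \<in> A \<Longrightarrow> f x = g x" and x: "x \<in> module.span s A"
  shows "f x = g x"
proof -
  interpret V: vector_space s by fact
  interpret W: vector_space r by fact
  have "x \<in> V.span A \<and> f x = g x"
    using x
  proof (induction rule: V.span_induct_alt)
    case base
    then show ?case
      using linear_on_zero[OF assms(1,2,3)] linear_on_zero[OF assms(1,2,4)] V.span_zero by simp
  next
    case (step c x y)
    then show ?case
      using assms(5)[OF step(1)] V.span_base[OF step(1)]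
      by (auto simp: linear_onD[OF assms(3)] linear_onD[OF assms(4)] V.span_add V.span_scale)
  qed
  then show ?thesis ..
qed

lemma linear_on_span_into:
  assumes "vector_space s" and C: "subspace_of r C"
    and f: "linear_on s r (module.span s A) D f" and gen: "\<And>x. x \<in> A \<Longrightarrow> f x \<in> C"
  shows "linear_on s r (module.span s A) C f"
proof -
  interpret V: vector_space s by fact
  interpret W: vector_space r using C by (simp add: subspace_of_def)
  have sub: "W.subspace C" using C by (simp add: subspace_of_def)
  have "f x \<in> C" if "x \<in> V.span A" for x
  proof -
    have "x \<in> V.span A \<and> f x \<in> C"
      using that
    proof (induction rule: V.span_induct_alt)
      case base
      then show ?case
        using linear_on_zero[OF assms(1) W.vector_space_axioms f] V.span_zero W.subspace_0[OF sub] by simp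
    next
      case (step c x y)
      then show ?case
        using gen[OF step(1)] V.span_base[OF step(1)]
        by (auto simp: linear_onD(2,3)[OF f] V.span_add V.span_scale W.subspace_add[OF sub] W.subspace_scale[OF sub])
    qed
    then show ?thesis ..
  qed
  then show ?thesis using f unfolding linear_on_def by auto
qed

lemma subspace_of_span: "vector_space s \<Longrightarrow> subspace_of s (module.span s A)"
  unfolding subspace_of_def using module.subspace_span by (metis module_iff_vector_space)

lemma subspace_of_tensor_space: "subspace_of tensor_scale (tensor_space s s' A B)"
  unfolding tensor_space_def by (rule subspace_of_span[OF vector_space_tensor_scale])

lemma pure_tensor_in_tensor_space:
  "x \<in> A \<Longrightarrow> y \<in> B \<Longrightarrow> pure_tensor s s' x y \<in> tensor_space s s' A B"
  unfolding tensor_space_def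
  by (rule module.span_base) (use vector_space_tensor_scale module_iff_vector_space in auto)

lemma pure_tensor_bilinear:
  "bilinear_on s s' tensor_scale A B (tensor_space s s' A B) (pure_tensor s s')"
  unfolding bilinear_on_def linear_on_def
  by (auto simp: pure_tensor_in_tensor_space)
     (auto simp: pure_tensor_def bilinear_form_def Vector_Spaces.linear_iff tensor_scale_def)

lemma tensor_lift:
  assumes "subspace_of s A" "subspace_of s' B" "subspace_of r C" "bilinear_on s s' r A B C \<phi>"
  shows tensor_lift_linear: "linear_on tensor_scale r (tensor_space s s' A B) C (tensor_lift s s' A B \<phi>)"
    and tensor_lift_pure: "\<lbrakk>x \<in> A; y \<in> B\<rbrakk> \<Longrightarrow> tensor_lift s s' A B \<phi> (pure_tensor s s' x y) = \<phi> x y"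
proof -
  have vs: "vector_space s" "vector_space s'" "vector_space r"
    and sub: "module.subspace s A" "module.subspace s' B" "module.subspace r C"
    using assms(1-3) by (simp_all add: subspace_of_def)
  have phi: "linear_on s r A C (\<lambda>x. \<phi> x y)" if "y \<in> B" for y
    using assms(4) that by (simp add: bilinear_on_def)
  have phi': "linear_on s' r B C (\<phi> x)" if "x \<in> A" for x
    using assms(4) that by (simp add: bilinear_on_def)
  show "linear_on tensor_scale r (tensor_space s s' A B) C (tensor_lift s s' A B \<phi>)"
    by (rule tensor_universal(1)[OF vs sub phi phi'])
  show "tensor_lift s s' A B \<phi> (pure_tensor s s' x y) = \<phi> x y" if "x \<in> A" "y \<in> B"
    by (rule tensor_universal(2)[OF vs sub phi phi' that])
qed

lemma tensor_space_eq:
  assumes "linear_on tensor_scale r (tensor_space s s' A B) C f"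
    "linear_on tensor_scale r (tensor_space s s' A B) D g" "vector_space r"
    "\<And>x y. x \<in> A \<Longrightarrow> y \<in> B \<Longrightarrow> f (pure_tensor s s' x y) = g (pure_tensor s s' x y)"
    "t \<in> tensor_space s s' A B"
  shows "f t = g t"
proof -
  note assms' = assms(1,2,5)[unfolded tensor_space_def]
  show ?thesis
    by (rule linear_on_eq_on_span[OF vector_space_tensor_scale assms(3) assms'(1,2) _ assms'(3)])
      (use assms(4) in auto)
qed

text \<open>
  The reassociation and the interchange of the middle factors are lifts nested in one another, so
  the inner lift has to depend linearly on the arguments of the outer one.
\<close>

lemma tensor_lift_parameter:
  assumes A: "subspace_of s A" "subspace_of s' B" and C: "subspace_of r C" and X: "subspace_of q X"
    and bil: "\<And>x. x \<in> X \<Longrightarrow> bilinear_on s s' r A B C (\<phi> x)"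
    and par: "\<And>a b. a \<in> A \<Longrightarrow> b \<in> B \<Longrightarrow> linear_on q r X C (\<lambda>x. \<phi> x a b)"
    and t: "t \<in> tensor_space s s' A B"
  shows "linear_on q r X C (\<lambda>x. tensor_lift s s' A B (\<phi> x) t)"
proof -
  note lin = tensor_lift_linear[OF A C bil] and pure = tensor_lift_pure[OF A C bil]
  interpret R: vector_space r using C by (simp add: subspace_of_def)
  interpret X: vector_space q using X by (simp add: subspace_of_def)
  have sub: "X.subspace X" "R.subspace C" using X C by (simp_all add: subspace_of_def)
  show ?thesis
    unfolding linear_on_def
  proof (intro conjI ballI allI funcsetI)
    fix x assume "x \<in> X"
    then show "tensor_lift s s' A B (\<phi> x) t \<in> C" using linear_onD(1)[OF lin] t by blast
  next
    fix x y assume x: "x \<in> X" and y: "y \<in> X"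
    have xy: "x + y \<in> X" using x y sub X.subspace_add by blast
    show "tensor_lift s s' A B (\<phi> (x + y)) t = tensor_lift s s' A B (\<phi> x) t + tensor_lift s s' A B (\<phi> y) t"
    proof (rule tensor_space_eq[OF _ _ _ _ t, of r C _ C])
      show "linear_on tensor_scale r (tensor_space s s' A B) C
          (\<lambda>t. tensor_lift s s' A B (\<phi> x) t + tensor_lift s s' A B (\<phi> y) t)"
        using lin[OF x] lin[OF y] sub unfolding linear_on_def
        by (auto simp: Pi_iff algebra_simps R.scale_right_distrib R.subspace_add)
    qed (auto simp: pure x y xy lin linear_onD(2)[OF par] R.vector_space_axioms)
  next
    fix c x assume x: "x \<in> X"
    have cx: "q c x \<in> X" using x sub X.subspace_scale by blast
    show "tensor_lift s s' A B (\<phi> (q c x)) t = r c (tensor_lift s s' A B (\<phi> x) t)"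
    proof (rule tensor_space_eq[OF _ _ _ _ t, of r C _ C])
      show "linear_on tensor_scale r (tensor_space s s' A B) C (\<lambda>t. r c (tensor_lift s s' A B (\<phi> x) t))"
        using lin[OF x] sub unfolding linear_on_def
        by (auto simp: Pi_iff R.scale_right_distrib R.subspace_scale mult.commute)
    qed (auto simp: pure x cx lin linear_onD(3)[OF par] R.vector_space_axioms)
  qed
qed

lemma tensor_map:
  assumes "subspace_of s A" "subspace_of s' B"
    and f: "linear_on s r A C f" and g: "linear_on s' r' B D g"
  shows tensor_map_linear: "linear_on tensor_scale tensor_scale (tensor_space s s' A B) (tensor_space r r' C D)
      (tensor_map s s' r r' A B f g)"
    and tensor_map_pure: "x \<in> A \<Longrightarrow> y \<in> B \<Longrightarrow>
      tensor_map s s' r r' A B f g (pure_tensor s s' x y) = pure_tensor r r' (f x) (g y)"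
proof -
  have "bilinear_on s s' tensor_scale A B (tensor_space r r' C D) (\<lambda>x y. pure_tensor r r' (f x) (g y))"
    unfolding bilinear_on_def
  proof (intro conjI ballI)
    fix y assume "y \<in> B"
    then show "linear_on s tensor_scale A (tensor_space r r' C D) (\<lambda>x. pure_tensor r r' (f x) (g y))"
      using linear_onD(1)[OF g] pure_tensor_bilinear[of r r' C D]
      by (intro linear_on_compose[OF f]) (auto simp: bilinear_on_def)
  next
    fix x assume "x \<in> A"
    then show "linear_on s' tensor_scale B (tensor_space r r' C D) (\<lambda>y. pure_tensor r r' (f x) (g y))"
      using linear_onD(1)[OF f] pure_tensor_bilinear[of r r' C D]
      by (intro linear_on_compose[OF g]) (auto simp: bilinear_on_def)
  qed
  from tensor_lift[OF assms(1,2) subspace_of_tensor_space this]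
  show "linear_on tensor_scale tensor_scale (tensor_space s s' A B) (tensor_space r r' C D)
      (tensor_map s s' r r' A B f g)"
    "x \<in> A \<Longrightarrow> y \<in> B \<Longrightarrow>
      tensor_map s s' r r' A B f g (pure_tensor s s' x y) = pure_tensor r r' (f x) (g y)"
    unfolding tensor_map_def .
qed

lemma linear_on_pure_left:
  "y \<in> B \<Longrightarrow> linear_on s tensor_scale A (tensor_space s s' A B) (\<lambda>x. pure_tensor s s' x y)"
  and linear_on_pure_right:
  "x \<in> A \<Longrightarrow> linear_on s' tensor_scale B (tensor_space s s' A B) (pure_tensor s s' x)"
  using pure_tensor_bilinear[of s s' A B] by (auto simp: bilinear_on_def)

lemma tensor_assoc:
  assumes A: "subspace_of s A" "subspace_of s B" "subspace_of s C"
  shows tensor_assoc_linear: "linear_on tensor_scale tensor_scale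
      (tensor_space tensor_scale s (tensor_space s s A B) C)
      (tensor_space s tensor_scale A (tensor_space s s B C)) (tensor_assoc s A B C)"
    and tensor_assoc_pure: "a \<in> A \<Longrightarrow> b \<in> B \<Longrightarrow> c \<in> C \<Longrightarrow>
      tensor_assoc s A B C (pure_tensor tensor_scale s (pure_tensor s s a b) c) =
      pure_tensor s tensor_scale a (pure_tensor s s b c)"
proof -
  let ?D = "tensor_space s tensor_scale A (tensor_space s s B C)"
  let ?\<phi> = "\<lambda>c a b. pure_tensor s tensor_scale a (pure_tensor s s b c)"
  have bil: "bilinear_on s s tensor_scale A B ?D (?\<phi> c)" if "c \<in> C" for c
    unfolding bilinear_on_def
    using that by (auto intro: linear_on_pure_left pure_tensor_in_tensor_space
        linear_on_compose[OF linear_on_pure_left linear_on_pure_right])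
  have par: "linear_on s tensor_scale C ?D (\<lambda>c. ?\<phi> c a b)" if "a \<in> A" "b \<in> B" for a b
    using that by (auto intro: linear_on_compose[OF linear_on_pure_right linear_on_pure_right])
  note D = subspace_of_tensor_space[of s tensor_scale A "tensor_space s s B C"]
  have "bilinear_on tensor_scale s tensor_scale (tensor_space s s A B) C ?D
      (\<lambda>u c. tensor_lift s s A B (?\<phi> c) u)"
    unfolding bilinear_on_def
    using tensor_lift_linear[OF A(1,2) D bil] tensor_lift_parameter[OF A(1,2) D A(3) bil par] by simp
  note * = tensor_lift[OF subspace_of_tensor_space A(3) D this]
  show "linear_on tensor_scale tensor_scale (tensor_space tensor_scale s (tensor_space s s A B) C) ?D
      (tensor_assoc s A B C)"
    unfolding tensor_assoc_def by (rule *)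
  assume "a \<in> A" "b \<in> B" "c \<in> C"
  then show "tensor_assoc s A B C (pure_tensor tensor_scale s (pure_tensor s s a b) c) =
      pure_tensor s tensor_scale a (pure_tensor s s b c)"
    unfolding tensor_assoc_def
    by (simp add: *(2) pure_tensor_in_tensor_space tensor_lift_pure[OF A(1,2) D bil])
qed

lemma tensor_middle_swap:
  assumes A: "subspace_of s A" "subspace_of s B" "subspace_of s A'" "subspace_of s B'"
  shows tensor_middle_swap_linear: "linear_on tensor_scale tensor_scale
      (tensor_space tensor_scale tensor_scale (tensor_space s s A B) (tensor_space s s A' B'))
      (tensor_space tensor_scale tensor_scale (tensor_space s s A A') (tensor_space s s B B'))
      (tensor_middle_swap s A B A' B')"
    and tensor_middle_swap_pure: "a \<in> A \<Longrightarrow> b \<in> B \<Longrightarrow> a' \<in> A' \<Longrightarrow> b' \<in> B' \<Longrightarrow>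
      tensor_middle_swap s A B A' B'
        (pure_tensor tensor_scale tensor_scale (pure_tensor s s a b) (pure_tensor s s a' b')) =
      pure_tensor tensor_scale tensor_scale (pure_tensor s s a a') (pure_tensor s s b b')"
proof -
  let ?D = "tensor_space tensor_scale tensor_scale (tensor_space s s A A') (tensor_space s s B B')"
  let ?\<phi> = "\<lambda>a b a' b'. pure_tensor tensor_scale tensor_scale (pure_tensor s s a a') (pure_tensor s s b b')"
  note D = subspace_of_tensor_space[of tensor_scale tensor_scale "tensor_space s s A A'" "tensor_space s s B B'"]
  have bil1: "bilinear_on s s tensor_scale A' B' ?D (?\<phi> a b)" if "a \<in> A" "b \<in> B" for a b
    unfolding bilinear_on_def
  proof (intro conjI ballI)
    fix b' assume "b' \<in> B'"
    then show "linear_on s tensor_scale A' ?D (\<lambda>a'. ?\<phi> a b a' b')"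
      by (intro linear_on_compose[OF linear_on_pure_right linear_on_pure_left])
        (simp_all add: that pure_tensor_in_tensor_space)
  next
    fix a' assume "a' \<in> A'"
    then show "linear_on s tensor_scale B' ?D (?\<phi> a b a')"
      by (intro linear_on_compose[OF linear_on_pure_right linear_on_pure_right])
        (simp_all add: that pure_tensor_in_tensor_space)
  qed
  have bil2: "linear_on s tensor_scale A ?D (\<lambda>a. ?\<phi> a b a' b')" if "b \<in> B" "a' \<in> A'" "b' \<in> B'" for b a' b'
    using that by (intro linear_on_compose[OF linear_on_pure_left linear_on_pure_left])
      (simp_all add: pure_tensor_in_tensor_space)
  have bil2': "linear_on s tensor_scale B ?D (\<lambda>b. ?\<phi> a b a' b')" if "a \<in> A" "a' \<in> A'" "b' \<in> B'" for a a' b'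
    using that by (intro linear_on_compose[OF linear_on_pure_left linear_on_pure_right])
      (simp_all add: pure_tensor_in_tensor_space)
  let ?\<psi> = "\<lambda>v a b. tensor_lift s s A' B' (?\<phi> a b) v"
  have bil3: "bilinear_on s s tensor_scale A B ?D (?\<psi> v)" if "v \<in> tensor_space s s A' B'" for v
    unfolding bilinear_on_def
  proof (intro conjI ballI)
    fix b assume b: "b \<in> B"
    show "linear_on s tensor_scale A ?D (\<lambda>a. ?\<psi> v a b)"
      by (rule tensor_lift_parameter[OF A(3,4) D A(1) _ _ that]) (auto intro: bil1 bil2 b)
  next
    fix a assume a: "a \<in> A"
    show "linear_on s tensor_scale B ?D (?\<psi> v a)"
      by (rule tensor_lift_parameter[OF A(3,4) D A(2) _ _ that]) (auto intro: bil1 bil2' a)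
  qed
  have "bilinear_on tensor_scale tensor_scale tensor_scale (tensor_space s s A B) (tensor_space s s A' B') ?D
      (\<lambda>u v. tensor_lift s s A B (?\<psi> v) u)"
    unfolding bilinear_on_def
    using tensor_lift_linear[OF A(1,2) D bil3]
      tensor_lift_parameter[OF A(1,2) D subspace_of_tensor_space bil3 tensor_lift_linear[OF A(3,4) D bil1]]
    by simp
  note * = tensor_lift[OF subspace_of_tensor_space subspace_of_tensor_space D this]
  show "linear_on tensor_scale tensor_scale
      (tensor_space tensor_scale tensor_scale (tensor_space s s A B) (tensor_space s s A' B')) ?D
      (tensor_middle_swap s A B A' B')"
    unfolding tensor_middle_swap_def by (rule *)
  assume "a \<in> A" "b \<in> B" "a' \<in> A'" "b' \<in> B'"
  then show "tensor_middle_swap s A B A' B'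
        (pure_tensor tensor_scale tensor_scale (pure_tensor s s a b) (pure_tensor s s a' b')) =
      pure_tensor tensor_scale tensor_scale (pure_tensor s s a a') (pure_tensor s s b b')"
    unfolding tensor_middle_swap_def
    by (simp add: *(2) pure_tensor_in_tensor_space tensor_lift_pure[OF A(1,2) D bil3]
        tensor_lift_pure[OF A(3,4) D bil1])
qed

text \<open>
  With this, an identity between linear maps on a tensor product has to be checked on pure tensors
  of elements of spanning sets only.
\<close>

lemma tensor_space_span:
  assumes "vector_space s" "vector_space s'"
  shows "tensor_space s s' (module.span s A) (module.span s' B) =
    module.span tensor_scale {pure_tensor s s' x y | x y. x \<in> A \<and> y \<in> B}" (is "_ = ?R")
proof -
  interpret V: vector_space s by fact
  interpret W: vector_space s' by fact
  interpret T: vector_space "tensor_scale :: 'a \<Rightarrow> ('b, 'c, 'a) tensor \<Rightarrow> _"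
    by (rule vector_space_tensor_scale)
  note R = subspace_of_span[OF vector_space_tensor_scale]
  have 1: "pure_tensor s s' x y \<in> ?R" if "x \<in> V.span A" "y \<in> B" for x y
    by (rule linear_onD(1)[OF linear_on_span_into[OF assms(1) R linear_on_pure_left[of y UNIV]] that(1)])
      (auto intro: that T.span_base)
  have 2: "pure_tensor s s' x y \<in> ?R" if "x \<in> V.span A" "y \<in> W.span B" for x y
    by (rule linear_onD(1)[OF linear_on_span_into[OF assms(2) R linear_on_pure_right[of x UNIV]] that(2)])
      (auto intro: that 1)
  show ?thesis
    unfolding tensor_space_def
    by (rule antisym; rule T.span_minimal) (auto intro: 2 V.span_base W.span_base T.span_base)
qed

text \<open>
  A functional that is 1 at \<open>x\<close> and 0 at the other elements of \<open>A\<close> separates the left factors. The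
  right factors are then equal because all functionals agree on them. Independence is asked for on
  the left only, so that the right factor may itself be a tensor, as in the coassociativity law.
\<close>

lemma pure_tensor_inject:
  fixes s :: "'k::field \<Rightarrow> 'v::ab_group_add \<Rightarrow> 'v" and s' :: "'k \<Rightarrow> 'w::ab_group_add \<Rightarrow> 'w"
  assumes vs: "vector_space s" "vector_space s'"
    and A: "\<not> module.dependent s A" "x \<in> A" "x' \<in> A" and y: "y \<noteq> 0"
    and eq: "pure_tensor s s' x y = pure_tensor s s' x' y'"
  shows "x = x'" and "y = y'"
proof -
  interpret V: vector_space s by fact
  interpret W: vector_space s' by fact
  have vk: "vector_space ((*) :: 'k \<Rightarrow> 'k \<Rightarrow> 'k)" by unfold_locales (auto simp: algebra_simps)
  interpret K: vector_space "(*) :: 'k \<Rightarrow> 'k \<Rightarrow> 'k" by (rule vk)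
  interpret VK: vector_space_pair s "(*) :: 'k \<Rightarrow> 'k \<Rightarrow> 'k" by unfold_locales
  interpret WK: vector_space_pair s' "(*) :: 'k \<Rightarrow> 'k \<Rightarrow> 'k" by unfold_locales
  obtain f where f: "Vector_Spaces.linear s (*) f" "\<And>z. z \<in> A \<Longrightarrow> f z = (if z = x then 1 else 0)"
    using VK.linear_independent_extend[OF A(1), of "\<lambda>z. if z = x then 1 else 0"] by auto
  have g: "f x * g y = f x' * g y'" if "Vector_Spaces.linear s' (*) g" for g
  proof -
    have "bilinear_form s s' (\<lambda>a b. f a * g b)"
      using f(1) that by (simp add: bilinear_form_def Vector_Spaces.linear_iff distrib_left distrib_right)
    then show ?thesis using fun_cong[OF eq, of "\<lambda>a b. f a * g b"] by (simp add: pure_tensor_def)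
  qed
  have sep: "z = 0" if "\<And>g. Vector_Spaces.linear s' (*) g \<Longrightarrow> g z = 0" for z
  proof (rule ccontr)
    assume "z \<noteq> 0"
    then have "W.independent {z}" by simp
    from WK.linear_independent_extend[OF this, of "\<lambda>_. 1"]
    obtain g where "Vector_Spaces.linear s' (*) g" "g z = 1" by auto
    then show False using that[of g] by simp
  qed
  show x: "x = x'"
  proof (rule ccontr)
    assume ne: "x \<noteq> x'"
    have "y = 0" by (rule sep) (use g ne f(2) A in auto)
    then show False using y by simp
  qed
  have "y - y' = 0"
  proof (rule sep)
    fix g assume "Vector_Spaces.linear s' (*) g"
    then interpret g: Vector_Spaces.linear s' "(*)" g .
    show "g (y - y') = 0" using g[OF g.linear_axioms] f(2)[OF A(2)] x by (simp add: g.diff)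
  qed
  then show "y = y'" by simp
qed

lemma pure_tensor_nonzero:
  assumes "vector_space s" "vector_space s'" "x \<noteq> 0" "y \<noteq> 0"
  shows "pure_tensor s s' x y \<noteq> 0"
proof
  interpret V: vector_space s by fact
  interpret W: vector_space s' by fact
  assume "pure_tensor s s' x y = 0"
  also have "0 = pure_tensor s s' x 0"
    using linear_on_zero[OF assms(2) vector_space_tensor_scale linear_on_pure_right[of x UNIV]]
    by (metis UNIV_I)
  finally show False
    using pure_tensor_inject(2)[OF assms(1,2), of "{x}" x x y 0] assms(3,4) by simp
qed

section \<open>Hopf monoids in set species\<close>

text \<open>
  A Hopf monoid in set species has the same axioms as a connected Hopf monoid, with Cartesian instead
  of tensor products. Its coproduct is a pair of maps \<open>d1\<close>, \<open>d2\<close>. Connectedness makes the remaining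
  counit laws, \<open>d1 {} S z = e\<close> and \<open>d2 S {} z = e\<close>, automatic.
\<close>

locale set_monoid = set_species F for F :: "('u, 'x, 'm) species_scheme" +
  fixes e :: 'x and mul :: "'u set \<Rightarrow> 'u set \<Rightarrow> 'x \<Rightarrow> 'x \<Rightarrow> 'x"
  assumes obj_empty: "sp_obj F {} = {e}"
    and mul_closed: "\<lbrakk>finite S; finite T; S \<inter> T = {}; x \<in> sp_obj F S; y \<in> sp_obj F T\<rbrakk> \<Longrightarrow>
      mul S T x y \<in> sp_obj F (S \<union> T)"
    and mul_natural: "\<lbrakk>finite S; finite T; S \<inter> T = {}; inj_on \<sigma> (S \<union> T); x \<in> sp_obj F S; y \<in> sp_obj F T\<rbrakk> \<Longrightarrow>
      sp_map F (S \<union> T) \<sigma> (mul S T x y) = mul (\<sigma> ` S) (\<sigma> ` T) (sp_map F S \<sigma> x) (sp_map F T \<sigma> y)"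
    and mul_assoc: "\<lbrakk>finite R; finite S; finite T; R \<inter> S = {}; R \<inter> T = {}; S \<inter> T = {};
        x \<in> sp_obj F R; y \<in> sp_obj F S; z \<in> sp_obj F T\<rbrakk> \<Longrightarrow>
      mul (R \<union> S) T (mul R S x y) z = mul R (S \<union> T) x (mul S T y z)"
    and mul_unit_left: "\<lbrakk>finite S; x \<in> sp_obj F S\<rbrakk> \<Longrightarrow> mul {} S e x = x"
    and mul_unit_right: "\<lbrakk>finite S; x \<in> sp_obj F S\<rbrakk> \<Longrightarrow> mul S {} x e = x"

locale set_comonoid = set_species F for F :: "('u, 'x, 'm) species_scheme" +
  fixes e :: 'x and d1 d2 :: "'u set \<Rightarrow> 'u set \<Rightarrow> 'x \<Rightarrow> 'x"
  assumes obj_empty: "sp_obj F {} = {e}"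
    and d_closed: "\<lbrakk>finite S; finite T; S \<inter> T = {}; z \<in> sp_obj F (S \<union> T)\<rbrakk> \<Longrightarrow>
      d1 S T z \<in> sp_obj F S \<and> d2 S T z \<in> sp_obj F T"
    and d_natural: "\<lbrakk>finite S; finite T; S \<inter> T = {}; inj_on \<sigma> (S \<union> T); z \<in> sp_obj F (S \<union> T)\<rbrakk> \<Longrightarrow>
      d1 (\<sigma> ` S) (\<sigma> ` T) (sp_map F (S \<union> T) \<sigma> z) = sp_map F S \<sigma> (d1 S T z) \<and>
      d2 (\<sigma> ` S) (\<sigma> ` T) (sp_map F (S \<union> T) \<sigma> z) = sp_map F T \<sigma> (d2 S T z)"
    and d_coassoc: "\<lbrakk>finite R; finite S; finite T; R \<inter> S = {}; R \<inter> T = {}; S \<inter> T = {};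
        z \<in> sp_obj F (R \<union> S \<union> T)\<rbrakk> \<Longrightarrow>
      d1 R S (d1 (R \<union> S) T z) = d1 R (S \<union> T) z \<and>
      d2 R S (d1 (R \<union> S) T z) = d1 S T (d2 R (S \<union> T) z) \<and>
      d2 (R \<union> S) T z = d2 S T (d2 R (S \<union> T) z)"
    and d_counit: "\<lbrakk>finite S; z \<in> sp_obj F S\<rbrakk> \<Longrightarrow> d2 {} S z = z \<and> d1 S {} z = z"

locale set_hopf_monoid = set_monoid F e mul + set_comonoid F e d1 d2
  for F :: "('u, 'x, 'm) species_scheme" and e mul d1 d2 +
  assumes d_mul: "\<lbrakk>finite R; finite R'; R \<inter> R' = {}; S \<inter> S' = {}; R \<union> R' = S \<union> S';
        x \<in> sp_obj F R; y \<in> sp_obj F R'\<rbrakk> \<Longrightarrow>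
      d1 S S' (mul R R' x y) =
        mul (R \<inter> S) (R' \<inter> S) (d1 (R \<inter> S) (R \<inter> S') x) (d1 (R' \<inter> S) (R' \<inter> S') y) \<and>
      d2 S S' (mul R R' x y) =
        mul (R \<inter> S') (R' \<inter> S') (d2 (R \<inter> S) (R \<inter> S') x) (d2 (R' \<inter> S) (R' \<inter> S') y)"
begin

lemma d_mul_same:
  assumes "finite S" "finite T" "S \<inter> T = {}" "x \<in> sp_obj F S" "y \<in> sp_obj F T"
  shows "d1 S T (mul S T x y) = x" and "d2 S T (mul S T x y) = y"
proof -
  have [simp]: "T \<inter> S = {}" using assms(3) by auto
  have "d1 {} T y = e" "d2 S {} x = e"
    using d_closed[of "{}" T y] d_closed[of S "{}" x] assms obj_empty by auto
  then show "d1 S T (mul S T x y) = x" "d2 S T (mul S T x y) = y"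
    \<comment> \<open>Of the four intersections in the compatibility law, two are empty and the other two are \<open>S\<close> and \<open>T\<close>.\<close>
    using d_mul[of S T S T x y] assms by (simp_all add: d_counit mul_unit_left mul_unit_right)
qed

end

text \<open>
  Each axiom is an equation between elements of \<open>G[S]\<close>, and it may be checked after applying the
  injective map \<open>f\<close>, where it becomes the corresponding axiom of \<open>F\<close>.
\<close>

lemma set_hopf_monoid_transfer:
  assumes "set_hopf_monoid F e mul d1 d2" and G: "set_species G" "sp_obj G {} = {e'}"
    and inj: "\<And>S. finite S \<Longrightarrow> inj_on (f S) (sp_obj G S)"
    and closed: "\<And>S x. finite S \<Longrightarrow> x \<in> sp_obj G S \<Longrightarrow> f S x \<in> sp_obj F S"
    and nat: "\<And>S \<sigma> x. finite S \<Longrightarrow> inj_on \<sigma> S \<Longrightarrow> x \<in> sp_obj G S \<Longrightarrow>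
      f (\<sigma> ` S) (sp_map G S \<sigma> x) = sp_map F S \<sigma> (f S x)"
    and mul: "\<And>S T x y. finite S \<Longrightarrow> finite T \<Longrightarrow> S \<inter> T = {} \<Longrightarrow> x \<in> sp_obj G S \<Longrightarrow> y \<in> sp_obj G T \<Longrightarrow>
      mul' S T x y \<in> sp_obj G (S \<union> T) \<and> f (S \<union> T) (mul' S T x y) = mul S T (f S x) (f T y)"
    and d: "\<And>S T z. finite S \<Longrightarrow> finite T \<Longrightarrow> S \<inter> T = {} \<Longrightarrow> z \<in> sp_obj G (S \<union> T) \<Longrightarrow>
      d1' S T z \<in> sp_obj G S \<and> d2' S T z \<in> sp_obj G T \<and>
      f S (d1' S T z) = d1 S T (f (S \<union> T) z) \<and> f T (d2' S T z) = d2 S T (f (S \<union> T) z)"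
  shows "set_hopf_monoid G e' mul' d1' d2'"
proof -
  interpret F: set_hopf_monoid F e mul d1 d2 by fact
  interpret G: set_species G by fact
  have eqI: "x = y" if "finite S" "x \<in> sp_obj G S" "y \<in> sp_obj G S" "f S x = f S y" for S x y
    using inj that by (auto dest: inj_onD)
  have fe: "f {} e' = e" "e' \<in> sp_obj G {}" using closed[of "{}" e'] G(2) F.obj_empty by auto
  have mulc: "mul' S T x y \<in> sp_obj G (S \<union> T)" "f (S \<union> T) (mul' S T x y) = mul S T (f S x) (f T y)"
    if "finite S" "finite T" "S \<inter> T = {}" "x \<in> sp_obj G S" "y \<in> sp_obj G T" for S T x y
    using mul[OF that] by auto
  have dc: "d1' S T z \<in> sp_obj G S" "d2' S T z \<in> sp_obj G T"
      "f S (d1' S T z) = d1 S T (f (S \<union> T) z)" "f T (d2' S T z) = d2 S T (f (S \<union> T) z)"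
    if "finite S" "finite T" "S \<inter> T = {}" "z \<in> sp_obj G (S \<union> T)" for S T z
    using d[OF that] by auto
  show ?thesis
  proof
    fix R S T :: "'a set" and x y z
    assume fin: "finite R" "finite S" "finite T" and dis: "R \<inter> S = {}" "R \<inter> T = {}" "S \<inter> T = {}"
      and x: "x \<in> sp_obj G R" "y \<in> sp_obj G S" "z \<in> sp_obj G T"
    have dis': "(R \<union> S) \<inter> T = {}" "R \<inter> (S \<union> T) = {}" using dis by auto
    show "mul' (R \<union> S) T (mul' R S x y) z = mul' R (S \<union> T) x (mul' S T y z)"
    proof (rule eqI)
      show "mul' (R \<union> S) T (mul' R S x y) z \<in> sp_obj G (R \<union> S \<union> T)"
        using fin dis dis' x by (simp add: mulc)
      show "mul' R (S \<union> T) x (mul' S T y z) \<in> sp_obj G (R \<union> S \<union> T)"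
        unfolding Un_assoc using fin dis dis' x by (simp add: mulc)
      have "f (R \<union> S \<union> T) (mul' (R \<union> S) T (mul' R S x y) z) = mul (R \<union> S) T (mul R S (f R x) (f S y)) (f T z)"
        using fin dis dis' x by (simp add: mulc)
      also have "\<dots> = mul R (S \<union> T) (f R x) (mul S T (f S y) (f T z))"
        using fin dis x by (simp add: F.mul_assoc closed)
      also have "\<dots> = f (R \<union> S \<union> T) (mul' R (S \<union> T) x (mul' S T y z))"
        unfolding Un_assoc using fin dis dis' x by (simp add: mulc)
      finally show "f (R \<union> S \<union> T) (mul' (R \<union> S) T (mul' R S x y) z) =
        f (R \<union> S \<union> T) (mul' R (S \<union> T) x (mul' S T y z))" .
    qed (use fin in simp)
  next
    fix S T :: "'a set" and \<sigma> :: "'a \<Rightarrow> 'a" and x y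
    assume fin: "finite S" "finite T" "S \<inter> T = {}" and \<sigma>: "inj_on \<sigma> (S \<union> T)"
      and x: "x \<in> sp_obj G S" "y \<in> sp_obj G T"
    have \<sigma>': "inj_on \<sigma> S" "inj_on \<sigma> T" "\<sigma> ` S \<inter> \<sigma> ` T = {}"
      using \<sigma> fin(3) by (auto intro: inj_on_subset dest: inj_onD)
    show "sp_map G (S \<union> T) \<sigma> (mul' S T x y) = mul' (\<sigma> ` S) (\<sigma> ` T) (sp_map G S \<sigma> x) (sp_map G T \<sigma> y)"
    proof (rule eqI[of "\<sigma> ` (S \<union> T)"])
      show "mul' (\<sigma> ` S) (\<sigma> ` T) (sp_map G S \<sigma> x) (sp_map G T \<sigma> y) \<in> sp_obj G (\<sigma> ` (S \<union> T))"
        unfolding image_Un using fin x \<sigma>' by (simp add: mulc G.map_closed)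
      have "f (\<sigma> ` (S \<union> T)) (sp_map G (S \<union> T) \<sigma> (mul' S T x y)) =
          sp_map F (S \<union> T) \<sigma> (mul S T (f S x) (f T y))"
        using fin x \<sigma> by (simp add: mulc nat)
      also have "\<dots> = mul (\<sigma> ` S) (\<sigma> ` T) (f (\<sigma> ` S) (sp_map G S \<sigma> x)) (f (\<sigma> ` T) (sp_map G T \<sigma> y))"
        using fin x \<sigma> \<sigma>' by (simp add: F.mul_natural closed nat)
      also have "\<dots> = f (\<sigma> ` (S \<union> T)) (mul' (\<sigma> ` S) (\<sigma> ` T) (sp_map G S \<sigma> x) (sp_map G T \<sigma> y))"
        unfolding image_Un using fin x \<sigma>' by (simp add: mulc G.map_closed)
      finally show "f (\<sigma> ` (S \<union> T)) (sp_map G (S \<union> T) \<sigma> (mul' S T x y)) =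
        f (\<sigma> ` (S \<union> T)) (mul' (\<sigma> ` S) (\<sigma> ` T) (sp_map G S \<sigma> x) (sp_map G T \<sigma> y))" .
    qed (use fin x \<sigma> in \<open>auto intro!: mulc G.map_closed\<close>)
  next
    fix S T :: "'a set" and \<sigma> :: "'a \<Rightarrow> 'a" and z
    assume fin: "finite S" "finite T" "S \<inter> T = {}" and \<sigma>: "inj_on \<sigma> (S \<union> T)"
      and z: "z \<in> sp_obj G (S \<union> T)"
    have \<sigma>': "inj_on \<sigma> S" "inj_on \<sigma> T" "\<sigma> ` S \<inter> \<sigma> ` T = {}"
      using \<sigma> fin(3) by (auto intro: inj_on_subset dest: inj_onD)
    have z': "sp_map G (S \<union> T) \<sigma> z \<in> sp_obj G (\<sigma> ` S \<union> \<sigma> ` T)"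
      using G.map_closed[of "S \<union> T" \<sigma> z] fin \<sigma> z by (simp add: image_Un)
    have fz: "f (\<sigma> ` S \<union> \<sigma> ` T) (sp_map G (S \<union> T) \<sigma> z) = sp_map F (S \<union> T) \<sigma> (f (S \<union> T) z)"
      using nat[of "S \<union> T" \<sigma> z] fin \<sigma> z by (simp add: image_Un)
    show "d1' (\<sigma> ` S) (\<sigma> ` T) (sp_map G (S \<union> T) \<sigma> z) = sp_map G S \<sigma> (d1' S T z) \<and>
      d2' (\<sigma> ` S) (\<sigma> ` T) (sp_map G (S \<union> T) \<sigma> z) = sp_map G T \<sigma> (d2' S T z)"
      by (intro conjI; rule eqI[of "\<sigma> ` S"] eqI[of "\<sigma> ` T"])
        (use fin \<sigma> \<sigma>' z z' in \<open>simp_all add: dc nat fz F.d_natural closed G.map_closed\<close>)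
  next
    fix R S T :: "'a set" and z
    assume fin: "finite R" "finite S" "finite T" and dis: "R \<inter> S = {}" "R \<inter> T = {}" "S \<inter> T = {}"
      and z: "z \<in> sp_obj G (R \<union> S \<union> T)"
    have dis': "(R \<union> S) \<inter> T = {}" "R \<inter> (S \<union> T) = {}" using dis by auto
    note z' = z[unfolded Un_assoc]
    have "f (R \<union> S \<union> T) z \<in> sp_obj F (R \<union> S \<union> T)" using closed z fin by simp
    note assoc = F.d_coassoc[OF fin dis this]
    note dz = dc[OF _ _ dis'(1) z] dc[OF _ _ dis'(2) z']
    note dz' = dc[OF _ _ dis(1) dz(1)] dc[OF _ _ dis(3) dz(6)]
    show "d1' R S (d1' (R \<union> S) T z) = d1' R (S \<union> T) z \<and>
      d2' R S (d1' (R \<union> S) T z) = d1' S T (d2' R (S \<union> T) z) \<and>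
      d2' (R \<union> S) T z = d2' S T (d2' R (S \<union> T) z)"
    proof (intro conjI)
      show "d1' R S (d1' (R \<union> S) T z) = d1' R (S \<union> T) z"
        by (rule eqI[OF fin(1)]) (use assoc fin in \<open>simp_all add: dz dz' Un_assoc\<close>)
      show "d2' R S (d1' (R \<union> S) T z) = d1' S T (d2' R (S \<union> T) z)"
        by (rule eqI[OF fin(2)]) (use assoc fin in \<open>simp_all add: dz dz' Un_assoc\<close>)
      show "d2' (R \<union> S) T z = d2' S T (d2' R (S \<union> T) z)"
        by (rule eqI[OF fin(3)]) (use assoc fin in \<open>simp_all add: dz dz' Un_assoc\<close>)
    qed
  next
    fix R R' S S' :: "'a set" and x y
    assume R: "finite R" "finite R'" "R \<inter> R' = {}" and S: "S \<inter> S' = {}" "R \<union> R' = S \<union> S'"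
      and x: "x \<in> sp_obj G R" "y \<in> sp_obj G R'"
    have fS: "finite S" "finite S'" using R S(2) by (metis finite_Un)+
    have mem: "x \<in> sp_obj G ((R \<inter> S) \<union> (R \<inter> S'))" "y \<in> sp_obj G ((R' \<inter> S) \<union> (R' \<inter> S'))"
      using x S(2) by (metis Un_Int_distrib Int_Un_distrib Un_commute inf_sup_absorb sup_inf_absorb)+
    have RR: "(R \<inter> S) \<union> (R \<inter> S') = R" "(R' \<inter> S) \<union> (R' \<inter> S') = R'"
      "(R \<inter> S) \<union> (R' \<inter> S) = S" "(R \<inter> S') \<union> (R' \<inter> S') = S'"
      using S(2) by auto
    have di: "(R \<inter> S) \<inter> (R \<inter> S') = {}" "(R' \<inter> S) \<inter> (R' \<inter> S') = {}"
      "(R \<inter> S) \<inter> (R' \<inter> S) = {}" "(R \<inter> S') \<inter> (R' \<inter> S') = {}"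
      using S(1) R(3) by auto
    have fi: "finite (R \<inter> S)" "finite (R \<inter> S')" "finite (R' \<inter> S)" "finite (R' \<inter> S')" using R by auto
    note dx = dc[OF fi(1,2) di(1) mem(1)] dc[OF fi(3,4) di(2) mem(2)]
    have m: "mul' R R' x y \<in> sp_obj G (S \<union> S')" using mulc[OF R x] S(2) by simp
    note dm = dc[OF fS S(1) m]
    note m1 = mulc[OF fi(1,3) di(3) dx(1,5)] and m2 = mulc[OF fi(2,4) di(4) dx(2,6)]
    have fm: "f (S \<union> S') (mul' R R' x y) = mul R R' (f R x) (f R' y)" using mulc[OF R x] S(2) by simp
    note dF = F.d_mul[OF R S closed[OF R(1) x(1)] closed[OF R(2) x(2)]]
    show "d1' S S' (mul' R R' x y) =
        mul' (R \<inter> S) (R' \<inter> S) (d1' (R \<inter> S) (R \<inter> S') x) (d1' (R' \<inter> S) (R' \<inter> S') y) \<and>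
      d2' S S' (mul' R R' x y) =
        mul' (R \<inter> S') (R' \<inter> S') (d2' (R \<inter> S) (R \<inter> S') x) (d2' (R' \<inter> S) (R' \<inter> S') y)"
    proof (intro conjI)
      show "d1' S S' (mul' R R' x y) =
        mul' (R \<inter> S) (R' \<inter> S) (d1' (R \<inter> S) (R \<inter> S') x) (d1' (R' \<inter> S) (R' \<inter> S') y)"
        using dm m1 dx dF fm RR by (intro eqI[OF fS(1)]) auto
      show "d2' S S' (mul' R R' x y) =
        mul' (R \<inter> S') (R' \<inter> S') (d2' (R \<inter> S) (R \<inter> S') x) (d2' (R' \<inter> S) (R' \<inter> S') y)"
        using dm m2 dx dF fm RR by (intro eqI[OF fS(2)]) auto
    qed
  next
    fix S T :: "'a set" and x y
    assume "finite S" "finite T" "S \<inter> T = {}" "x \<in> sp_obj G S" "y \<in> sp_obj G T"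
    then show "mul' S T x y \<in> sp_obj G (S \<union> T)" by (rule mulc)
  next
    fix S :: "'a set" and x assume S: "finite S" "x \<in> sp_obj G S"
    show "mul' {} S e' x = x"
      by (rule eqI[OF S(1)]) (use mulc[of "{}" S e' x] S closed in \<open>auto simp: fe F.mul_unit_left\<close>)
    show "mul' S {} x e' = x"
      by (rule eqI[OF S(1)]) (use mulc[of S "{}" x e'] S closed in \<open>auto simp: fe F.mul_unit_right\<close>)
    show "d2' {} S x = x \<and> d1' S {} x = x"
      using dc[of "{}" S x] dc[of S "{}" x] F.d_counit[OF S(1) closed[OF S]] S
      by (auto intro!: eqI[OF S(1)])
  next
    fix S T :: "'a set" and z
    assume "finite S" "finite T" "S \<inter> T = {}" "z \<in> sp_obj G (S \<union> T)"
    then show "d1' S T z \<in> sp_obj G S \<and> d2' S T z \<in> sp_obj G T" by (simp add: dc)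
  qed (rule G)
qed

section \<open>Labeled partitions\<close>

lemma labeled_partition_iff:
  "X \<in> sp_obj (labeled_partitions G) I \<longleftrightarrow>
     (\<forall>B l. (B, l) \<in> X \<longrightarrow> B \<noteq> {} \<and> l \<in> sp_obj G B) \<and>
     (\<forall>b\<in>X. \<forall>b'\<in>X. b \<noteq> b' \<longrightarrow> fst b \<inter> fst b' = {}) \<and> \<Union> (fst ` X) = I"
  by (auto simp: labeled_partitions_def)

lemma labeled_partition_block:
  assumes "X \<in> sp_obj (labeled_partitions G) I" "(B, l) \<in> X"
  shows "B \<noteq> {}" "l \<in> sp_obj G B" "B \<subseteq> I"
  using assms by (force simp: labeled_partition_iff)+

lemma labeled_partition_block_unique:
  assumes "X \<in> sp_obj (labeled_partitions G) I" "(B, l) \<in> X" "(C, m) \<in> X" "B \<inter> C \<noteq> {}"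
  shows "B = C" "l = m"
  using assms by (force simp: labeled_partition_iff)+

lemma labeled_partition_cover:
  assumes "X \<in> sp_obj (labeled_partitions G) I" "a \<in> I"
  obtains B l where "(B, l) \<in> X" "a \<in> B"
  using assms by (force simp: labeled_partition_iff)

lemma finite_labeled_partition:
  assumes "X \<in> sp_obj (labeled_partitions G) I" "finite I"
  shows "finite X"
proof (rule finite_imageD)
  show "finite (fst ` X)"
    by (rule finite_subset[of _ "Pow I"]) (use assms labeled_partition_block in \<open>fastforce+\<close>)
  show "inj_on fst X"
    using labeled_partition_block_unique[OF assms(1)] labeled_partition_block(1)[OF assms(1)]
    by (auto simp: inj_on_def)
qed

lemma labeled_partitions_empty: "sp_obj (labeled_partitions G) {} = {{}}"
proof -
  have "X = {}" if X: "X \<in> sp_obj (labeled_partitions G) {}" for X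
  proof (rule equals0I)
    fix b assume "b \<in> X"
    then show False using labeled_partition_block(1,3)[OF X, of "fst b" "snd b"] by simp
  qed
  moreover have "{} \<in> sp_obj (labeled_partitions G) {}" by (simp add: labeled_partition_iff)
  ultimately show ?thesis by blast
qed

lemma labeled_partition_Un:
  assumes "X \<in> sp_obj (labeled_partitions G) I" "Y \<in> sp_obj (labeled_partitions G) J" "I \<inter> J = {}"
  shows "X \<union> Y \<in> sp_obj (labeled_partitions G) (I \<union> J)"
proof -
  have "fst b \<inter> fst c = {} \<and> fst c \<inter> fst b = {}" if "b \<in> X" "c \<in> Y" for b c
    using labeled_partition_block(3)[OF assms(1), of "fst b" "snd b"]
      labeled_partition_block(3)[OF assms(2), of "fst c" "snd c"] assms(3) that by auto
  then show ?thesis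
    using assms(1,2) unfolding labeled_partition_iff image_Un Union_Un_distrib by (metis Un_iff)
qed

lemma labeled_partition_singleton:
  "B \<noteq> {} \<Longrightarrow> l \<in> sp_obj G B \<Longrightarrow> {(B, l)} \<in> sp_obj (labeled_partitions G) B"
  by (auto simp: labeled_partition_iff)

lemma labeled_partition_insert:
  assumes "B \<noteq> {}" "l \<in> sp_obj G B" "X \<in> sp_obj (labeled_partitions G) I" "B \<inter> I = {}"
  shows "insert (B, l) X \<in> sp_obj (labeled_partitions G) (B \<union> I)" "(B, l) \<notin> X"
proof -
  show "insert (B, l) X \<in> sp_obj (labeled_partitions G) (B \<union> I)"
    using labeled_partition_Un[OF labeled_partition_singleton[OF assms(1,2)] assms(3,4)] by simp
  show "(B, l) \<notin> X" using labeled_partition_block(3)[OF assms(3)] assms(1,4) by blast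
qed

lemma labeled_partition_remove:
  assumes "X \<in> sp_obj (labeled_partitions G) I" "(B, l) \<in> X"
  shows "X - {(B, l)} \<in> sp_obj (labeled_partitions G) (I - B)"
proof -
  have "\<Union> (fst ` (X - {(B, l)})) = I - B"
  proof (intro equalityI subsetI)
    fix a assume "a \<in> \<Union> (fst ` (X - {(B, l)}))"
    then obtain b where "b \<in> X" "b \<noteq> (B, l)" "a \<in> fst b" by blast
    then show "a \<in> I - B"
      using labeled_partition_block_unique[OF assms(1) _ assms(2), of "fst b" "snd b"]
        labeled_partition_block(3)[OF assms(1), of "fst b" "snd b"] by (cases b) auto
  next
    fix a assume "a \<in> I - B"
    then show "a \<in> \<Union> (fst ` (X - {(B, l)}))"
      using labeled_partition_cover[OF assms(1)] by (metis Diff_iff UN_I fst_conv singletonD)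
  qed
  moreover have "\<forall>C m. (C, m) \<in> X - {(B, l)} \<longrightarrow> C \<noteq> {} \<and> m \<in> sp_obj G C"
    using labeled_partition_block(1,2)[OF assms(1)] by blast
  ultimately show ?thesis using assms(1) by (simp add: labeled_partition_iff)
qed

lemma labeled_partition_induct [consumes 2, case_names empty insert]:
  assumes "finite I" "X \<in> sp_obj (labeled_partitions G) I"
    and "P {} {}"
    and step: "\<And>B l I X. \<lbrakk>finite B; B \<noteq> {}; l \<in> sp_obj G B; finite I; B \<inter> I = {};
        X \<in> sp_obj (labeled_partitions G) I; P I X\<rbrakk> \<Longrightarrow> P (B \<union> I) (insert (B, l) X)"
  shows "P I X"
proof -
  have "finite X" using finite_labeled_partition assms(1,2) by blast
  then show ?thesis
    using assms(1,2)
  proof (induction "card X" arbitrary: X I)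
    case 0
    then show ?case using assms(3) by (auto simp: labeled_partition_iff)
  next
    case (Suc n)
    have "X \<noteq> {}" using Suc.hyps(2) by auto
    then obtain B l where b: "(B, l) \<in> X" by (metis all_not_in_conv surj_pair)
    have B: "B \<noteq> {}" "l \<in> sp_obj G B" "B \<subseteq> I" using labeled_partition_block[OF Suc.prems(3) b] by auto
    have X: "X - {(B, l)} \<in> sp_obj (labeled_partitions G) (I - B)"
      using labeled_partition_remove[OF Suc.prems(3) b] .
    have "P (B \<union> (I - B)) (insert (B, l) (X - {(B, l)}))"
    proof (rule step)
      show "P (I - B) (X - {(B, l)})"
        using Suc.hyps(2) Suc.prems b X by (intro Suc.hyps(1)) auto
    qed (use B X Suc.prems in \<open>auto intro: finite_subset\<close>)
    then show ?case using B b by (simp add: insert_absorb Un_absorb1)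
  qed
qed

lemma set_species_labeled_partitions:
  fixes G :: "('u, 'x, 'm) species_scheme"
  assumes "set_species G"
  shows "set_species (labeled_partitions G)"
proof -
  interpret G: set_species G by fact
  let ?L = "labeled_partitions G"
  have map: "sp_map ?L I \<sigma> X = (\<lambda>(B, l). (\<sigma> ` B, sp_map G B \<sigma> l)) ` X" for I \<sigma> X
    by (simp add: labeled_partitions_def)
  show ?thesis
  proof
    fix S X and \<sigma> :: "'u \<Rightarrow> 'u" assume S: "finite S" "inj_on \<sigma> S" and X: "X \<in> sp_obj ?L S"
    have b: "B \<noteq> {}" "l \<in> sp_obj G B" "B \<subseteq> S" "finite B" "inj_on \<sigma> B" if "(B, l) \<in> X" for B l
      using labeled_partition_block[OF X that] S by (auto intro: finite_subset inj_on_subset)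
    show "sp_map ?L S \<sigma> X \<in> sp_obj ?L (\<sigma> ` S)"
      unfolding labeled_partition_iff map
    proof (intro conjI allI impI ballI)
      fix B l assume "(B, l) \<in> (\<lambda>(B, l). (\<sigma> ` B, sp_map G B \<sigma> l)) ` X"
      then show "B \<noteq> {}" "l \<in> sp_obj G B" using b by (auto intro: G.map_closed)
    next
      fix c c' assume "c \<in> (\<lambda>(B, l). (\<sigma> ` B, sp_map G B \<sigma> l)) ` X" "c' \<in> (\<lambda>(B, l). (\<sigma> ` B, sp_map G B \<sigma> l)) ` X"
      then obtain B l B' l' where *: "(B, l) \<in> X" "(B', l') \<in> X"
        "c = (\<sigma> ` B, sp_map G B \<sigma> l)" "c' = (\<sigma> ` B', sp_map G B' \<sigma> l')" by auto
      assume "c \<noteq> c'"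
      then have "(B, l) \<noteq> (B', l')" using * by auto
      then have "B \<inter> B' = {}" using labeled_partition_block_unique[OF X *(1,2)] by auto
      then show "fst c \<inter> fst c' = {}"
        using *(3,4) inj_on_image_Int[OF S(2) b(3)[OF *(1)] b(3)[OF *(2)]] by simp
    next
      have "\<Union> (fst ` X) = S" using X by (simp add: labeled_partition_iff)
      then show "\<Union> (fst ` ((\<lambda>(B, l). (\<sigma> ` B, sp_map G B \<sigma> l)) ` X)) = \<sigma> ` S"
        by (auto simp: image_image) force
    qed
    show "sp_map ?L S \<sigma> X = sp_map ?L S \<rho> X" if "\<And>a. a \<in> S \<Longrightarrow> \<sigma> a = \<rho> a" for \<rho> :: "'u \<Rightarrow> 'u"
      unfolding map using that b
      by (intro image_cong refl) (auto intro!: G.map_cong image_cong, blast+)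
    show "sp_map ?L S (\<tau> \<circ> \<sigma>) X = sp_map ?L (\<sigma> ` S) \<tau> (sp_map ?L S \<sigma> X)"
      if \<tau>: "inj_on \<tau> (\<sigma> ` S)" for \<tau> :: "'u \<Rightarrow> 'u"
    proof -
      have "inj_on \<tau> (\<sigma> ` B)" if "(B, l) \<in> X" for B l
        using inj_on_subset[OF \<tau>] b(3)[OF that] by (simp add: image_mono)
      then show ?thesis
        unfolding map image_image using b
        by (intro image_cong refl) (auto intro!: G.map_comp simp: image_image)
    qed
  next
    fix S X assume S: "finite S" and X: "X \<in> sp_obj ?L S"
    have "(\<lambda>(B, l). (id ` B, sp_map G B id l)) b = b" if "b \<in> X" for b
      using labeled_partition_block[OF X, of "fst b" "snd b"] that S
      by (cases b) (auto intro: G.map_id finite_subset)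
    then show "sp_map ?L S id X = X" unfolding map by simp
  qed
qed

text \<open>
  The common form of \<^const>\<open>partition_left\<close> and \<^const>\<open>partition_right\<close>: \<open>d\<close> is one of the two components of
  the coproduct, and \<open>S\<close> is the part that is kept.
\<close>

definition restrict_blocks where
  "restrict_blocks d S T X = {(S \<inter> B, d (S \<inter> B) (T \<inter> B) l) | B l. (B, l) \<in> X \<and> S \<inter> B \<noteq> {}}"

lemma restrict_blocks_closed:
  assumes X: "X \<in> sp_obj (labeled_partitions G) (S \<union> T)" and fin: "finite S" "finite T" "S \<inter> T = {}"
    and d: "\<And>S T l. finite S \<Longrightarrow> finite T \<Longrightarrow> S \<inter> T = {} \<Longrightarrow> S \<noteq> {} \<Longrightarrow> l \<in> sp_obj G (S \<union> T) \<Longrightarrow> d S T l \<in> sp_obj G S"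
  shows "restrict_blocks d S T X \<in> sp_obj (labeled_partitions G) S"
  unfolding labeled_partition_iff
proof (intro conjI allI impI ballI)
  fix C m assume "(C, m) \<in> restrict_blocks d S T X"
  then obtain B l where B: "(B, l) \<in> X" "S \<inter> B \<noteq> {}" "C = S \<inter> B" "m = d (S \<inter> B) (T \<inter> B) l"
    by (auto simp: restrict_blocks_def)
  then show "C \<noteq> {}" by simp
  have "(S \<inter> B) \<union> (T \<inter> B) = B" using labeled_partition_block(3)[OF X B(1)] by auto
  then show "m \<in> sp_obj G C"
    using B fin labeled_partition_block(2)[OF X B(1)] d[of "S \<inter> B" "T \<inter> B" l] by auto
next
  fix c c' assume "c \<in> restrict_blocks d S T X" "c' \<in> restrict_blocks d S T X" and ne: "c \<noteq> c'"
  then obtain B l B' l' where b: "(B, l) \<in> X" "c = (S \<inter> B, d (S \<inter> B) (T \<inter> B) l)"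
    "(B', l') \<in> X" "c' = (S \<inter> B', d (S \<inter> B') (T \<inter> B') l')"
    unfolding restrict_blocks_def by blast
  then have "B \<inter> B' = {}"
    using ne labeled_partition_block_unique[OF X b(1,3)] by auto
  then show "fst c \<inter> fst c' = {}" using b by auto
next
  show "\<Union> (fst ` restrict_blocks d S T X) = S"
  proof (intro equalityI subsetI)
    fix a assume "a \<in> S"
    moreover from this obtain B l where "(B, l) \<in> X" "a \<in> B"
      using labeled_partition_cover[OF X] by blast
    ultimately have "(S \<inter> B, d (S \<inter> B) (T \<inter> B) l) \<in> restrict_blocks d S T X" "a \<in> S \<inter> B"
      unfolding restrict_blocks_def by auto
    then show "a \<in> \<Union> (fst ` restrict_blocks d S T X)" by force
  qed (auto simp: restrict_blocks_def)
qed

section \<open>The product of the labels of a partition\<close>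

locale commutative_set_monoid = set_monoid +
  assumes mul_commute: "\<lbrakk>finite S; finite T; S \<inter> T = {}; x \<in> sp_obj F S; y \<in> sp_obj F T\<rbrakk> \<Longrightarrow>
      mul S T x y = mul T S y x"
begin

text \<open>
  Multiplication of a partial product by one more block, made total by the value \<^const>\<open>None\<close> where it
  is undefined. This way it is left commutative without side conditions, which is what folding over
  a finite set asks for. The domain of the partial product is carried along because \<open>mul\<close> depends on it.
\<close>

fun attach :: "'a set \<times> 'b \<Rightarrow> ('a set \<times> 'b) option \<Rightarrow> ('a set \<times> 'b) option" where
  "attach _ None = None"
| "attach (B, l) (Some (I, x)) =
     (if finite B \<and> finite I \<and> B \<inter> I = {} \<and> l \<in> sp_obj F B \<and> x \<in> sp_obj F I
      then Some (B \<union> I, mul B I l x) else None)"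

lemma attach_attach_None:
  "\<not> (finite B \<and> finite C \<and> finite I \<and> B \<inter> C = {} \<and> B \<inter> I = {} \<and> C \<inter> I = {} \<and>
      l \<in> sp_obj F B \<and> m \<in> sp_obj F C \<and> x \<in> sp_obj F I) \<Longrightarrow>
    attach (B, l) (attach (C, m) (Some (I, x))) = None"
  by (simp add: Int_Un_distrib; blast)

lemma attach_left_commute: "attach b (attach c a) = attach c (attach b a)"
proof (cases a)
  case (Some p)
  obtain B l C m I x where e: "b = (B, l)" "c = (C, m)" "p = (I, x)" by (metis surj_pair)
  show ?thesis
  \<comment> \<open>Either all products involved are defined, or both sides are \<^const>\<open>None\<close>.\<close>
  proof (cases "finite B \<and> finite C \<and> finite I \<and> B \<inter> C = {} \<and> B \<inter> I = {} \<and> C \<inter> I = {} \<and>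
      l \<in> sp_obj F B \<and> m \<in> sp_obj F C \<and> x \<in> sp_obj F I")
    case True
    have "mul B (C \<union> I) l (mul C I m x) = mul (B \<union> C) I (mul B C l m) x"
      using True by (simp add: mul_assoc)
    also have "\<dots> = mul (C \<union> B) I (mul C B m l) x"
      using True mul_commute[of B C l m] by (simp add: Un_commute)
    also have "\<dots> = mul C (B \<union> I) m (mul B I l x)"
      by (rule mul_assoc) (use True in auto)
    finally show ?thesis
      using True Some e by (auto simp: mul_closed)
  next
    case False
    have "attach b (attach c a) = None" "attach c (attach b a) = None"
      unfolding Some e using False by (intro attach_attach_None; blast)+
    then show ?thesis by simp
  qed
qed simp

sublocale attach: comp_fun_commute attach
  by standard (simp add: fun_eq_iff attach_left_commute)

definition block_product :: "('a set \<times> 'b) set \<Rightarrow> 'b" where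
  "block_product X = snd (the (Finite_Set.fold attach (Some ({}, e)) X))"

end

text \<open>
  The labels come from \<open>G\<close>, which is going to be \<open>Q\<close>. As blocks are nonempty, it is over nonempty sets
  that \<open>G\<close> is compared with \<open>F\<close>.
\<close>

locale monoid_blocks = commutative_set_monoid F e mul + G: set_species G
  for F :: "('u, 'x, 'm) species_scheme" and e mul and G :: "('u, 'x, 'n) species_scheme" +
  assumes block_closed: "finite B \<Longrightarrow> B \<noteq> {} \<Longrightarrow> l \<in> sp_obj G B \<Longrightarrow> l \<in> sp_obj F B"
    and block_map: "finite B \<Longrightarrow> inj_on \<sigma> B \<Longrightarrow> B \<noteq> {} \<Longrightarrow> l \<in> sp_obj G B \<Longrightarrow> sp_map G B \<sigma> l = sp_map F B \<sigma> l"
begin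

lemma fold_attach:
  assumes "finite I" "X \<in> sp_obj (labeled_partitions G) I"
  shows "Finite_Set.fold attach (Some ({}, e)) X = Some (I, block_product X)"
    and "block_product X \<in> sp_obj F I"
proof -
  have "\<exists>x\<in>sp_obj F I. Finite_Set.fold attach (Some ({}, e)) X = Some (I, x)"
    using assms
  proof (induction I X rule: labeled_partition_induct)
    case empty
    then show ?case by (simp add: obj_empty)
  next
    case (insert B l I X)
    have "finite X" by (rule finite_labeled_partition[OF insert.hyps(6,4)])
    moreover have "(B, l) \<notin> X" by (rule labeled_partition_insert(2)[OF insert.hyps(2,3,6,5)])
    moreover have "l \<in> sp_obj F B" using block_closed insert.hyps by blast
    ultimately show ?case
      using insert by (auto simp: mul_closed)
  qed
  then show "Finite_Set.fold attach (Some ({}, e)) X = Some (I, block_product X)"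
    and "block_product X \<in> sp_obj F I"
    by (auto simp: block_product_def)
qed

lemma block_product_closed:
  "finite I \<Longrightarrow> X \<in> sp_obj (labeled_partitions G) I \<Longrightarrow> block_product X \<in> sp_obj F I"
  by (rule fold_attach)

lemma block_product_empty: "block_product {} = e"
  by (simp add: block_product_def)

lemma block_product_insert:
  assumes "finite B" "B \<noteq> {}" "l \<in> sp_obj G B" "finite I" "B \<inter> I = {}"
    "X \<in> sp_obj (labeled_partitions G) I"
  shows "block_product (insert (B, l) X) = mul B I l (block_product X)"
proof -
  have "finite X" by (rule finite_labeled_partition[OF assms(6,4)])
  moreover have "(B, l) \<notin> X" by (rule labeled_partition_insert(2)[OF assms(2,3,6,5)])
  ultimately show ?thesis
    using assms fold_attach[OF assms(4,6)] by (simp add: block_product_def[of "insert _ _"] block_closed)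
qed

lemma block_product_remove:
  assumes "finite I" "X \<in> sp_obj (labeled_partitions G) I" "(B, l) \<in> X"
  shows "block_product X = mul B (I - B) l (block_product (X - {(B, l)}))"
proof -
  note B = labeled_partition_block[OF assms(2,3)]
  have "insert (B, l) (X - {(B, l)}) = X" using assms(3) by auto
  moreover have "finite B" using B(3) assms(1) by (rule finite_subset)
  ultimately show ?thesis
    using block_product_insert[OF _ B(1,2) _ _ labeled_partition_remove[OF assms(2,3)]] assms(1) by auto
qed

lemma block_product_singleton:
  "finite B \<Longrightarrow> B \<noteq> {} \<Longrightarrow> l \<in> sp_obj G B \<Longrightarrow> block_product {(B, l)} = l"
  using block_product_insert[of B l "{}" "{}"]
  by (simp add: labeled_partitions_empty block_product_empty mul_unit_right block_closed)

lemma block_product_Un: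
  assumes "finite I" "X \<in> sp_obj (labeled_partitions G) I"
    and J: "finite J" "Y \<in> sp_obj (labeled_partitions G) J" "I \<inter> J = {}"
  shows "block_product (X \<union> Y) = mul I J (block_product X) (block_product Y)"
  using assms(1,2) J(3)
proof (induction I X rule: labeled_partition_induct)
  case empty
  then show ?case using J by (simp add: block_product_empty mul_unit_left block_product_closed)
next
  case (insert B l I X)
  have XY: "X \<union> Y \<in> sp_obj (labeled_partitions G) (I \<union> J)"
    by (rule labeled_partition_Un) (use insert J in auto)
  have "block_product (insert (B, l) X \<union> Y) = mul B (I \<union> J) l (block_product (X \<union> Y))"
    using block_product_insert[OF _ _ _ _ _ XY, of B l] insert J by auto
  also have "\<dots> = mul B (I \<union> J) l (mul I J (block_product X) (block_product Y))"
    using insert by (subst insert.IH) auto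
  also have "\<dots> = mul (B \<union> I) J (mul B I l (block_product X)) (block_product Y)"
    by (rule mul_assoc[symmetric]) (use insert J in \<open>auto intro: block_closed block_product_closed\<close>)
  also have "mul B I l (block_product X) = block_product (insert (B, l) X)"
    using insert by (simp add: block_product_insert)
  finally show ?case .
qed

lemma block_product_natural:
  assumes "finite I" "X \<in> sp_obj (labeled_partitions G) I" and "inj_on \<sigma> I"
  shows "block_product (sp_map (labeled_partitions G) I \<sigma> X) = sp_map F I \<sigma> (block_product X)"
  using assms
proof (induction I X rule: labeled_partition_induct)
  case empty
  have "sp_map F {} \<sigma> e \<in> sp_obj F (\<sigma> ` {})" by (rule map_closed) (auto simp: obj_empty)
  then show ?case by (simp add: labeled_partitions_def block_product_empty obj_empty)
next
  case (insert B l I X)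
  interpret L: set_species "labeled_partitions G"
    by (rule set_species_labeled_partitions) unfold_locales
  have inj: "inj_on \<sigma> B" "inj_on \<sigma> I" "\<sigma> ` B \<inter> \<sigma> ` I = {}"
    using insert by (auto simp: inj_on_Un) 
  have "sp_map (labeled_partitions G) (B \<union> I) \<sigma> (insert (B, l) X) =
      insert (\<sigma> ` B, sp_map G B \<sigma> l) (sp_map (labeled_partitions G) I \<sigma> X)"
    by (simp add: labeled_partitions_def)
  also have "block_product \<dots> = mul (\<sigma> ` B) (\<sigma> ` I) (sp_map G B \<sigma> l) (block_product (sp_map (labeled_partitions G) I \<sigma> X))"
    by (rule block_product_insert)
      (use insert inj in \<open>auto intro: G.map_closed L.map_closed\<close>)
  also have "\<dots> = sp_map F (B \<union> I) \<sigma> (mul B I l (block_product X))"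
    using insert inj by (simp add: block_map mul_natural block_closed block_product_closed)
  also have "mul B I l (block_product X) = block_product (insert (B, l) X)"
    using insert by (simp add: block_product_insert)
  finally show ?case .
qed

text \<open>
  By induction on the blocks: \<open>d\<close> distributes over the product of the first block with the remaining
  ones, and a block that does not meet \<open>S\<close> contributes a unit. The lemma speaks of a single component
  of the coproduct, because the other one is of the same kind with \<open>S\<close> and \<open>T\<close> exchanged.
\<close>

lemma block_product_restrict:
  assumes d_closed: "\<And>S T z. finite S \<Longrightarrow> finite T \<Longrightarrow> S \<inter> T = {} \<Longrightarrow> z \<in> sp_obj F (S \<union> T) \<Longrightarrow> d S T z \<in> sp_obj F S"
    and d_block: "\<And>S T l. finite S \<Longrightarrow> finite T \<Longrightarrow> S \<inter> T = {} \<Longrightarrow> S \<noteq> {} \<Longrightarrow> l \<in> sp_obj G (S \<union> T) \<Longrightarrow> d S T l \<in> sp_obj G S"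
    and d_mul: "\<And>R R' S T x y. \<lbrakk>finite R; finite R'; R \<inter> R' = {}; S \<inter> T = {}; R \<union> R' = S \<union> T;
        x \<in> sp_obj F R; y \<in> sp_obj F R'\<rbrakk> \<Longrightarrow>
      d S T (mul R R' x y) = mul (R \<inter> S) (R' \<inter> S) (d (R \<inter> S) (R \<inter> T) x) (d (R' \<inter> S) (R' \<inter> T) y)"
    and fin: "finite S" "finite T" "S \<inter> T = {}" and X: "X \<in> sp_obj (labeled_partitions G) (S \<union> T)"
  shows "d S T (block_product X) = block_product (restrict_blocks d S T X)"
proof -
  have "d S T (block_product X) = block_product (restrict_blocks d S T X)"
    if "finite I" "X \<in> sp_obj (labeled_partitions G) I" "S \<union> T = I" "S \<inter> T = {}" for I S T X
    using that
  proof (induction I X arbitrary: S T rule: labeled_partition_induct)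
    case empty
    then show ?case
      using d_closed[of "{}" "{}" e] by (simp add: restrict_blocks_def block_product_empty obj_empty)
  next
    case (insert B l I X)
    have e1: "I \<inter> S \<union> I \<inter> T = I" "B \<inter> S \<union> B \<inter> T = B" using insert.prems by auto
    have e2: "(I \<inter> S) \<inter> (I \<inter> T) = {}" "(B \<inter> S) \<inter> (B \<inter> T) = {}" using insert.prems by auto
    have "restrict_blocks d (I \<inter> S) (I \<inter> T) X = restrict_blocks d S T X"
    proof -
      have "(I \<inter> S) \<inter> C = S \<inter> C" "(I \<inter> T) \<inter> C = T \<inter> C" if "(C, m) \<in> X" for C m
        using labeled_partition_block(3)[OF insert.hyps(6) that] by auto
      then show ?thesis unfolding restrict_blocks_def by (intro Collect_cong) metis
    qed
    then have IH: "d (I \<inter> S) (I \<inter> T) (block_product X) = block_product (restrict_blocks d S T X)"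
      using insert.IH[OF e1(1) e2(1)] by simp
    have RX: "restrict_blocks d S T X \<in> sp_obj (labeled_partitions G) (I \<inter> S)"
      using restrict_blocks_closed[of X G "I \<inter> S" "I \<inter> T" d] insert.hyps e1 e2 d_block
        \<open>restrict_blocks d (I \<inter> S) (I \<inter> T) X = _\<close> by simp
    note IP = block_product_closed[OF insert.hyps(4,6)]
    have "d S T (block_product (insert (B, l) X)) = d S T (mul B I l (block_product X))"
      using insert.hyps by (simp add: block_product_insert)
    also have "\<dots> = mul (B \<inter> S) (I \<inter> S) (d (B \<inter> S) (B \<inter> T) l) (block_product (restrict_blocks d S T X))"
      using insert.hyps insert.prems IP by (subst d_mul) (auto simp: IH block_closed)
    also have "\<dots> = block_product (restrict_blocks d S T (insert (B, l) X))"
    proof (cases "B \<inter> S = {}")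
      case True
      have "d {} B l = e"
        using d_closed[of "{}" B l] insert.hyps by (simp add: obj_empty block_closed)
      moreover have "B \<inter> T = B" using True e1 by auto
      moreover have "restrict_blocks d S T (insert (B, l) X) = restrict_blocks d S T X"
        using True by (auto simp: restrict_blocks_def)
      ultimately show ?thesis
        using True insert.hyps RX by (simp add: mul_unit_left block_product_closed)
    next
      case False
      have "restrict_blocks d S T (insert (B, l) X) =
          insert (B \<inter> S, d (B \<inter> S) (B \<inter> T) l) (restrict_blocks d S T X)"
        using False by (auto simp: restrict_blocks_def Int_commute)
      moreover have "d (B \<inter> S) (B \<inter> T) l \<in> sp_obj G (B \<inter> S)"
        using d_block[of "B \<inter> S" "B \<inter> T" l] insert.hyps False e1 e2 by simp
      moreover have "(B \<inter> S) \<inter> (I \<inter> S) = {}" using insert.hyps by auto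
      ultimately show ?thesis
        using block_product_insert[OF _ False _ _ _ RX] insert.hyps by simp
    qed
    finally show ?case .
  qed
  from this[OF _ X refl] fin show ?thesis by simp
qed

end

section \<open>Unique factorization into indecomposables\<close>

text \<open>
  This is what strong linearization says about the operations on the basis \<open>F\<close> and about its
  indecomposable elements \<open>G\<close>.
\<close>

locale block_hopf_monoid = set_hopf_monoid F e mul d1 d2 + monoid_blocks F e mul G
  for F :: "('u, 'x, 'm) species_scheme" and e mul d1 d2 and G :: "('u, 'x, 'n) species_scheme" +
  assumes indecomposable: "\<lbrakk>finite I; I \<noteq> {}; x \<in> sp_obj F I\<rbrakk> \<Longrightarrow>
      x \<in> sp_obj G I \<longleftrightarrow> (\<forall>S T. S \<union> T = I \<and> S \<inter> T = {} \<and> S \<noteq> {} \<and> T \<noteq> {} \<longrightarrow>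
        (\<forall>a\<in>sp_obj F S. \<forall>b\<in>sp_obj F T. x \<noteq> mul S T a b))"
    and d_block: "\<lbrakk>finite S; finite T; S \<inter> T = {}; S \<noteq> {}; T \<noteq> {}; l \<in> sp_obj G (S \<union> T)\<rbrakk> \<Longrightarrow>
      d1 S T l \<in> sp_obj G S \<and> d2 S T l \<in> sp_obj G T"
begin

lemma d_block_nonempty:
  assumes "finite S" "finite T" "S \<inter> T = {}" "l \<in> sp_obj G (S \<union> T)"
  shows "S \<noteq> {} \<Longrightarrow> d1 S T l \<in> sp_obj G S" and "T \<noteq> {} \<Longrightarrow> d2 S T l \<in> sp_obj G T"
proof -
  show "d1 S T l \<in> sp_obj G S" if "S \<noteq> {}"
  proof (cases "T = {}")
    case True
    then show ?thesis using assms that d_counit[of S l] block_closed[of S l] by simp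
  next
    case False
    then show ?thesis using d_block assms that by blast
  qed
  show "d2 S T l \<in> sp_obj G T" if "T \<noteq> {}"
  proof (cases "S = {}")
    case True
    then show ?thesis using assms that d_counit[of T l] block_closed[of T l] by simp
  next
    case False
    then show ?thesis using d_block assms that by blast
  qed
qed

lemma d_block_product:
  assumes "finite S" "finite T" "S \<inter> T = {}" and X: "X \<in> sp_obj (labeled_partitions G) (S \<union> T)"
  shows "d1 S T (block_product X) = block_product (restrict_blocks d1 S T X)"
    and "d2 S T (block_product X) = block_product (restrict_blocks (\<lambda>T S. d2 S T) T S X)"
    and "restrict_blocks d1 S T X \<in> sp_obj (labeled_partitions G) S"
    and "restrict_blocks (\<lambda>T S. d2 S T) T S X \<in> sp_obj (labeled_partitions G) T"
proof -
  have TS: "T \<inter> S = {}" "T \<union> S = S \<union> T" using assms by auto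
  have d2c: "d2 T S z \<in> sp_obj F S" if "finite S" "finite T" "S \<inter> T = {}" "z \<in> sp_obj F (S \<union> T)" for S T z
    using d_closed[of T S z] that by (simp add: Un_commute Int_commute)
  have d2b: "d2 T S l \<in> sp_obj G S" if "finite S" "finite T" "S \<inter> T = {}" "S \<noteq> {}" "l \<in> sp_obj G (S \<union> T)" for S T l
    using d_block_nonempty(2)[of T S l] that by (simp add: Un_commute Int_commute)
  have d2m: "d2 T S (mul R R' x y) =
      mul (R \<inter> S) (R' \<inter> S) (d2 (R \<inter> T) (R \<inter> S) x) (d2 (R' \<inter> T) (R' \<inter> S) y)"
    if "finite R" "finite R'" "R \<inter> R' = {}" "S \<inter> T = {}" "R \<union> R' = S \<union> T" "x \<in> sp_obj F R" "y \<in> sp_obj F R'"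
    for R R' S T x y
    using d_mul[of R R' T S x y] that by (simp add: Un_commute Int_commute)
  show "d1 S T (block_product X) = block_product (restrict_blocks d1 S T X)"
    by (rule block_product_restrict) (use assms in \<open>simp_all add: d_closed d_block_nonempty d_mul\<close>)
  show "d2 S T (block_product X) = block_product (restrict_blocks (\<lambda>T S. d2 S T) T S X)"
    by (rule block_product_restrict[where d = "\<lambda>T S. d2 S T"]) (use assms TS d2c d2b d2m in \<open>simp_all\<close>)
  show "restrict_blocks d1 S T X \<in> sp_obj (labeled_partitions G) S"
    by (rule restrict_blocks_closed) (use assms in \<open>simp_all add: d_block_nonempty\<close>)
  show "restrict_blocks (\<lambda>T S. d2 S T) T S X \<in> sp_obj (labeled_partitions G) T"
    by (rule restrict_blocks_closed) (use assms TS d2b in \<open>simp_all\<close>)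
qed

text \<open>
  A decomposable element splits into factors over smaller sets, so the induction is on the size of \<open>I\<close>.
\<close>

lemma block_product_surj:
  assumes "finite I" "x \<in> sp_obj F I"
  shows "\<exists>X\<in>sp_obj (labeled_partitions G) I. block_product X = x"
  using assms
proof (induction "card I" arbitrary: I x rule: less_induct)
  case less
  consider "I = {}" | "I \<noteq> {}" "x \<in> sp_obj G I" | "I \<noteq> {}" "x \<notin> sp_obj G I" by blast
  then show ?case
  proof cases
    case 1
    then show ?thesis
      using less.prems by (auto simp: labeled_partitions_empty obj_empty block_product_empty)
  next
    case 2
    then show ?thesis
      using less.prems by (intro bexI[of _ "{(I, x)}"])
        (simp_all add: labeled_partition_singleton block_product_singleton)
  next
    case 3
    then obtain S T a b where S: "S \<union> T = I" "S \<inter> T = {}" "S \<noteq> {}" "T \<noteq> {}"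
      and ab: "a \<in> sp_obj F S" "b \<in> sp_obj F T" "x = mul S T a b"
      using indecomposable[of I x] less.prems by blast
    have fin: "finite S" "finite T" using S(1) less.prems(1) by auto
    have "card S < card I" "card T < card I"
      using S less.prems(1) by (auto intro!: psubset_card_mono)
    then obtain X Y where X: "X \<in> sp_obj (labeled_partitions G) S" "block_product X = a"
      and Y: "Y \<in> sp_obj (labeled_partitions G) T" "block_product Y = b"
      using less.hyps fin ab by meson
    then have "X \<union> Y \<in> sp_obj (labeled_partitions G) I" "block_product (X \<union> Y) = x"
      using labeled_partition_Un[OF X(1) Y(1) S(2)] block_product_Un[OF fin(1) X(1) fin(2) Y(1) S(2)] S(1) ab(3)
      by auto
    then show ?thesis by blast
  qed
qed

text \<open>
  The labels can be read off from the product: splitting \<open>I\<close> into \<open>B\<close> and the rest undoes the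
  multiplication by the block \<open>(B, l)\<close>.
\<close>

lemma d1_block_product:
  assumes "finite I" "X \<in> sp_obj (labeled_partitions G) I" "(B, l) \<in> X"
  shows "d1 B (I - B) (block_product X) = l"
proof -
  note B = labeled_partition_block[OF assms(2,3)]
  have fin: "finite B" using B(3) assms(1) by (rule finite_subset)
  show ?thesis
    unfolding block_product_remove[OF assms]
    using assms(1) fin B block_product_closed[OF _ labeled_partition_remove[OF assms(2,3)]]
    by (intro d_mul_same) (auto intro: block_closed)
qed

text \<open>
  The label \<open>l\<close> is the product of the restrictions to \<open>B\<close> of the labels of \<open>Y\<close>. Two or more factors
  would contradict its indecomposability, so \<open>B\<close> meets a single block of \<open>Y\<close>.
\<close>

lemma block_refines:
  assumes I: "finite I" and X: "X \<in> sp_obj (labeled_partitions G) I" and Y: "Y \<in> sp_obj (labeled_partitions G) I"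
    and eq: "block_product X = block_product Y" and b: "(B, l) \<in> X"
  shows "\<exists>C m. (C, m) \<in> Y \<and> B \<subseteq> C"
proof -
  note B = labeled_partition_block[OF X b]
  have fin: "finite B" using B(3) I by (rule finite_subset)
  have BI: "B \<union> (I - B) = I" using B(3) by auto
  define Z where "Z = restrict_blocks d1 B (I - B) Y"
  have Z: "Z \<in> sp_obj (labeled_partitions G) B" "l = block_product Z"
    using d_block_product(1,3)[of B "I - B" Y] d1_block_product[OF I X b] fin I Y BI eq
    by (auto simp: Z_def)
  have "Z \<noteq> {}" using Z(1) B(1) by (auto simp: labeled_partition_iff)
  then obtain C' m' where c: "(C', m') \<in> Z" by (metis all_not_in_conv surj_pair)
  note C = labeled_partition_block[OF Z(1) c]
  have "finite C'" using C(3) fin by (rule finite_subset)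
  have "B - C' = {}"
  proof (rule ccontr)
    assume ne: "B - C' \<noteq> {}"
    have "l = mul C' (B - C') m' (block_product (Z - {(C', m')}))"
      using block_product_remove[OF fin Z(1) c] Z(2) by simp
    moreover have "m' \<in> sp_obj F C'" using C \<open>finite C'\<close> by (intro block_closed)
    moreover have "block_product (Z - {(C', m')}) \<in> sp_obj F (B - C')"
      using labeled_partition_remove[OF Z(1) c] fin by (intro block_product_closed) auto
    moreover have "C' \<union> (B - C') = B" "C' \<inter> (B - C') = {}" using C(3) by auto
    moreover have "l \<noteq> mul S T a b"
      if "S \<union> T = B" "S \<inter> T = {}" "S \<noteq> {}" "T \<noteq> {}" "a \<in> sp_obj F S" "b \<in> sp_obj F T" for S T a b
      using indecomposable[OF fin B(1) block_closed[OF fin B(1,2)]] B(2) that by blast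
    ultimately show False using C(1) ne by blast
  qed
  moreover obtain C m where "(C, m) \<in> Y" "C' = B \<inter> C"
    using c unfolding Z_def restrict_blocks_def by auto
  ultimately show ?thesis by auto
qed

text \<open>
  Refinement in both directions makes a block \<open>B\<close> of \<open>X\<close> a block of \<open>Y\<close>; the label over \<open>B\<close> is then
  recovered from the common product.
\<close>

lemma block_product_eq_subset:
  assumes I: "finite I" and X: "X \<in> sp_obj (labeled_partitions G) I" and Y: "Y \<in> sp_obj (labeled_partitions G) I"
    and eq: "block_product X = block_product Y"
  shows "X \<subseteq> Y"
proof
  fix b assume "b \<in> X"
  moreover obtain B l where bl: "b = (B, l)" by (cases b)
  ultimately have b: "(B, l) \<in> X" by simp
  obtain C m where c: "(C, m) \<in> Y" "B \<subseteq> C" using block_refines[OF I X Y eq b] by blast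
  obtain B' l' where b': "(B', l') \<in> X" "C \<subseteq> B'" using block_refines[OF I Y X eq[symmetric] c(1)] by blast
  have "B \<inter> B' \<noteq> {}" using labeled_partition_block(1)[OF X b] c b' by auto
  then have "B = B'" using labeled_partition_block_unique[OF X b b'(1)] by simp
  then have BC: "C = B" using c b' by auto
  have "l = m"
    using d1_block_product[OF I X b] d1_block_product[OF I Y c(1)] eq BC by simp
  then show "b \<in> Y" using bl c BC by simp
qed

lemma bij_betw_block_product:
  assumes "finite I"
  shows "bij_betw block_product (sp_obj (labeled_partitions G) I) (sp_obj F I)"
  unfolding bij_betw_def inj_on_def
  using block_product_eq_subset[OF assms] block_product_surj[OF assms] block_product_closed[OF assms]
  by (metis (no_types, lifting) image_eqI image_subsetI subsetI subset_antisym)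

text \<open>
  The axioms are inherited from \<open>F\<close> by way of the injective \<open>block_product\<close>; coassociativity and
  compatibility never have to be checked block by block.
\<close>

lemma labeled_partitions_hopf_monoid:
  "set_hopf_monoid (labeled_partitions G) {} (\<lambda>S T X Y. X \<union> Y) (restrict_blocks d1)
     (\<lambda>S T. restrict_blocks (\<lambda>T S. d2 S T) T S)"
proof (rule set_hopf_monoid_transfer[where f = "\<lambda>_. block_product"])
  show "set_hopf_monoid F e mul d1 d2" by unfold_locales
  show "set_species (labeled_partitions G)"
    by (rule set_species_labeled_partitions) unfold_locales
  show "inj_on block_product (sp_obj (labeled_partitions G) S)" if "finite S" for S
    using bij_betw_block_product[OF that] by (rule bij_betw_imp_inj_on)
qed (use d_block_product block_product_natural block_product_closed in
    \<open>simp_all add: labeled_partitions_empty labeled_partition_Un block_product_Un\<close>)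

end

section \<open>Linear extension of set-theoretic structures\<close>

context connected_species
begin

lemma obj_subspace_of: "finite S \<Longrightarrow> subspace_of (sp_scale p) (sp_obj p S)"
  unfolding subspace_of_def using obj_subspace vector_space_axioms by blast

end

lemma image_disjoint:
  "inj_on \<sigma> (S \<union> T) \<Longrightarrow> S \<inter> T = {} \<Longrightarrow> inj_on \<sigma> S \<and> inj_on \<sigma> T \<and> \<sigma> ` S \<inter> \<sigma> ` T = {}"
  by (auto simp: inj_on_Un)

text \<open>
  A species together with a set species that spans it. The spanning elements are given by a map \<open>b\<close>
  rather than as subsets, so that both a basis of \<open>q\<degree>\<close> (with \<open>b = id\<close>) and the generators of a free
  species (with \<open>b\<close> = \<^term>\<open>free_elem\<close>) are covered.
\<close>

locale spanned_species = connected_species p + F: set_species F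
  for p :: "('u, 'v::ab_group_add, 'k::field, 'm) connected_species_data_scheme"
    and F :: "('u, 'x, 'n) species_scheme" +
  fixes b :: "'x \<Rightarrow> 'v"
  assumes obj_span: "finite S \<Longrightarrow> sp_obj p S = module.span (sp_scale p) (b ` sp_obj F S)"
    and map_b: "\<lbrakk>finite S; inj_on \<sigma> S; x \<in> sp_obj F S\<rbrakk> \<Longrightarrow> sp_map p S \<sigma> (b x) = b (sp_map F S \<sigma> x)"
begin

lemma b_in_obj: "finite S \<Longrightarrow> x \<in> sp_obj F S \<Longrightarrow> b x \<in> sp_obj p S"
  by (simp add: obj_span span_base)

lemma linear_eq:
  assumes "finite S" "linear_on (sp_scale p) r (sp_obj p S) C f" "linear_on (sp_scale p) r (sp_obj p S) D g"
    "vector_space r" "\<And>x. x \<in> sp_obj F S \<Longrightarrow> f (b x) = g (b x)" "x \<in> sp_obj p S"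
  shows "f x = g x"
proof -
  note l = assms(2,3,6)[unfolded obj_span[OF assms(1)]]
  show ?thesis
    by (rule linear_on_eq_on_span[OF vector_space_axioms assms(4) l(1,2) _ l(3)]) (use assms(5) in auto)
qed

lemma tensor_spanned:
  assumes "finite S" "finite T"
  shows "sp_tensor p S T = module.span tensor_scale
    {sp_pure p x y | x y. x \<in> b ` sp_obj F S \<and> y \<in> b ` sp_obj F T}"
  unfolding obj_span[OF assms(1)] obj_span[OF assms(2)]
  by (rule tensor_space_span[OF vector_space_axioms vector_space_axioms])

lemma tensor_eq:
  assumes fin: "finite S" "finite T"
    and "linear_on tensor_scale r (sp_tensor p S T) C f" "linear_on tensor_scale r (sp_tensor p S T) D g"
    and "vector_space r"
    and eq: "\<And>x y. x \<in> sp_obj F S \<Longrightarrow> y \<in> sp_obj F T \<Longrightarrow> f (sp_pure p (b x) (b y)) = g (sp_pure p (b x) (b y))"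
    and "t \<in> sp_tensor p S T"
  shows "f t = g t"
proof -
  note l = assms(3,4,7)[unfolded tensor_spanned[OF fin]]
  show ?thesis
    by (rule linear_on_eq_on_span[OF vector_space_tensor_scale assms(5) l(1,2) _ l(3)]) (use eq in auto)
qed

lemma tensor3_eq:
  assumes fin: "finite R" "finite S" "finite T"
    and "linear_on tensor_scale r (tensor_space tensor_scale (sp_scale p) (sp_tensor p R S) (sp_obj p T)) C f"
    and "linear_on tensor_scale r (tensor_space tensor_scale (sp_scale p) (sp_tensor p R S) (sp_obj p T)) D g"
    and "vector_space r"
    and eq: "\<And>x y z. x \<in> sp_obj F R \<Longrightarrow> y \<in> sp_obj F S \<Longrightarrow> z \<in> sp_obj F T \<Longrightarrow>
      f (pure_tensor tensor_scale (sp_scale p) (sp_pure p (b x) (b y)) (b z)) =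
      g (pure_tensor tensor_scale (sp_scale p) (sp_pure p (b x) (b y)) (b z))"
    and "t \<in> tensor_space tensor_scale (sp_scale p) (sp_tensor p R S) (sp_obj p T)"
  shows "f t = g t"
proof -
  note l = assms(4,5,8)[unfolded tensor_spanned[OF fin(1,2)] obj_span[OF fin(3)]
      tensor_space_span[OF vector_space_tensor_scale vector_space_axioms]]
  show ?thesis
    by (rule linear_on_eq_on_span[OF vector_space_tensor_scale assms(6) l(1,2) _ l(3)]) (use eq in auto)
qed

text \<open>
  Both sides of each axiom are linear, so the axiom holds as soon as it holds for the spanning
  elements, where it is the axiom of the set-theoretic structure. The same argument gives the
  lemmas after it.
\<close>

lemma linear_extension_monoid:
  assumes M: "set_monoid F e mul" and one: "b e = sp_one p"
    and lin: "\<And>S T. finite S \<Longrightarrow> finite T \<Longrightarrow> S \<inter> T = {} \<Longrightarrow>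
      linear_on tensor_scale (sp_scale p) (sp_tensor p S T) (sp_obj p (S \<union> T)) (nabla S T)"
    and nabla: "\<And>S T x y. finite S \<Longrightarrow> finite T \<Longrightarrow> S \<inter> T = {} \<Longrightarrow> x \<in> sp_obj F S \<Longrightarrow> y \<in> sp_obj F T \<Longrightarrow>
      nabla S T (sp_pure p (b x) (b y)) = b (mul S T x y)"
  shows "connected_monoid p nabla"
proof (rule connected_monoid.intro[OF connected_species_axioms connected_monoid_axioms.intro])
  interpret M: set_monoid F e mul by (rule M)
  note sub = obj_subspace_of
  fix S T :: "'u set"
  assume S: "finite S"
  {
    assume T: "finite T" "S \<inter> T = {}"
    show "linear_on tensor_scale (sp_scale p) (sp_tensor p S T) (sp_obj p (S \<union> T)) (nabla S T)"
      using S T by (rule lin)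
    fix \<sigma> :: "'u \<Rightarrow> 'u" and t assume \<sigma>: "inj_on \<sigma> (S \<union> T)" and t: "t \<in> sp_tensor p S T"
    note \<sigma>' = conjunct1[OF image_disjoint[OF \<sigma> T(2)]] conjunct2[OF image_disjoint[OF \<sigma> T(2)]]
    note map1 = map_linear[OF S \<sigma>'(1)] and map2 = map_linear[OF T(1) conjunct1[OF \<sigma>'(2)]]
    note tm = tensor_map[OF sub[OF S] sub[OF T(1)] map1 map2]
    have fin: "finite (S \<union> T)" "finite (\<sigma> ` S)" "finite (\<sigma> ` T)" using S T by auto
    show "sp_map p (S \<union> T) \<sigma> (nabla S T t) = nabla (\<sigma> ` S) (\<sigma> ` T)
        (tensor_map (sp_scale p) (sp_scale p) (sp_scale p) (sp_scale p) (sp_obj p S) (sp_obj p T)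
           (sp_map p S \<sigma>) (sp_map p T \<sigma>) t)"
    proof (rule tensor_eq[OF S T(1) _ _ vector_space_axioms _ t])
      show "linear_on tensor_scale (sp_scale p) (sp_tensor p S T) (sp_obj p (\<sigma> ` (S \<union> T)))
          (\<lambda>t. sp_map p (S \<union> T) \<sigma> (nabla S T t))"
        by (rule linear_on_compose[OF lin[OF S T] map_linear[OF fin(1) \<sigma>]])
      show "linear_on tensor_scale (sp_scale p) (sp_tensor p S T) (sp_obj p (\<sigma> ` S \<union> \<sigma> ` T))
          (\<lambda>t. nabla (\<sigma> ` S) (\<sigma> ` T) (tensor_map (sp_scale p) (sp_scale p) (sp_scale p) (sp_scale p)
            (sp_obj p S) (sp_obj p T) (sp_map p S \<sigma>) (sp_map p T \<sigma>) t))"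
        by (rule linear_on_compose[OF tm(1) lin[OF fin(2,3) conjunct2[OF \<sigma>'(2)]]])
      fix x y assume "x \<in> sp_obj F S" "y \<in> sp_obj F T"
      then show "sp_map p (S \<union> T) \<sigma> (nabla S T (sp_pure p (b x) (b y))) = nabla (\<sigma> ` S) (\<sigma> ` T)
        (tensor_map (sp_scale p) (sp_scale p) (sp_scale p) (sp_scale p) (sp_obj p S) (sp_obj p T)
           (sp_map p S \<sigma>) (sp_map p T \<sigma>) (sp_pure p (b x) (b y)))"
        using S T \<sigma> \<sigma>' fin
        by (simp add: tm(2) b_in_obj nabla map_b M.mul_closed M.mul_natural F.map_closed)
    qed
  }
  {
    fix R :: "'u set" and u
    assume R: "finite R" and T: "finite T" and dis: "R \<inter> S = {}" "R \<inter> T = {}" "S \<inter> T = {}"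
      and u: "u \<in> tensor_space tensor_scale (sp_scale p) (sp_tensor p R S) (sp_obj p T)"
    have dis': "(R \<union> S) \<inter> T = {}" "R \<inter> (S \<union> T) = {}" using dis by auto
    have fin: "finite (R \<union> S)" "finite (S \<union> T)" using R S T by auto
    note as = tensor_assoc[OF sub[OF R] sub[OF S] sub[OF T]]
    note t1 = tensor_map[OF subspace_of_tensor_space sub[OF T] lin[OF R S dis(1)] linear_on_id]
    note t2 = tensor_map[OF sub[OF R] subspace_of_tensor_space linear_on_id lin[OF S T dis(3)]]
    show "nabla (R \<union> S) T
        (tensor_map tensor_scale (sp_scale p) (sp_scale p) (sp_scale p)
           (sp_tensor p R S) (sp_obj p T) (nabla R S) id u) =
      nabla R (S \<union> T)
        (tensor_map (sp_scale p) tensor_scale (sp_scale p) (sp_scale p)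
           (sp_obj p R) (sp_tensor p S T) id (nabla S T)
           (tensor_assoc (sp_scale p) (sp_obj p R) (sp_obj p S) (sp_obj p T) u))"
      by (rule tensor3_eq[OF R S T linear_on_compose[OF t1(1) lin[OF fin(1) T dis'(1)]]
          linear_on_compose[OF linear_on_compose[OF as(1) t2(1)] lin[OF R fin(2) dis'(2)]]
          vector_space_axioms _ u])
        (use R S T dis dis' fin in \<open>simp add: t1(2) t2(2) as(2) b_in_obj pure_tensor_in_tensor_space nabla
          M.mul_closed M.mul_assoc\<close>)
  }
  fix x assume x: "x \<in> sp_obj p S"
  have one_in: "sp_one p \<in> sp_obj p {}" using linear_onD(1)[OF unit_linear] by simp
  have e: "e \<in> sp_obj F {}" by (simp add: M.obj_empty)
  note id = linear_on_id[of "sp_scale p" "sp_obj p S", unfolded id_def]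
  have lin0: "linear_on tensor_scale (sp_scale p) (sp_tensor p {} S) (sp_obj p S) (nabla {} S)"
    "linear_on tensor_scale (sp_scale p) (sp_tensor p S {}) (sp_obj p S) (nabla S {})"
    using lin[of "{}" S] lin[of S "{}"] S by simp_all
  show "nabla {} S (sp_pure p (sp_one p) x) = x"
    by (rule linear_eq[OF S linear_on_compose[OF linear_on_pure_right[OF one_in] lin0(1)] id vector_space_axioms _ x])
      (use nabla[of "{}" S e] S e in \<open>simp add: one[symmetric] M.mul_unit_left\<close>)
  show "nabla S {} (sp_pure p x (sp_one p)) = x"
    by (rule linear_eq[OF S linear_on_compose[OF linear_on_pure_left[OF one_in] lin0(2)] id vector_space_axioms _ x])
      (use nabla[of S "{}" _ e] S e in \<open>simp add: one[symmetric] M.mul_unit_right\<close>)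
qed

lemma linear_extension_comonoid:
  assumes M: "set_comonoid F e d1 d2" and one: "b e = sp_one p"
    and lin: "\<And>S T. finite S \<Longrightarrow> finite T \<Longrightarrow> S \<inter> T = {} \<Longrightarrow>
      linear_on (sp_scale p) tensor_scale (sp_obj p (S \<union> T)) (sp_tensor p S T) (Delta S T)"
    and Delta: "\<And>S T z. finite S \<Longrightarrow> finite T \<Longrightarrow> S \<inter> T = {} \<Longrightarrow> z \<in> sp_obj F (S \<union> T) \<Longrightarrow>
      Delta S T (b z) = sp_pure p (b (d1 S T z)) (b (d2 S T z))"
  shows "connected_comonoid p Delta"
proof (rule connected_comonoid.intro[OF connected_species_axioms connected_comonoid_axioms.intro])
  interpret M: set_comonoid F e d1 d2 by (rule M)
  note sub = obj_subspace_of and vt = vector_space_tensor_scale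
  fix S T :: "'u set"
  assume S: "finite S"
  {
    assume T: "finite T" "S \<inter> T = {}"
    show "linear_on (sp_scale p) tensor_scale (sp_obj p (S \<union> T)) (sp_tensor p S T) (Delta S T)"
      using S T by (rule lin)
    fix \<sigma> :: "'u \<Rightarrow> 'u" and x assume \<sigma>: "inj_on \<sigma> (S \<union> T)" and x: "x \<in> sp_obj p (S \<union> T)"
    note \<sigma>' = conjunct1[OF image_disjoint[OF \<sigma> T(2)]] conjunct2[OF image_disjoint[OF \<sigma> T(2)]]
    note map1 = map_linear[OF S \<sigma>'(1)] and map2 = map_linear[OF T(1) conjunct1[OF \<sigma>'(2)]]
    note tm = tensor_map[OF sub[OF S] sub[OF T(1)] map1 map2]
    have fin: "finite (S \<union> T)" "finite (\<sigma> ` S)" "finite (\<sigma> ` T)" using S T by auto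
    note map3 = map_linear[OF fin(1) \<sigma>, unfolded image_Un]
    have mapF: "sp_map F (S \<union> T) \<sigma> z \<in> sp_obj F (\<sigma> ` S \<union> \<sigma> ` T)" if "z \<in> sp_obj F (S \<union> T)" for z
      using F.map_closed[OF fin(1) \<sigma> that] by (simp add: image_Un)
    show "Delta (\<sigma> ` S) (\<sigma> ` T) (sp_map p (S \<union> T) \<sigma> x) =
      tensor_map (sp_scale p) (sp_scale p) (sp_scale p) (sp_scale p) (sp_obj p S) (sp_obj p T)
        (sp_map p S \<sigma>) (sp_map p T \<sigma>) (Delta S T x)"
      by (rule linear_eq[OF fin(1) linear_on_compose[OF map3 lin[OF fin(2,3) conjunct2[OF \<sigma>'(2)]]]
          linear_on_compose[OF lin[OF S T] tm(1)] vt _ x])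
        (use S T \<sigma> \<sigma>' fin M.d_closed mapF in \<open>simp add: tm(2) b_in_obj Delta map_b M.d_natural\<close>)
  }
  {
    fix R :: "'u set" and x
    assume R: "finite R" and T: "finite T" and dis: "R \<inter> S = {}" "R \<inter> T = {}" "S \<inter> T = {}"
      and x: "x \<in> sp_obj p (R \<union> S \<union> T)"
    have dis': "(R \<union> S) \<inter> T = {}" "R \<inter> (S \<union> T) = {}" using dis by auto
    have fin: "finite (R \<union> S)" "finite (S \<union> T)" "finite (R \<union> S \<union> T)" using R S T by auto
    note as = tensor_assoc[OF sub[OF R] sub[OF S] sub[OF T]]
    note t1 = tensor_map[OF sub[OF fin(1)] sub[OF T] lin[OF R S dis(1)] linear_on_id]
    note t2 = tensor_map[OF sub[OF R] sub[OF fin(2)] linear_on_id lin[OF S T dis(3)]]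
    show "tensor_assoc (sp_scale p) (sp_obj p R) (sp_obj p S) (sp_obj p T)
        (tensor_map (sp_scale p) (sp_scale p) tensor_scale (sp_scale p)
           (sp_obj p (R \<union> S)) (sp_obj p T) (Delta R S) id (Delta (R \<union> S) T x)) =
      tensor_map (sp_scale p) (sp_scale p) (sp_scale p) tensor_scale
        (sp_obj p R) (sp_obj p (S \<union> T)) id (Delta S T) (Delta R (S \<union> T) x)"
    proof (rule linear_eq[OF fin(3) linear_on_compose[OF linear_on_compose[OF lin[OF fin(1) T dis'(1)] t1(1)] as(1)]
          linear_on_compose[OF lin[OF R fin(2) dis'(2), folded Un_assoc] t2(1)] vt _ x])
      fix z assume z: "z \<in> sp_obj F (R \<union> S \<union> T)"
      note z' = z[unfolded Un_assoc]
      note c1 = M.d_closed[OF fin(1) T dis'(1) z] and c2 = M.d_closed[OF R fin(2) dis'(2) z']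
      note c3 = M.d_closed[OF R S dis(1) conjunct1[OF c1]] and c4 = M.d_closed[OF S T dis(3) conjunct2[OF c2]]
      have "d1 R S (d1 (R \<union> S) T z) = d1 R (S \<union> T) z" "d2 R S (d1 (R \<union> S) T z) = d1 S T (d2 R (S \<union> T) z)"
        "d2 (R \<union> S) T z = d2 S T (d2 R (S \<union> T) z)"
        using M.d_coassoc[OF R S T dis z] by auto
      then show "tensor_assoc (sp_scale p) (sp_obj p R) (sp_obj p S) (sp_obj p T)
        (tensor_map (sp_scale p) (sp_scale p) tensor_scale (sp_scale p)
           (sp_obj p (R \<union> S)) (sp_obj p T) (Delta R S) id (Delta (R \<union> S) T (b z))) =
      tensor_map (sp_scale p) (sp_scale p) (sp_scale p) tensor_scale
        (sp_obj p R) (sp_obj p (S \<union> T)) id (Delta S T) (Delta R (S \<union> T) (b z))"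
        using R S T dis dis' fin c1 c2 c3 c4 z z'
        by (simp add: t1(2) t2(2) as(2) b_in_obj Delta)
    qed
  }
  fix x assume x: "x \<in> sp_obj p S"
  have one_in: "sp_one p \<in> sp_obj p {}" using linear_onD(1)[OF unit_linear] by simp
  have lin0: "linear_on (sp_scale p) tensor_scale (sp_obj p S) (sp_tensor p {} S) (Delta {} S)"
    "linear_on (sp_scale p) tensor_scale (sp_obj p S) (sp_tensor p S {}) (Delta S {})"
    using lin[of "{}" S] lin[of S "{}"] S by simp_all
  have e: "d1 {} S z = e" "d2 S {} z = e" "d2 {} S z = z" "d1 S {} z = z" if "z \<in> sp_obj F S" for z
    using M.d_closed[of "{}" S z] M.d_closed[of S "{}" z] M.d_counit[of S z] S that by (auto simp: M.obj_empty)
  show "Delta {} S x = sp_pure p (sp_one p) x"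
    by (rule linear_eq[OF S lin0(1) linear_on_pure_right[OF one_in] vt _ x])
      (use Delta[of "{}" S] S e in \<open>simp add: one[symmetric]\<close>)
  show "Delta S {} x = sp_pure p x (sp_one p)"
    by (rule linear_eq[OF S lin0(2) linear_on_pure_left[OF one_in] vt _ x])
      (use Delta[of S "{}"] S e in \<open>simp add: one[symmetric]\<close>)
qed

lemma linear_extension_hopf_monoid:
  assumes M: "set_hopf_monoid F e mul d1 d2" and one: "b e = sp_one p"
    and lin: "\<And>S T. finite S \<Longrightarrow> finite T \<Longrightarrow> S \<inter> T = {} \<Longrightarrow>
      linear_on tensor_scale (sp_scale p) (sp_tensor p S T) (sp_obj p (S \<union> T)) (nabla S T)"
    and nabla: "\<And>S T x y. finite S \<Longrightarrow> finite T \<Longrightarrow> S \<inter> T = {} \<Longrightarrow> x \<in> sp_obj F S \<Longrightarrow> y \<in> sp_obj F T \<Longrightarrow>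
      nabla S T (sp_pure p (b x) (b y)) = b (mul S T x y)"
    and lin': "\<And>S T. finite S \<Longrightarrow> finite T \<Longrightarrow> S \<inter> T = {} \<Longrightarrow>
      linear_on (sp_scale p) tensor_scale (sp_obj p (S \<union> T)) (sp_tensor p S T) (Delta S T)"
    and Delta: "\<And>S T z. finite S \<Longrightarrow> finite T \<Longrightarrow> S \<inter> T = {} \<Longrightarrow> z \<in> sp_obj F (S \<union> T) \<Longrightarrow>
      Delta S T (b z) = sp_pure p (b (d1 S T z)) (b (d2 S T z))"
  shows "connected_hopf_monoid p nabla Delta"
proof (intro connected_hopf_monoid.intro connected_hopf_monoid_axioms.intro)
  interpret M: set_hopf_monoid F e mul d1 d2 by (rule M)
  show "connected_monoid p nabla"
    by (rule linear_extension_monoid[OF M.set_monoid_axioms one lin nabla])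
  show "connected_comonoid p Delta"
    by (rule linear_extension_comonoid[OF M.set_comonoid_axioms one lin' Delta])
  note sub = obj_subspace_of and vt = vector_space_tensor_scale
  fix R R' S S' A B A' B' :: "'u set" and t
  assume R: "finite R" "finite R'" "R \<inter> R' = {}" and S: "S \<inter> S' = {}" "R \<union> R' = S \<union> S'"
    and A: "A = R \<inter> S" "B = R \<inter> S'" "A' = R' \<inter> S" "B' = R' \<inter> S'" and t: "t \<in> sp_tensor p R R'"
  have fS: "finite S" "finite S'" using R S(2) by (metis finite_Un)+
  have U: "A \<union> B = R" "A' \<union> B' = R'" "A \<union> A' = S" "B \<union> B' = S'" using A S(2) by auto
  have di: "A \<inter> B = {}" "A' \<inter> B' = {}" "A \<inter> A' = {}" "B \<inter> B' = {}" using A S(1) R(3) by auto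
  have fi: "finite A" "finite B" "finite A'" "finite B'" using A R by auto
  note D1 = lin'[OF fi(1,2) di(1), unfolded U] and D2 = lin'[OF fi(3,4) di(2), unfolded U]
  note N1 = lin[OF fi(1,3) di(3), unfolded U] and N2 = lin[OF fi(2,4) di(4), unfolded U]
  note t1 = tensor_map[OF sub[OF R(1)] sub[OF R(2)] D1 D2]
  note t2 = tensor_middle_swap[OF sub[OF fi(1)] sub[OF fi(2)] sub[OF fi(3)] sub[OF fi(4)]]
  note t3 = tensor_map[OF subspace_of_tensor_space subspace_of_tensor_space N1 N2]
  show "Delta S S' (nabla R R' t) =
      tensor_map tensor_scale tensor_scale (sp_scale p) (sp_scale p)
        (sp_tensor p A A') (sp_tensor p B B') (nabla A A') (nabla B B')
        (tensor_middle_swap (sp_scale p) (sp_obj p A) (sp_obj p B) (sp_obj p A') (sp_obj p B')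
           (tensor_map (sp_scale p) (sp_scale p) tensor_scale tensor_scale
              (sp_obj p R) (sp_obj p R') (Delta A B) (Delta A' B') t))"
  proof (rule tensor_eq[OF R(1,2) linear_on_compose[OF lin[OF R, unfolded S(2)] lin'[OF fS S(1)]]
        linear_on_compose[OF linear_on_compose[OF t1(1) t2(1)] t3(1)] vt _ t])
    fix x y assume x: "x \<in> sp_obj F R" and y: "y \<in> sp_obj F R'"
    have mem: "mul R R' x y \<in> sp_obj F (S \<union> S')" using M.mul_closed[OF R x y] S(2) by simp
    note c1 = M.d_closed[OF fi(1,2) di(1), unfolded U, OF x] and c2 = M.d_closed[OF fi(3,4) di(2), unfolded U, OF y]
    have D: "Delta A B (b x) = sp_pure p (b (d1 A B x)) (b (d2 A B x))"
      "Delta A' B' (b y) = sp_pure p (b (d1 A' B' y)) (b (d2 A' B' y))"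
      using Delta[OF fi(1,2) di(1), unfolded U, OF x] Delta[OF fi(3,4) di(2), unfolded U, OF y] by auto
    have m: "d1 S S' (mul R R' x y) = mul A A' (d1 A B x) (d1 A' B' y)"
      "d2 S S' (mul R R' x y) = mul B B' (d2 A B x) (d2 A' B' y)"
      using M.d_mul[OF R S x y] A by auto
    show "Delta S S' (nabla R R' (sp_pure p (b x) (b y))) =
      tensor_map tensor_scale tensor_scale (sp_scale p) (sp_scale p)
        (sp_tensor p A A') (sp_tensor p B B') (nabla A A') (nabla B B')
        (tensor_middle_swap (sp_scale p) (sp_obj p A) (sp_obj p B) (sp_obj p A') (sp_obj p B')
           (tensor_map (sp_scale p) (sp_scale p) tensor_scale tensor_scale
              (sp_obj p R) (sp_obj p R') (Delta A B) (Delta A' B') (sp_pure p (b x) (b y))))"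
      using R fS S(1) fi di c1 c2 x y mem
      by (simp add: nabla Delta m D t1(2) t2(2) t3(2) b_in_obj pure_tensor_in_tensor_space)
  qed
qed

lemma hopf_monoid_homI:
  assumes "connected_species_hom p p' f" and H: "connected_hopf_monoid p nabla Delta"
    and H': "connected_hopf_monoid p' nabla' Delta'"
    and nabla: "\<And>S T x y. finite S \<Longrightarrow> finite T \<Longrightarrow> S \<inter> T = {} \<Longrightarrow> x \<in> sp_obj F S \<Longrightarrow> y \<in> sp_obj F T \<Longrightarrow>
      f (S \<union> T) (nabla S T (sp_pure p (b x) (b y))) = nabla' S T (sp_pure p' (f S (b x)) (f T (b y)))"
    and Delta: "\<And>S T z. finite S \<Longrightarrow> finite T \<Longrightarrow> S \<inter> T = {} \<Longrightarrow> z \<in> sp_obj F (S \<union> T) \<Longrightarrow>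
      Delta' S T (f (S \<union> T) (b z)) =
      tensor_map (sp_scale p) (sp_scale p) (sp_scale p') (sp_scale p')
        (sp_obj p S) (sp_obj p T) (f S) (f T) (Delta S T (b z))"
  shows "connected_hopf_monoid_hom p nabla Delta p' nabla' Delta' f"
proof (rule connected_hopf_monoid_hom.intro[OF assms(1-3) connected_hopf_monoid_hom_axioms.intro])
  interpret f: connected_species_hom p p' f by fact
  interpret H: connected_hopf_monoid p nabla Delta by fact
  interpret H': connected_hopf_monoid p' nabla' Delta' by fact
  fix S T :: "'u set" assume S: "finite S" and T: "finite T" and dis: "S \<inter> T = {}"
  have fin: "finite (S \<union> T)" using S T by simp
  note tm = tensor_map[OF obj_subspace_of[OF S] obj_subspace_of[OF T] f.hom_linear[OF S] f.hom_linear[OF T]]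
  show "f (S \<union> T) (nabla S T t) =
      nabla' S T (tensor_map (sp_scale p) (sp_scale p) (sp_scale p') (sp_scale p')
        (sp_obj p S) (sp_obj p T) (f S) (f T) t)" if "t \<in> sp_tensor p S T" for t
    by (rule tensor_eq[OF S T linear_on_compose[OF H.nabla_linear[OF S T dis] f.hom_linear[OF fin]]
        linear_on_compose[OF tm(1) H'.nabla_linear[OF S T dis]] f.p'.vector_space_axioms _ that])
      (use S T dis in \<open>simp add: tm(2) nabla b_in_obj\<close>)
  show "Delta' S T (f (S \<union> T) x) =
      tensor_map (sp_scale p) (sp_scale p) (sp_scale p') (sp_scale p')
        (sp_obj p S) (sp_obj p T) (f S) (f T) (Delta S T x)" if "x \<in> sp_obj p (S \<union> T)" for x
    by (rule linear_eq[OF fin linear_on_compose[OF f.hom_linear[OF fin] H'.Delta_linear[OF S T dis]]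
        linear_on_compose[OF H.Delta_linear[OF S T dis] tm(1)] vector_space_tensor_scale _ that])
      (use S T dis in \<open>simp add: Delta\<close>)
qed

end

section \<open>Free vector species\<close>

text \<open>
  The linear extension of \<open>b\<close> to the free vector space.
\<close>

definition free_lift :: "('k::field \<Rightarrow> 'v::ab_group_add \<Rightarrow> 'v) \<Rightarrow> ('x \<Rightarrow> 'v) \<Rightarrow> ('x \<Rightarrow>\<^sub>0 'k) \<Rightarrow> 'v" where
  "free_lift r b u = (\<Sum>x\<in>Poly_Mapping.keys u. r (Poly_Mapping.lookup u x) (b x))"

lemma lookup_free_scale: "Poly_Mapping.lookup (free_scale c u) x = c * Poly_Mapping.lookup u x"
  by (simp add: Poly_Mapping.map.rep_eq when_def)

lemma vector_space_free_scale: "vector_space (free_scale :: 'k::field \<Rightarrow> ('x \<Rightarrow>\<^sub>0 'k) \<Rightarrow> _)"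
  by unfold_locales (auto intro!: poly_mapping_eqI simp: lookup_free_scale lookup_add algebra_simps)

lemma free_lift_superset:
  assumes "vector_space r" "finite K" "Poly_Mapping.keys u \<subseteq> K"
  shows "free_lift r b u = (\<Sum>x\<in>K. r (Poly_Mapping.lookup u x) (b x))"
proof -
  interpret R: vector_space r by fact
  show ?thesis
    unfolding free_lift_def using assms by (intro sum.mono_neutral_left) (auto simp: in_keys_iff)
qed

lemma linear_free_lift:
  assumes "vector_space r"
  shows "Vector_Spaces.linear free_scale r (free_lift r b)"
proof -
  interpret R: vector_space r by fact
  have "free_lift r b (u + v) = free_lift r b u + free_lift r b v" for u v
  proof -
    let ?K = "Poly_Mapping.keys u \<union> Poly_Mapping.keys v"
    have "free_lift r b w = (\<Sum>x\<in>?K. r (Poly_Mapping.lookup w x) (b x))" if "Poly_Mapping.keys w \<subseteq> ?K" for w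
      by (rule free_lift_superset[OF assms _ that]) simp
    then show ?thesis
      using Poly_Mapping.keys_add[of u v] by (simp add: lookup_add R.scale_left_distrib sum.distrib)
  qed
  moreover have "free_lift r b (free_scale c u) = r c (free_lift r b u)" for c u
  proof -
    have "Poly_Mapping.keys (free_scale c u) \<subseteq> Poly_Mapping.keys u"
      by (auto simp: in_keys_iff lookup_free_scale)
    from free_lift_superset[OF assms _ this, of b] show ?thesis
      by (simp add: lookup_free_scale R.scale_sum_right free_lift_def)
  qed
  ultimately show ?thesis
    by (simp add: Vector_Spaces.linear_iff assms vector_space_free_scale)
qed

lemma linear_on_free_lift:
  "vector_space r \<Longrightarrow> linear_on free_scale r A UNIV (free_lift r b)"
  using linear_free_lift[of r b] by (simp add: Vector_Spaces.linear_iff linear_on_def)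

lemma free_lift_elem: "vector_space r \<Longrightarrow> free_lift r b (free_elem x) = b x"
  by (simp add: free_lift_def vector_space.vector_space_assms(4))

lemma free_lift_free_elem: "free_lift free_scale free_elem u = u"
proof (rule poly_mapping_eqI)
  fix x
  show "Poly_Mapping.lookup (free_lift free_scale free_elem u) x = Poly_Mapping.lookup u x"
    by (simp add: free_lift_def lookup_sum lookup_free_scale lookup_single when_def in_keys_iff)
qed

lemma span_free_elem: "module.span free_scale (free_elem ` X) = {u :: 'x \<Rightarrow>\<^sub>0 'k::field. Poly_Mapping.keys u \<subseteq> X}"
proof -
  interpret V: vector_space "free_scale :: 'k \<Rightarrow> ('x \<Rightarrow>\<^sub>0 'k) \<Rightarrow> _" by (rule vector_space_free_scale)
  have sub: "V.subspace {u. Poly_Mapping.keys u \<subseteq> X}"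
  proof (rule V.subspaceI)
    fix u v :: "'x \<Rightarrow>\<^sub>0 'k" assume "u \<in> {u. Poly_Mapping.keys u \<subseteq> X}" "v \<in> {u. Poly_Mapping.keys u \<subseteq> X}"
    then show "u + v \<in> {u. Poly_Mapping.keys u \<subseteq> X}" using Poly_Mapping.keys_add[of u v] by auto
  qed (auto simp: in_keys_iff lookup_free_scale)
  have "u \<in> V.span (free_elem ` X)" if "Poly_Mapping.keys u \<subseteq> X" for u
  proof -
    have "free_lift free_scale free_elem u \<in> V.span (free_elem ` X)"
      unfolding free_lift_def
      by (intro V.span_sum V.span_scale V.span_base) (use that in auto)
    then show ?thesis by (simp add: free_lift_free_elem)
  qed
  then show ?thesis by (intro equalityI V.span_minimal[OF _ sub]) auto
qed

lemma free_lift_image: 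
  assumes "vector_space r"
  shows "free_lift r b ` {u. Poly_Mapping.keys u \<subseteq> X} = module.span r (b ` X)"
proof -
  interpret L: Vector_Spaces.linear free_scale r "free_lift r b" by (rule linear_free_lift[OF assms])
  have "free_lift r b ` free_elem ` X = b ` X"
    by (simp add: image_image free_lift_elem[OF assms])
  then show ?thesis using L.span_image[of "free_elem ` X"] by (simp add: span_free_elem)
qed

text \<open>
  The coefficients of \<open>u - v\<close> are those of a linear relation between distinct elements of the
  independent set \<open>b ` X\<close>.
\<close>

lemma inj_on_free_lift:
  assumes r: "vector_space r" and ind: "\<not> module.dependent r (b ` X)" and inj: "inj_on b X"
  shows "inj_on (free_lift r b) {u. Poly_Mapping.keys u \<subseteq> X}"
proof (rule inj_onI)
  interpret R: vector_space r by fact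
  interpret L: Vector_Spaces.linear free_scale r "free_lift r b" by (rule linear_free_lift[OF r])
  fix u v assume u: "u \<in> {u. Poly_Mapping.keys u \<subseteq> X}" "v \<in> {u. Poly_Mapping.keys u \<subseteq> X}"
    and eq: "free_lift r b u = free_lift r b v"
  let ?K = "Poly_Mapping.keys (u - v)"
  have K: "?K \<subseteq> X" using u Poly_Mapping.keys_diff[of u v] by auto
  then have injK: "inj_on b ?K" using inj by (rule inj_on_subset[rotated])
  have "(\<Sum>y\<in>b ` ?K. r (Poly_Mapping.lookup (u - v) (inv_into ?K b y)) y) = free_lift r b (u - v)"
    using injK by (simp add: sum.reindex free_lift_def)
  also have "\<dots> = 0" using eq by (simp add: L.diff)
  finally have 0: "(\<Sum>y\<in>b ` ?K. r (Poly_Mapping.lookup (u - v) (inv_into ?K b y)) y) = 0" .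
  have "Poly_Mapping.lookup (u - v) x = 0" if "x \<in> ?K" for x
    using R.independentD[OF ind _ _ 0, of "b x"] K injK that by auto
  then have "u - v = 0" by (intro poly_mapping_eqI) (metis in_keys_iff lookup_zero)
  then show "u = v" by simp
qed

lemma spanned_species_free:
  fixes X :: "('u, 'x, 'm) species_scheme"
  assumes "set_species X" and e: "sp_obj X {} = {e}"
  shows "spanned_species (free_connected X e :: ('u, 'x \<Rightarrow>\<^sub>0 'k::field, 'k) connected_species_data) X free_elem"
proof -
  interpret X: set_species X by fact
  let ?p = "free_connected X e :: ('u, 'x \<Rightarrow>\<^sub>0 'k, 'k) connected_species_data"
  note v = vector_space_free_scale
  interpret V: vector_space "free_scale :: 'k \<Rightarrow> ('x \<Rightarrow>\<^sub>0 'k) \<Rightarrow> _" by (rule v)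
  have obj: "sp_obj ?p S = module.span free_scale (free_elem ` sp_obj X S)" for S
    by (simp add: free_connected_def span_free_elem)
  have map: "sp_map ?p S \<sigma> = free_lift free_scale (\<lambda>x. free_elem (sp_map X S \<sigma> x))" for S \<sigma>
    by (simp add: free_connected_def free_lift_def fun_eq_iff)
  have scale: "sp_scale ?p = free_scale" by (simp add: free_connected_def)
  have lin: "linear_on free_scale free_scale (sp_obj ?p S) (sp_obj ?p (\<sigma> ` S)) (sp_map ?p S \<sigma>)"
    if "finite S" "inj_on \<sigma> S" for S \<sigma>
    unfolding map obj
    by (rule linear_on_span_into[OF v subspace_of_span[OF v] linear_on_free_lift[OF v]])
      (use X.map_closed[OF that] in \<open>auto simp: free_lift_elem[OF v] intro: V.span_base\<close>)
  have map_elem: "sp_map ?p S \<sigma> (free_elem x) = free_elem (sp_map X S \<sigma> x)" for S \<sigma> x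
    by (simp add: map free_lift_elem[OF v])
  have unit_eq: "sp_unit ?p c = Poly_Mapping.single e c" for c
    by (auto simp: free_connected_def lookup_free_scale lookup_single when_def intro!: poly_mapping_eqI)
  have eq: "f x = g x" if "linear_on free_scale free_scale (sp_obj ?p S) C f"
    "linear_on free_scale free_scale (sp_obj ?p S) D g"
    "\<And>x. x \<in> sp_obj X S \<Longrightarrow> f (free_elem x) = g (free_elem x)" "x \<in> sp_obj ?p S"
    for f g :: "('x \<Rightarrow>\<^sub>0 'k) \<Rightarrow> ('x \<Rightarrow>\<^sub>0 'k)" and S C D x
  proof -
    note l = that(1,2,4)[unfolded obj]
    show ?thesis by (rule linear_on_eq_on_span[OF v v l(1,2) _ l(3)]) (use that(3) in auto)
  qed
  show ?thesis
  proof (intro spanned_species.intro connected_species.intro)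
    show "set_species ?p"
    proof
      fix S :: "'u set" and \<sigma> :: "'u \<Rightarrow> 'u" and x
      assume S: "finite S" "inj_on \<sigma> S" and x: "x \<in> sp_obj ?p S"
      show "sp_map ?p S \<sigma> x \<in> sp_obj ?p (\<sigma> ` S)" by (rule linear_onD(1)[OF lin[OF S] x])
      show "sp_map ?p S \<sigma> x = sp_map ?p S \<rho> x" if "\<And>a. a \<in> S \<Longrightarrow> \<sigma> a = \<rho> a" for \<rho>
      proof (rule eq[OF lin[OF S] lin[OF S(1)] _ x])
        show "inj_on \<rho> S" using S(2) that by (simp cong: inj_on_cong)
        show "sp_map ?p S \<sigma> (free_elem x) = sp_map ?p S \<rho> (free_elem x)" if "x \<in> sp_obj X S" for x
          using X.map_cong[OF S _ that, of \<rho>] \<open>\<And>a. a \<in> S \<Longrightarrow> \<sigma> a = \<rho> a\<close> by (simp add: map_elem)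
      qed
      show "sp_map ?p S (\<tau> \<circ> \<sigma>) x = sp_map ?p (\<sigma> ` S) \<tau> (sp_map ?p S \<sigma> x)" if "inj_on \<tau> (\<sigma> ` S)" for \<tau>
      proof (rule eq[OF lin[OF S(1)] linear_on_compose[OF lin[OF S] lin[OF _ that]] _ x])
        show "inj_on (\<tau> \<circ> \<sigma>) S" using comp_inj_on[OF S(2) that] .
        show "finite (\<sigma> ` S)" using S(1) by simp
        show "sp_map ?p S (\<tau> \<circ> \<sigma>) (free_elem x) = sp_map ?p (\<sigma> ` S) \<tau> (sp_map ?p S \<sigma> (free_elem x))"
          if "x \<in> sp_obj X S" for x
          using X.map_comp[OF S \<open>inj_on \<tau> (\<sigma> ` S)\<close> that] by (simp add: map_elem)
      qed
    next
      fix S :: "'u set" and x assume S: "finite S" and x: "x \<in> sp_obj ?p S"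
      show "sp_map ?p S id x = x"
        by (rule eq[OF lin[OF S inj_on_id] linear_on_id[unfolded id_def] _ x])
          (use X.map_id[OF S] in \<open>simp add: map_elem\<close>)
    qed
    show "vector_space (sp_scale ?p)" unfolding scale by (rule v)
    show "connected_species_axioms ?p"
    proof (rule connected_species_axioms.intro)
      fix S :: "'u set" and \<sigma> :: "'u \<Rightarrow> 'u"
      show "module.subspace (sp_scale ?p) (sp_obj ?p S)"
        unfolding scale obj by (rule V.subspace_span)
      show "linear_on (sp_scale ?p) (sp_scale ?p) (sp_obj ?p S) (sp_obj ?p (\<sigma> ` S)) (sp_map ?p S \<sigma>)"
        if "finite S" "inj_on \<sigma> S" unfolding scale by (rule lin[OF that])
      show "linear_on (*) (sp_scale ?p) UNIV (sp_obj ?p {}) (sp_unit ?p)"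
        unfolding linear_on_def unit_eq scale
        by (auto simp: free_connected_def e lookup_free_scale lookup_single lookup_add when_def
            intro!: poly_mapping_eqI split: if_splits)
      show "linear_on (sp_scale ?p) (*) (sp_obj ?p {}) UNIV (sp_counit ?p)"
        by (simp add: linear_on_def free_connected_def lookup_add lookup_free_scale)
      show "sp_counit ?p (sp_unit ?p c) = c" for c
        unfolding unit_eq by (simp add: free_connected_def)
      show "sp_unit ?p (sp_counit ?p x) = x" if "x \<in> sp_obj ?p {}" for x
        using that unfolding unit_eq
        by (auto simp: free_connected_def e lookup_single when_def in_keys_iff intro!: poly_mapping_eqI)
    qed
    show "set_species X" by fact
    show "spanned_species_axioms ?p X free_elem"
      by (rule spanned_species_axioms.intro) (simp_all add: obj scale map_elem)
  qed
qed

section \<open>Product and coproduct of labeled partitions\<close>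

text \<open>
  The double sum in the definition of the product is a linear extension in each of its two arguments,
  hence bilinear.
\<close>

lemma partition_product_linear:
  fixes q :: "('u, 'v, 'k::field, 'm) connected_species_data_scheme"
  assumes dis: "S \<inter> T = {}"
  shows "linear_on tensor_scale (sp_scale (partition_species q Q)) (sp_tensor (partition_species q Q) S T)
      (sp_obj (partition_species q Q) (S \<union> T)) (partition_product q Q S T)" (is ?lin)
    and "X \<in> sp_obj (labeled_partitions (subspecies q Q)) S \<Longrightarrow>
      Y \<in> sp_obj (labeled_partitions (subspecies q Q)) T \<Longrightarrow>
      partition_product q Q S T (sp_pure (partition_species q Q) (free_elem X) (free_elem Y)) =
      free_elem (X \<union> Y)" (is "_ \<Longrightarrow> _ \<Longrightarrow> ?val")
proof -
  let ?L = "labeled_partitions (subspecies q Q)"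
  let ?p = "partition_species q Q"
  note v = vector_space_free_scale
  interpret V: vector_space "free_scale :: 'k \<Rightarrow> (('u set \<times> 'v) set \<Rightarrow>\<^sub>0 'k) \<Rightarrow> _" by (rule v)
  have scale: "sp_scale ?p = free_scale" by (simp add: partition_species_def free_connected_def)
  have obj: "sp_obj ?p I = module.span free_scale (free_elem ` sp_obj ?L I)" for I
    by (simp add: partition_species_def free_connected_def span_free_elem)
  have sub: "subspace_of free_scale (sp_obj ?p I)" for I
    unfolding obj by (rule subspace_of_span[OF v])
  define \<phi> :: "(('u set \<times> 'v) set \<Rightarrow>\<^sub>0 'k) \<Rightarrow> (('u set \<times> 'v) set \<Rightarrow>\<^sub>0 'k) \<Rightarrow> (('u set \<times> 'v) set \<Rightarrow>\<^sub>0 'k)"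
    where "\<phi> = (\<lambda>u v. \<Sum>X\<in>Poly_Mapping.keys u. \<Sum>Y\<in>Poly_Mapping.keys v.
          free_scale (Poly_Mapping.lookup u X * Poly_Mapping.lookup v Y) (free_elem (X \<union> Y)))"
  have left: "\<phi> u v = free_lift free_scale (\<lambda>X. free_lift free_scale (\<lambda>Y. free_elem (X \<union> Y)) v) u" for u v
    by (simp add: \<phi>_def free_lift_def V.scale_sum_right)
  have right: "\<phi> u v = free_lift free_scale (\<lambda>Y. free_lift free_scale (\<lambda>X. free_elem (X \<union> Y)) u) v" for u v
    unfolding \<phi>_def by (subst sum.swap) (simp add: free_lift_def V.scale_sum_right mult.commute)
  have lin: "linear_on free_scale free_scale A UNIV (\<lambda>u. \<phi> u v)" "linear_on free_scale free_scale A UNIV (\<phi> u)"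
    for A u v
    unfolding left using linear_on_free_lift[OF v] apply blast
    unfolding left[symmetric] right by (rule linear_on_free_lift[OF v])
  have elem: "\<phi> (free_elem X) (free_elem Y) = free_elem (X \<union> Y)" for X Y
    by (simp add: left free_lift_elem[OF v])
  have mem1: "\<phi> u (free_elem Y) \<in> sp_obj ?p (S \<union> T)" if "u \<in> sp_obj ?p S" "Y \<in> sp_obj ?L T" for u Y
  proof (rule linear_onD(1)[OF linear_on_span_into[OF v sub lin(1)] that(1)[unfolded obj]])
    fix u :: "('u set \<times> 'v) set \<Rightarrow>\<^sub>0 'k" assume "u \<in> free_elem ` sp_obj ?L S"
    then show "\<phi> u (free_elem Y) \<in> sp_obj ?p (S \<union> T)"
      using labeled_partition_Un[OF _ that(2) dis] by (auto simp: elem obj intro: V.span_base)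
  qed
  have mem: "\<phi> u w \<in> sp_obj ?p (S \<union> T)" if "u \<in> sp_obj ?p S" "w \<in> sp_obj ?p T" for u w
    using linear_onD(1)[OF linear_on_span_into[OF v sub lin(2)] that(2)[unfolded obj], of u "S \<union> T"]
      mem1[OF that(1)] by auto
  have bil: "bilinear_on free_scale free_scale free_scale (sp_obj ?p S) (sp_obj ?p T) (sp_obj ?p (S \<union> T)) \<phi>"
    unfolding bilinear_on_def using lin mem by (auto simp: linear_on_def)
  note l = tensor_lift[OF sub sub sub bil]
  have pp: "partition_product q Q S T = tensor_lift free_scale free_scale (sp_obj ?p S) (sp_obj ?p T) \<phi>"
    by (simp add: partition_product_def \<phi>_def)
  show ?lin unfolding scale pp by (rule l)
  show ?val if "X \<in> sp_obj ?L S" "Y \<in> sp_obj ?L T"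
    unfolding scale pp using that by (subst l(2)) (auto simp: obj elem intro: V.span_base)
qed

lemma partition_coproduct_linear:
  fixes q :: "('u, 'v::ab_group_add, 'k::field, 'm) connected_species_data_scheme"
  assumes closed: "\<And>Z. Z \<in> sp_obj (labeled_partitions (subspecies q Q)) (S \<union> T) \<Longrightarrow>
      partition_left q Delta Q S T Z \<in> sp_obj (labeled_partitions (subspecies q Q)) S \<and>
      partition_right q Delta Q S T Z \<in> sp_obj (labeled_partitions (subspecies q Q)) T"
  shows "linear_on (sp_scale (partition_species q Q)) tensor_scale
      (sp_obj (partition_species q Q) (S \<union> T)) (sp_tensor (partition_species q Q) S T)
      (partition_coproduct q Delta Q S T)" (is ?lin)
    and "partition_coproduct q Delta Q S T (free_elem Z) =
      sp_pure (partition_species q Q) (free_elem (partition_left q Delta Q S T Z))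
        (free_elem (partition_right q Delta Q S T Z))" (is ?val)
proof -
  let ?L = "labeled_partitions (subspecies q Q)"
  let ?p = "partition_species q Q"
  note v = vector_space_free_scale
  interpret V: vector_space "free_scale :: 'k \<Rightarrow> (('u set \<times> 'v) set \<Rightarrow>\<^sub>0 'k) \<Rightarrow> _" by (rule v)
  have scale: "sp_scale ?p = free_scale" by (simp add: partition_species_def free_connected_def)
  have obj: "sp_obj ?p I = module.span free_scale (free_elem ` sp_obj ?L I)" for I
    by (simp add: partition_species_def free_connected_def span_free_elem)
  have pc: "partition_coproduct q Delta Q S T = free_lift tensor_scale (\<lambda>Z. pure_tensor free_scale free_scale
           (free_elem (partition_left q Delta Q S T Z)) (free_elem (partition_right q Delta Q S T Z)))"
    by (simp add: fun_eq_iff partition_coproduct_def free_lift_def)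
  show ?val unfolding scale pc by (rule free_lift_elem[OF vector_space_tensor_scale])
  have "linear_on free_scale tensor_scale (module.span free_scale (free_elem ` sp_obj ?L (S \<union> T)))
      (tensor_space free_scale free_scale (sp_obj ?p S) (sp_obj ?p T)) (partition_coproduct q Delta Q S T)"
    unfolding pc
    by (rule linear_on_span_into[OF v subspace_of_tensor_space linear_on_free_lift[OF vector_space_tensor_scale]])
      (use closed in \<open>auto simp: free_lift_elem[OF vector_space_tensor_scale] obj
         intro!: pure_tensor_in_tensor_space V.span_base\<close>)
  then show ?lin unfolding scale obj[of "S \<union> T"] .
qed

section \<open>Bijective homomorphisms\<close>

definition inverse_species_map where
  "inverse_species_map F G f =
     (\<lambda>S\<in>Collect finite. \<lambda>y\<in>sp_obj G S. inv_into (sp_obj F S) (f S) y)"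

lemma inverse_species_map:
  assumes bij: "\<forall>S. finite S \<longrightarrow> bij_betw (f S) (sp_obj F S) (sp_obj G S)" and S: "finite S"
  shows "x \<in> sp_obj F S \<Longrightarrow> inverse_species_map F G f S (f S x) = x"
    and "y \<in> sp_obj G S \<Longrightarrow> f S (inverse_species_map F G f S y) = y"
    and "y \<in> sp_obj G S \<Longrightarrow> inverse_species_map F G f S y \<in> sp_obj F S"
proof -
  have b: "bij_betw (f S) (sp_obj F S) (sp_obj G S)" using bij S by blast
  show "inverse_species_map F G f S (f S x) = x" if "x \<in> sp_obj F S"
    using that bij_betw_inv_into_left[OF b that] bij_betw_apply[OF b that] S
    by (simp add: inverse_species_map_def)
  show "f S (inverse_species_map F G f S y) = y" "inverse_species_map F G f S y \<in> sp_obj F S"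
    if "y \<in> sp_obj G S"
    using that bij_betw_inv_into_right[OF b that] bij_betw_apply[OF bij_betw_inv_into[OF b] that] S
    by (simp_all add: inverse_species_map_def)
qed

lemma species_hom_inverse:
  assumes "species_hom F G f" and bij: "\<forall>S. finite S \<longrightarrow> bij_betw (f S) (sp_obj F S) (sp_obj G S)"
  shows "species_hom G F (inverse_species_map F G f)" and "inverse_homs F G f (inverse_species_map F G f)"
proof -
  interpret f: species_hom F G f by fact
  note inv = inverse_species_map[of f F G, OF bij]
  show "inverse_homs F G f (inverse_species_map F G f)"
    unfolding inverse_homs_def using inv by simp
  show "species_hom G F (inverse_species_map F G f)"
  proof (intro species_hom.intro species_hom_axioms.intro f.F.set_species_axioms f.G.set_species_axioms)
    show "inverse_species_map F G f \<in> (\<Pi>\<^sub>E S\<in>Collect finite. sp_obj G S \<rightarrow>\<^sub>E sp_obj F S)"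
    proof (intro PiE_I)
      fix S y assume "S \<in> Collect finite" "y \<in> sp_obj G S"
      then show "inverse_species_map F G f S y \<in> sp_obj F S" using inv(3) by simp
    qed (auto simp: inverse_species_map_def)
    fix S \<sigma> y assume S: "finite S" "inj_on (\<sigma> :: 'a \<Rightarrow> 'a) S" and y: "y \<in> sp_obj G S"
    define x where "x = inverse_species_map F G f S y"
    have x: "x \<in> sp_obj F S" "y = f S x" using inv S y by (simp_all add: x_def)
    show "inverse_species_map F G f (\<sigma> ` S) (sp_map G S \<sigma> y) = sp_map F S \<sigma> (inverse_species_map F G f S y)"
      using S x inv(1)[of "\<sigma> ` S" "sp_map F S \<sigma> x"] f.F.map_closed[OF S x(1)]
      by (simp add: inv(1) f.hom_natural[symmetric])
  qed
qed

text \<open>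
  For the coproduct, the inverse \<open>g\<close> is applied to the equation that says that \<open>f\<close> is a homomorphism;
  \<open>(g \<otimes> g) \<circ> (f \<otimes> f)\<close> is the identity, as can be seen on pure tensors.
\<close>

lemma connected_hopf_monoid_isoI:
  assumes "connected_hopf_monoid_hom p nabla Delta p' nabla' Delta' f"
    and bij: "\<forall>S. finite S \<longrightarrow> bij_betw (f S) (sp_obj p S) (sp_obj p' S)"
  shows "connected_hopf_monoid_iso p nabla Delta p' nabla' Delta' f"
proof -
  interpret f: connected_hopf_monoid_hom p nabla Delta p' nabla' Delta' f by fact
  define g where "g = inverse_species_map p p' f"
  note inv = inverse_species_map[of f p p', OF bij, folded g_def]
  note hom = species_hom_inverse[OF f.species_hom_axioms bij, folded g_def]
  have fx: "f S x \<in> sp_obj p' S" if "finite S" "x \<in> sp_obj p S" for S x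
    using linear_onD(1)[OF f.hom_linear[OF that(1)] that(2)] .
  have lin: "linear_on (sp_scale p') (sp_scale p) (sp_obj p' S) (sp_obj p S) (g S)" if S: "finite S" for S
  proof -
    note l = linear_onD[OF f.hom_linear[OF S]]
    have sub: "module.subspace (sp_scale p) (sp_obj p S)" by (rule f.p.obj_subspace[OF S])
    have "g S (y + y') = g S y + g S y'" if "y \<in> sp_obj p' S" "y' \<in> sp_obj p' S" for y y'
      using inv(1)[OF S, of "g S y + g S y'"] inv(2,3)[OF S that(1)] inv(2,3)[OF S that(2)] l(2)
        f.p.subspace_add[OF sub] by simp
    moreover have "g S (sp_scale p' c y) = sp_scale p c (g S y)" if "y \<in> sp_obj p' S" for c y
      using inv(1)[OF S, of "sp_scale p c (g S y)"] inv(2,3)[OF S that] l(3) f.p.subspace_scale[OF sub] by simp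
    ultimately show ?thesis using inv(3)[OF S] unfolding linear_on_def by auto
  qed
  have "connected_hopf_monoid_hom p' nabla' Delta' p nabla Delta g"
  proof (intro connected_hopf_monoid_hom.intro connected_species_hom.intro hom
      connected_species_hom_axioms.intro connected_hopf_monoid_hom_axioms.intro
      f.p.connected_species_axioms f.p'.connected_species_axioms
      f.H.connected_hopf_monoid_axioms f.H'.connected_hopf_monoid_axioms)
    show "linear_on (sp_scale p') (sp_scale p) (sp_obj p' S) (sp_obj p S) (g S)" if "finite S" for S
      by (rule lin[OF that])
    show "g {} (sp_one p') = sp_one p"
      using inv(1)[of "{}" "sp_one p"] linear_onD(1)[OF f.p.unit_linear] by (simp add: f.hom_one)
    fix S T :: "'a set" assume S: "finite S" and T: "finite T" and dis: "S \<inter> T = {}"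
    have fin: "finite (S \<union> T)" using S T by simp
    note gm = tensor_map[OF f.p'.obj_subspace_of[OF S] f.p'.obj_subspace_of[OF T] lin[OF S] lin[OF T]]
    note fm = tensor_map[OF f.p.obj_subspace_of[OF S] f.p.obj_subspace_of[OF T] f.hom_linear[OF S] f.hom_linear[OF T]]
    show "g (S \<union> T) (nabla' S T t) =
      nabla S T (tensor_map (sp_scale p') (sp_scale p') (sp_scale p) (sp_scale p)
        (sp_obj p' S) (sp_obj p' T) (g S) (g T) t)" if t: "t \<in> sp_tensor p' S T" for t
    proof (rule tensor_space_eq[OF linear_on_compose[OF f.H'.nabla_linear[OF S T dis] lin[OF fin]]
          linear_on_compose[OF gm(1) f.H.nabla_linear[OF S T dis]] f.p.vector_space_axioms _ t])
      fix y z assume y: "y \<in> sp_obj p' S" and z: "z \<in> sp_obj p' T"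
      note iy = inv(2,3)[OF S y] and iz = inv(2,3)[OF T z]
      have pt: "sp_pure p (g S y) (g T z) \<in> sp_tensor p S T"
        using iy iz by (intro pure_tensor_in_tensor_space)
      have "nabla' S T (sp_pure p' y z) = f (S \<union> T) (nabla S T (sp_pure p (g S y) (g T z)))"
        using f.hom_nabla[OF S T dis pt] iy iz by (simp add: fm(2))
      then show "g (S \<union> T) (nabla' S T (sp_pure p' y z)) =
        nabla S T (tensor_map (sp_scale p') (sp_scale p') (sp_scale p) (sp_scale p)
          (sp_obj p' S) (sp_obj p' T) (g S) (g T) (sp_pure p' y z))"
        using inv(1)[OF fin linear_onD(1)[OF f.H.nabla_linear[OF S T dis] pt]] y z by (simp add: gm(2))
    qed
    show "Delta S T (g (S \<union> T) y) =
      tensor_map (sp_scale p') (sp_scale p') (sp_scale p) (sp_scale p)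
        (sp_obj p' S) (sp_obj p' T) (g S) (g T) (Delta' S T y)" if y: "y \<in> sp_obj p' (S \<union> T)" for y
    proof -
      define x where "x = g (S \<union> T) y"
      have x: "x \<in> sp_obj p (S \<union> T)" "y = f (S \<union> T) x" using inv(2,3)[OF fin y] by (auto simp: x_def)
      have "tensor_map (sp_scale p') (sp_scale p') (sp_scale p) (sp_scale p) (sp_obj p' S) (sp_obj p' T) (g S) (g T)
          (tensor_map (sp_scale p) (sp_scale p) (sp_scale p') (sp_scale p') (sp_obj p S) (sp_obj p T) (f S) (f T)
            (Delta S T x)) = id (Delta S T x)"
      proof (rule tensor_space_eq[OF linear_on_compose[OF fm(1) gm(1)] linear_on_id vector_space_tensor_scale])
        show "Delta S T x \<in> sp_tensor p S T" by (rule linear_onD(1)[OF f.H.Delta_linear[OF S T dis] x(1)])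
      qed (use S T in \<open>simp add: fm(2) gm(2) fx inv(1)\<close>)
      then show ?thesis
        using f.hom_Delta[OF S T dis x(1)] x(2) inv(1)[OF fin x(1)] by simp
    qed
  qed
  then show ?thesis
    unfolding connected_hopf_monoid_iso_def using assms(1) hom(2) by blast
qed

section \<open>The operations on the basis of a linearized Hopf monoid\<close>

text \<open>
  The parts of the coproduct of \<open>l\<close> depend on the ambient species and basis only through the
  factors \<open>x\<close> and \<open>y\<close>, so they are the same in \<open>p\<close> and in its subspecies \<open>q\<degree>\<close>.
\<close>

lemma coproduct_partsI:
  assumes vs: "vector_space (sp_scale q)"
    and ind: "\<not> module.dependent (sp_scale q) (X S)" "\<not> module.dependent (sp_scale q) (X T)"
    and x: "x \<in> X S" "y \<in> X T" "Delta S T l = sp_pure q x y"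
  shows "coproduct_parts q Delta X S T l = (x, y)"
proof -
  interpret V: vector_space "sp_scale q" by fact
  have "y \<noteq> 0" using V.dependent_zero ind(2) x(2) by blast
  have "ll = (x, y)" if ll: "fst ll \<in> X S \<and> snd ll \<in> X T \<and> Delta S T l = sp_pure q (fst ll) (snd ll)" for ll
  proof -
    have "sp_pure q x y = sp_pure q (fst ll) (snd ll)" using ll x(3) by simp
    from pure_tensor_inject[OF vs vs ind(1) x(1) _ \<open>y \<noteq> 0\<close> this] ll show ?thesis
      by (simp add: prod_eq_iff)
  qed
  then show ?thesis
    unfolding coproduct_parts_def by (intro the_equality) (use x in simp_all)
qed

lemma set_comonoid_subspecies:
  assumes "set_comonoid F e d1 d2" and X: "set_subspecies F X" "X {} = {e}"
    and d: "\<And>S T z. finite S \<Longrightarrow> finite T \<Longrightarrow> S \<inter> T = {} \<Longrightarrow> z \<in> X (S \<union> T) \<Longrightarrow> d1 S T z \<in> X S \<and> d2 S T z \<in> X T"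
  shows "set_comonoid (subspecies F X) e d1 d2"
proof -
  interpret set_comonoid F e d1 d2 by fact
  have sub: "x \<in> sp_obj F S" if "finite S" "x \<in> X S" for S x
    using X(1) that unfolding set_subspecies_def by blast
  have map: "sp_map F S \<sigma> x \<in> X (\<sigma> ` S)" if "finite S" "inj_on \<sigma> S" "x \<in> X S" for S \<sigma> x
    using X(1) that unfolding set_subspecies_def by blast
  show ?thesis
  proof (unfold_locales, unfold subspecies_def species.select_convs)
    fix S T :: "'a set" and \<sigma> :: "'a \<Rightarrow> 'a" and z
    assume S: "finite S" and T: "finite T" "S \<inter> T = {}" and z: "z \<in> X (S \<union> T)"
    have z': "z \<in> sp_obj F (S \<union> T)" using sub S T z by simp
    show "d1 S T z \<in> X S \<and> d2 S T z \<in> X T" by (rule d[OF S T z])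
    show "d1 (\<sigma> ` S) (\<sigma> ` T) (sp_map F (S \<union> T) \<sigma> z) = sp_map F S \<sigma> (d1 S T z) \<and>
      d2 (\<sigma> ` S) (\<sigma> ` T) (sp_map F (S \<union> T) \<sigma> z) = sp_map F T \<sigma> (d2 S T z)" if "inj_on \<sigma> (S \<union> T)"
      by (rule d_natural[OF S T that z'])
  next
    fix R S T :: "'a set" and z
    assume *: "finite R" "finite S" "finite T" "R \<inter> S = {}" "R \<inter> T = {}" "S \<inter> T = {}"
      and "z \<in> X (R \<union> S \<union> T)"
    then have "z \<in> sp_obj F (R \<union> S \<union> T)" using sub by simp
    then show "d1 R S (d1 (R \<union> S) T z) = d1 R (S \<union> T) z \<and>
      d2 R S (d1 (R \<union> S) T z) = d1 S T (d2 R (S \<union> T) z) \<and>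
      d2 (R \<union> S) T z = d2 S T (d2 R (S \<union> T) z)"
      by (rule d_coassoc[OF *])
  next
    fix S :: "'a set" and \<sigma> :: "'a \<Rightarrow> 'a" and x assume S: "finite S" and x: "x \<in> X S"
    note x' = sub[OF S x]
    show "d2 {} S x = x \<and> d1 S {} x = x" by (rule d_counit[OF S x'])
    show "sp_map F S id x = x" by (rule map_id[OF S x'])
    assume \<sigma>: "inj_on \<sigma> S"
    show "sp_map F S \<sigma> x \<in> X (\<sigma> ` S)" by (rule map[OF S \<sigma> x])
    show "sp_map F S \<sigma> x = sp_map F S \<rho> x" if "\<And>a. a \<in> S \<Longrightarrow> \<sigma> a = \<rho> a" for \<rho>
      by (rule map_cong[OF S \<sigma> that x'])
    show "sp_map F S (\<tau> \<circ> \<sigma>) x = sp_map F (\<sigma> ` S) \<tau> (sp_map F S \<sigma> x)" if "inj_on \<tau> (\<sigma> ` S)" for \<tau>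
      by (rule map_comp[OF S \<sigma> that x'])
  qed (rule X(2))
qed

locale linearized_hopf_monoid = connected_hopf_monoid p nabla Delta
  for p :: "('u, 'v::ab_group_add, 'k::field) connected_species_data" and nabla Delta +
  fixes P :: "'u set \<Rightarrow> 'v set"
  assumes linearized: "linearized p nabla Delta P"
begin

definition basis_mul :: "'u set \<Rightarrow> 'u set \<Rightarrow> 'v \<Rightarrow> 'v \<Rightarrow> 'v" where
  "basis_mul S T x y = nabla S T (sp_pure p x y)"

definition basis_left :: "'u set \<Rightarrow> 'u set \<Rightarrow> 'v \<Rightarrow> 'v" where
  "basis_left S T z = fst (coproduct_parts p Delta P S T z)"

definition basis_right :: "'u set \<Rightarrow> 'u set \<Rightarrow> 'v \<Rightarrow> 'v" where
  "basis_right S T z = snd (coproduct_parts p Delta P S T z)"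

lemma basis:
  assumes "finite S"
  shows basis_independent: "\<not> dependent (P S)" and basis_span: "span (P S) = sp_obj p S"
    and basis_obj: "x \<in> P S \<Longrightarrow> x \<in> sp_obj p S"
    and basis_map: "inj_on \<sigma> S \<Longrightarrow> x \<in> P S \<Longrightarrow> sp_map p S \<sigma> x \<in> P (\<sigma> ` S)"
    and basis_nonzero: "x \<in> P S \<Longrightarrow> x \<noteq> 0"
proof -
  have b: "species_basis p P" using linearized by (simp add: linearized_def)
  show ind: "\<not> dependent (P S)" and sp: "span (P S) = sp_obj p S"
    using b assms by (auto simp: species_basis_def)
  show "x \<in> P S \<Longrightarrow> x \<in> sp_obj p S" using sp span_base by blast
  have "set_subspecies p P" using b by (simp add: species_basis_def)
  then show "sp_map p S \<sigma> x \<in> P (\<sigma> ` S)" if "inj_on \<sigma> S" "x \<in> P S"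
    using assms that unfolding set_subspecies_def by (metis image_subset_iff)
  show "x \<in> P S \<Longrightarrow> x \<noteq> 0" using ind dependent_zero by blast
qed

lemma basis_empty: "P {} = {sp_one p}"
  using linearized by (simp add: linearized_def species_basis_def)

lemma basis_mul_closed:
  "\<lbrakk>finite S; finite T; S \<inter> T = {}; x \<in> P S; y \<in> P T\<rbrakk> \<Longrightarrow> basis_mul S T x y \<in> P (S \<union> T)"
  using linearized by (simp add: linearized_def product_restricts_def basis_mul_def)

lemma Delta_basis:
  assumes "finite S" "finite T" "S \<inter> T = {}" "z \<in> P (S \<union> T)"
  shows "basis_left S T z \<in> P S" "basis_right S T z \<in> P T"
    "Delta S T z = sp_pure p (basis_left S T z) (basis_right S T z)"
proof -
  obtain x y where xy: "x \<in> P S" "y \<in> P T" "Delta S T z = sp_pure p x y"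
    using linearized assms unfolding linearized_def coproduct_restricts_def by meson
  have "coproduct_parts p Delta P S T z = (x, y)"
    using coproduct_partsI[of p P S T x y Delta z] vector_space_axioms basis_independent assms xy by blast
  then show "basis_left S T z \<in> P S" "basis_right S T z \<in> P T"
    "Delta S T z = sp_pure p (basis_left S T z) (basis_right S T z)"
    using xy by (simp_all add: basis_left_def basis_right_def)
qed

lemma pure_basis_inject:
  "\<lbrakk>finite S; finite T; x \<in> P S; x' \<in> P S; y \<in> P T; sp_pure p x y = sp_pure p x' y'\<rbrakk> \<Longrightarrow> x = x' \<and> y = y'"
  using pure_tensor_inject[OF vector_space_axioms vector_space_axioms basis_independent] basis_nonzero
  by metis

text \<open>
  Evaluating a linear axiom on basis elements gives an equation between basis elements (for the
  product) or between pure tensors of basis elements (for the coproduct), and such a pure tensor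
  determines its factors.
\<close>

lemma basis_set_hopf_monoid:
  "set_hopf_monoid (subspecies p P) (sp_one p) basis_mul basis_left basis_right"
proof (unfold_locales, unfold subspecies_def species.select_convs)
  note sub = obj_subspace_of
  fix S T :: "'u set" and \<sigma> :: "'u \<Rightarrow> 'u" and x y z
  assume S: "finite S"
  show "sp_map p S id x = x" if "x \<in> P S" using map_id S that basis_obj by blast
  show "basis_mul {} S (sp_one p) x = x" "basis_mul S {} x (sp_one p) = x" if "x \<in> P S"
    using S that by (simp_all add: basis_mul_def nabla_unit_left nabla_unit_right basis_obj)
  show "basis_right {} S z = z \<and> basis_left S {} z = z" if z: "z \<in> P S"
  proof -
    have one: "sp_one p \<in> P {}" by (simp add: basis_empty)
    have "sp_pure p (basis_left {} S z) (basis_right {} S z) = sp_pure p (sp_one p) z"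
      "sp_pure p (basis_left S {} z) (basis_right S {} z) = sp_pure p z (sp_one p)"
      using Delta_basis(3)[of "{}" S z] Delta_basis(3)[of S "{}" z] S z
        Delta_counit_left[OF S basis_obj[OF S z]] Delta_counit_right[OF S basis_obj[OF S z]] by simp_all
    then show ?thesis
      using pure_basis_inject[of "{}" S "basis_left {} S z" "sp_one p" "basis_right {} S z" z]
        pure_basis_inject[of S "{}" "basis_left S {} z" z "basis_right S {} z" "sp_one p"]
        Delta_basis(1,2)[of "{}" S z] Delta_basis(1,2)[of S "{}" z] S z one by simp
  qed
  {
    assume \<sigma>: "inj_on \<sigma> S" and x: "x \<in> P S"
    show "sp_map p S \<sigma> x \<in> P (\<sigma> ` S)" using basis_map S \<sigma> x by blast
    show "sp_map p S \<sigma> x = sp_map p S \<rho> x" if "\<And>a. a \<in> S \<Longrightarrow> \<sigma> a = \<rho> a" for \<rho>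
      using map_cong[OF S \<sigma> that] basis_obj S x by blast
    show "sp_map p S (\<tau> \<circ> \<sigma>) x = sp_map p (\<sigma> ` S) \<tau> (sp_map p S \<sigma> x)" if "inj_on \<tau> (\<sigma> ` S)" for \<tau>
      using map_comp[OF S \<sigma> that] basis_obj S x by blast
  }
  {
    assume T: "finite T" and dis: "S \<inter> T = {}"
    show "basis_mul S T x y \<in> P (S \<union> T)" if "x \<in> P S" "y \<in> P T"
      by (rule basis_mul_closed[OF S T dis that])
    show "basis_left S T z \<in> P S \<and> basis_right S T z \<in> P T" if "z \<in> P (S \<union> T)"
      using Delta_basis[OF S T dis that] by blast
    assume \<sigma>: "inj_on \<sigma> (S \<union> T)"
    note \<sigma>' = conjunct1[OF image_disjoint[OF \<sigma> dis]] conjunct2[OF image_disjoint[OF \<sigma> dis]]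
    have fin: "finite (S \<union> T)" "finite (\<sigma> ` S)" "finite (\<sigma> ` T)" using S T by auto
    note tm = tensor_map[OF sub[OF S] sub[OF T] map_linear[OF S \<sigma>'(1)] map_linear[OF T conjunct1[OF \<sigma>'(2)]]]
    show "sp_map p (S \<union> T) \<sigma> (basis_mul S T x y) =
        basis_mul (\<sigma> ` S) (\<sigma> ` T) (sp_map p S \<sigma> x) (sp_map p T \<sigma> y)" if "x \<in> P S" "y \<in> P T"
      using nabla_natural[OF S T dis \<sigma> pure_tensor_in_tensor_space[OF basis_obj[OF S that(1)] basis_obj[OF T that(2)]]]
        basis_obj[OF S that(1)] basis_obj[OF T that(2)] by (simp add: basis_mul_def tm(2))
    show "basis_left (\<sigma> ` S) (\<sigma> ` T) (sp_map p (S \<union> T) \<sigma> z) = sp_map p S \<sigma> (basis_left S T z) \<and>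
        basis_right (\<sigma> ` S) (\<sigma> ` T) (sp_map p (S \<union> T) \<sigma> z) = sp_map p T \<sigma> (basis_right S T z)"
      if z: "z \<in> P (S \<union> T)"
    proof (rule pure_basis_inject[OF fin(2,3)])
      note D = Delta_basis[OF S T dis z]
      have z': "sp_map p (S \<union> T) \<sigma> z \<in> P (\<sigma> ` S \<union> \<sigma> ` T)"
        using basis_map[OF fin(1) \<sigma> z] by (simp add: image_Un)
      note D' = Delta_basis[OF fin(2,3) conjunct2[OF \<sigma>'(2)] z']
      show "basis_left (\<sigma> ` S) (\<sigma> ` T) (sp_map p (S \<union> T) \<sigma> z) \<in> P (\<sigma> ` S)"
        "basis_right (\<sigma> ` S) (\<sigma> ` T) (sp_map p (S \<union> T) \<sigma> z) \<in> P (\<sigma> ` T)" using D' by auto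
      show "sp_map p S \<sigma> (basis_left S T z) \<in> P (\<sigma> ` S)" by (rule basis_map[OF S \<sigma>'(1) D(1)])
      show "sp_pure p (basis_left (\<sigma> ` S) (\<sigma> ` T) (sp_map p (S \<union> T) \<sigma> z))
          (basis_right (\<sigma> ` S) (\<sigma> ` T) (sp_map p (S \<union> T) \<sigma> z)) =
        sp_pure p (sp_map p S \<sigma> (basis_left S T z)) (sp_map p T \<sigma> (basis_right S T z))"
        using Delta_natural[OF S T dis \<sigma> basis_obj[OF fin(1) z]] basis_obj[OF S D(1)] basis_obj[OF T D(2)]
        by (simp add: D(3) D'(3) tm(2))
    qed
  }
  {
    fix R :: "'u set"
    assume R: "finite R" and T: "finite T" and dis: "R \<inter> S = {}" "R \<inter> T = {}" "S \<inter> T = {}"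
    have dis': "(R \<union> S) \<inter> T = {}" "R \<inter> (S \<union> T) = {}" using dis by auto
    have fin: "finite (R \<union> S)" "finite (S \<union> T)" "finite (R \<union> S \<union> T)" using R S T by auto
    note as = tensor_assoc[OF sub[OF R] sub[OF S] sub[OF T]]
    show "basis_mul (R \<union> S) T (basis_mul R S x y) z = basis_mul R (S \<union> T) x (basis_mul S T y z)"
      if x: "x \<in> P R" "y \<in> P S" "z \<in> P T"
    proof -
      note t1 = tensor_map[OF subspace_of_tensor_space sub[OF T] nabla_linear[OF R S dis(1)] linear_on_id]
      note t2 = tensor_map[OF sub[OF R] subspace_of_tensor_space linear_on_id nabla_linear[OF S T dis(3)]]
      note o = basis_obj[OF R x(1)] basis_obj[OF S x(2)] basis_obj[OF T x(3)]
      have "pure_tensor tensor_scale (sp_scale p) (sp_pure p x y) z \<in>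
          tensor_space tensor_scale (sp_scale p) (sp_tensor p R S) (sp_obj p T)"
        using o by (intro pure_tensor_in_tensor_space)
      from nabla_assoc[OF R S T dis this] o show ?thesis
        by (simp add: basis_mul_def t1(2) t2(2) as(2) pure_tensor_in_tensor_space)
    qed
    show "basis_left R S (basis_left (R \<union> S) T z) = basis_left R (S \<union> T) z \<and>
        basis_right R S (basis_left (R \<union> S) T z) = basis_left S T (basis_right R (S \<union> T) z) \<and>
        basis_right (R \<union> S) T z = basis_right S T (basis_right R (S \<union> T) z)"
      if z: "z \<in> P (R \<union> S \<union> T)"
    proof -
      note t1 = tensor_map[OF sub[OF fin(1)] sub[OF T] Delta_linear[OF R S dis(1)] linear_on_id]
      note t2 = tensor_map[OF sub[OF R] sub[OF fin(2)] linear_on_id Delta_linear[OF S T dis(3)]]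
      note D1 = Delta_basis[OF fin(1) T dis'(1) z] and D2 = Delta_basis[OF R fin(2) dis'(2) z[unfolded Un_assoc]]
      note D3 = Delta_basis[OF R S dis(1) D1(1)] and D4 = Delta_basis[OF S T dis(3) D2(2)]
      have eq: "pure_tensor (sp_scale p) tensor_scale (basis_left R S (basis_left (R \<union> S) T z))
          (sp_pure p (basis_right R S (basis_left (R \<union> S) T z)) (basis_right (R \<union> S) T z)) =
        pure_tensor (sp_scale p) tensor_scale (basis_left R (S \<union> T) z)
          (sp_pure p (basis_left S T (basis_right R (S \<union> T) z)) (basis_right S T (basis_right R (S \<union> T) z)))"
        using Delta_coassoc[OF R S T dis basis_obj[OF fin(3) z]] D1 D2 D3 D4 R S T fin
        by (simp add: t1(2) t2(2) as(2) basis_obj)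
      have nz: "sp_pure p (basis_right R S (basis_left (R \<union> S) T z)) (basis_right (R \<union> S) T z) \<noteq> 0"
        using pure_tensor_nonzero[OF vector_space_axioms vector_space_axioms] basis_nonzero D1(2) D3(2) S T by blast
      note inj = pure_tensor_inject[OF vector_space_axioms vector_space_tensor_scale basis_independent[OF R] D3(1) D2(1) nz eq]
      show ?thesis
        using inj pure_basis_inject[OF S T D3(2) D4(1) D1(2) inj(2)] by simp
    qed
  }
next
  note sub = obj_subspace_of
  fix R R' S S' :: "'u set" and x y
  assume R: "finite R" "finite R'" "R \<inter> R' = {}" and S: "S \<inter> S' = {}" "R \<union> R' = S \<union> S'"
    and x: "x \<in> P R" "y \<in> P R'"
  define A B A' B' where A: "A = R \<inter> S" "B = R \<inter> S'" "A' = R' \<inter> S" "B' = R' \<inter> S'"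
  have fS: "finite S" "finite S'" using R S(2) by (metis finite_Un)+
  have U: "A \<union> B = R" "A' \<union> B' = R'" "A \<union> A' = S" "B \<union> B' = S'" using A S(2) by auto
  have di: "A \<inter> B = {}" "A' \<inter> B' = {}" "A \<inter> A' = {}" "B \<inter> B' = {}" using A S(1) R(3) by auto
  have fi: "finite A" "finite B" "finite A'" "finite B'" using A R by auto
  note t1 = tensor_map[OF sub[OF R(1)] sub[OF R(2)] Delta_linear[OF fi(1,2) di(1), unfolded U]
      Delta_linear[OF fi(3,4) di(2), unfolded U]]
  note t2 = tensor_middle_swap[OF sub[OF fi(1)] sub[OF fi(2)] sub[OF fi(3)] sub[OF fi(4)]]
  note t3 = tensor_map[OF subspace_of_tensor_space subspace_of_tensor_space
      nabla_linear[OF fi(1,3) di(3), unfolded U] nabla_linear[OF fi(2,4) di(4), unfolded U]]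
  note o = basis_obj[OF R(1) x(1)] basis_obj[OF R(2) x(2)]
  note D1 = Delta_basis[OF fi(1,2) di(1), unfolded U, OF x(1)]
    and D2 = Delta_basis[OF fi(3,4) di(2), unfolded U, OF x(2)]
  note M = basis_mul_closed[OF R x, unfolded S(2)]
  note D = Delta_basis[OF fS S(1) M]
  note M1 = basis_mul_closed[OF fi(1,3) di(3) D1(1) D2(1), unfolded U]
    and M2 = basis_mul_closed[OF fi(2,4) di(4) D1(2) D2(2), unfolded U]
  have "sp_pure p (basis_left S S' (basis_mul R R' x y)) (basis_right S S' (basis_mul R R' x y)) =
      Delta S S' (nabla R R' (sp_pure p x y))"
    using D(3) by (simp add: basis_mul_def)
  also have "\<dots> = sp_pure p (basis_mul A A' (basis_left A B x) (basis_left A' B' y))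
      (basis_mul B B' (basis_right A B x) (basis_right A' B' y))"
    using compatible[OF R S A pure_tensor_in_tensor_space[OF o]] o D1 D2 fi
    by (simp add: t1(2) t2(2) t3(2) basis_obj basis_mul_def pure_tensor_in_tensor_space)
  finally show "basis_left S S' (basis_mul R R' x y) =
        basis_mul (R \<inter> S) (R' \<inter> S) (basis_left (R \<inter> S) (R \<inter> S') x) (basis_left (R' \<inter> S) (R' \<inter> S') y) \<and>
      basis_right S S' (basis_mul R R' x y) =
        basis_mul (R \<inter> S') (R' \<inter> S') (basis_right (R \<inter> S) (R \<inter> S') x) (basis_right (R' \<inter> S) (R' \<inter> S') y)"
    using pure_basis_inject[OF fS D(1) M1 D(2)] by (simp add: A)
qed (simp_all add: basis_empty)

sublocale basis: set_hopf_monoid "subspecies p P" "sp_one p" basis_mul basis_left basis_right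
  by (rule basis_set_hopf_monoid)

text \<open>
  The image of \<open>\<nabla>\<^sub>S\<^sub>,\<^sub>T\<close> is spanned by products of basis elements, which are again basis elements. By
  independence, a basis element in their span is one of them.
\<close>

lemma decomposable_basis:
  assumes fin: "finite S" "finite T" "S \<inter> T = {}" and x: "x \<in> P (S \<union> T)"
  shows "x \<in> nabla S T ` sp_tensor p S T \<longleftrightarrow> (\<exists>a\<in>P S. \<exists>b\<in>P T. x = basis_mul S T a b)"
proof
  assume "\<exists>a\<in>P S. \<exists>b\<in>P T. x = basis_mul S T a b"
  then show "x \<in> nabla S T ` sp_tensor p S T"
    using fin by (auto simp: basis_mul_def intro!: imageI pure_tensor_in_tensor_space basis_obj)
next
  assume "x \<in> nabla S T ` sp_tensor p S T"
  then obtain t where t: "t \<in> sp_tensor p S T" "x = nabla S T t" by blast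
  let ?M = "{basis_mul S T a b | a b. a \<in> P S \<and> b \<in> P T}"
  have tens: "sp_tensor p S T = module.span tensor_scale {sp_pure p a b | a b. a \<in> P S \<and> b \<in> P T}"
    using tensor_space_span[OF vector_space_axioms vector_space_axioms, of "P S" "P T"]
    by (simp add: basis_span fin)
  have lin: "linear_on tensor_scale (sp_scale p) (sp_tensor p S T) (span ?M) (nabla S T)"
    unfolding tens
    by (rule linear_on_span_into[OF vector_space_tensor_scale subspace_of_span[OF vector_space_axioms]
          nabla_linear[OF fin, unfolded tens]])
      (auto simp: basis_mul_def intro!: span_base)
  have "x \<in> span ?M" using linear_onD(1)[OF lin t(1)] t(2) by simp
  moreover have "?M \<subseteq> P (S \<union> T)" using basis_mul_closed[OF fin] by auto
  moreover have "x \<notin> span (P (S \<union> T) - {x})"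
    using basis_independent[of "S \<union> T"] fin x unfolding dependent_def by blast
  ultimately have "x \<in> ?M" using span_mono[of ?M "P (S \<union> T) - {x}"] by blast
  then show "\<exists>a\<in>P S. \<exists>b\<in>P T. x = basis_mul S T a b" by auto
qed

end

section \<open>Strongly linearized commutative Hopf monoids\<close>

locale strongly_linearized_hopf_monoid = linearized_hopf_monoid p nabla Delta P
  for p :: "('u, 'v::ab_group_add, 'k::field) connected_species_data" and nabla Delta P +
  assumes commutative: "commutative_product p nabla"
    and strong: "strongly_linearized p nabla Delta P"
begin

abbreviation Q :: "'u set \<Rightarrow> 'v set" where
  "Q \<equiv> indecomposables p nabla P"

abbreviation Qo :: "'u set \<Rightarrow> 'v set" where
  "Qo \<equiv> connected_basis p Q"

abbreviation qo :: "('u, 'v, 'k) connected_species_data" where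
  "qo \<equiv> span_connected p Q"

abbreviation L :: "('u, ('u set \<times> 'v) set) species" where
  "L \<equiv> labeled_partitions (subspecies p Q)"

lemma indecomposable_basis:
  assumes "finite I" "I \<noteq> {}"
  shows "x \<in> Q I \<longleftrightarrow> x \<in> P I \<and> (\<forall>S T. S \<union> T = I \<and> S \<inter> T = {} \<and> S \<noteq> {} \<and> T \<noteq> {} \<longrightarrow>
      (\<forall>a\<in>P S. \<forall>b\<in>P T. x \<noteq> basis_mul S T a b))"
proof -
  have dec: "x \<in> nabla S T ` sp_tensor p S T \<longleftrightarrow> (\<exists>a\<in>P S. \<exists>b\<in>P T. x = basis_mul S T a b)"
    if "x \<in> P I" "S \<union> T = I" "S \<inter> T = {}" for S T
    using decomposable_basis[of S T x] that assms(1) by (metis finite_Un)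
  have "x \<in> Q I \<longleftrightarrow> x \<in> P I \<and> (\<forall>S T. S \<union> T = I \<and> S \<inter> T = {} \<and> S \<noteq> {} \<and> T \<noteq> {} \<longrightarrow>
      x \<notin> nabla S T ` sp_tensor p S T)"
    using assms(2) by (simp add: indecomposables_def)
  also have "\<dots> \<longleftrightarrow> x \<in> P I \<and> (\<forall>S T. S \<union> T = I \<and> S \<inter> T = {} \<and> S \<noteq> {} \<and> T \<noteq> {} \<longrightarrow>
      (\<forall>a\<in>P S. \<forall>b\<in>P T. x \<noteq> basis_mul S T a b))"
    by (intro conj_cong refl all_cong1 imp_cong) (simp add: dec)
  finally show ?thesis .
qed

lemma Q_in_P: "x \<in> Q I \<Longrightarrow> x \<in> P I"
  by (auto simp: indecomposables_def split: if_splits)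

lemma Q_empty: "Q {} = {}"
  by (simp add: indecomposables_def)

text \<open>
  A factorization of the image of \<open>x\<close> could be carried back to \<open>x\<close> by the inverse bijection.
\<close>

lemma Q_map:
  assumes S: "finite S" "inj_on \<sigma> S" and x: "x \<in> Q S"
  shows "sp_map p S \<sigma> x \<in> Q (\<sigma> ` S)"
proof -
  have ne: "S \<noteq> {}" using x Q_empty by auto
  note xP = Q_in_P[OF x]
  define \<tau> where "\<tau> = inv_into S \<sigma>"
  have \<tau>: "inj_on \<tau> (\<sigma> ` S)" "\<tau> ` (\<sigma> ` S) = S" "\<And>a. a \<in> S \<Longrightarrow> (\<tau> \<circ> \<sigma>) a = id a"
    using S(2) by (auto simp: \<tau>_def inj_on_inv_into inv_into_image_cancel)
  have undo: "sp_map p (\<sigma> ` S) \<tau> (sp_map p S \<sigma> x) = x"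
    by (rule trans[OF map_comp[OF S \<tau>(1) basis_obj[OF S(1) xP], symmetric] trans[OF
          map_cong[OF S(1) comp_inj_on[OF S(2) \<tau>(1)] \<tau>(3) basis_obj[OF S(1) xP]]
          map_id[OF S(1) basis_obj[OF S(1) xP]]]])
  have "sp_map p S \<sigma> x \<noteq> basis_mul T1 T2 a c"
    if T: "T1 \<union> T2 = \<sigma> ` S" "T1 \<inter> T2 = {}" "T1 \<noteq> {}" "T2 \<noteq> {}" and ac: "a \<in> P T1" "c \<in> P T2" for T1 T2 a c
  proof
    assume eq: "sp_map p S \<sigma> x = basis_mul T1 T2 a c"
    have fin: "finite T1" "finite T2" using T(1) S(1) by (metis finite_Un finite_imageI)+
    have inj: "inj_on \<tau> (T1 \<union> T2)" using \<tau>(1) T(1) by simp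
    note \<tau>' = image_disjoint[OF inj T(2)]
    have "x = basis_mul (\<tau> ` T1) (\<tau> ` T2) (sp_map p T1 \<tau> a) (sp_map p T2 \<tau> c)"
      using basis.mul_natural[OF fin T(2) inj, of a c] ac undo eq T(1) by (simp add: subspecies_def)
    moreover have "sp_map p T1 \<tau> a \<in> P (\<tau> ` T1)" "sp_map p T2 \<tau> c \<in> P (\<tau> ` T2)"
      using basis_map[OF fin(1) _ ac(1)] basis_map[OF fin(2) _ ac(2)] \<tau>' by auto
    moreover have "\<tau> ` T1 \<union> \<tau> ` T2 = S" using T(1) \<tau>(2) by (metis image_Un)
    ultimately show False
      using indecomposable_basis[OF S(1) ne, of x] x \<tau>' T(3,4) by (metis image_is_empty)
  qed
  then show ?thesis
    using indecomposable_basis[of "\<sigma> ` S" "sp_map p S \<sigma> x"] S(1) ne basis_map[OF S xP] by simp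
qed

lemma Q_restricts:
  assumes "finite S" "finite T" "S \<inter> T = {}" "S \<noteq> {}" "T \<noteq> {}" "l \<in> Q (S \<union> T)"
  shows "basis_left S T l \<in> Q S \<and> basis_right S T l \<in> Q T"
proof -
  obtain x y where xy: "x \<in> Q S" "y \<in> Q T" "Delta S T l = sp_pure p x y"
    using strong assms unfolding strongly_linearized_def coproduct_restricts_def by meson
  have "coproduct_parts p Delta P S T l = (x, y)"
    using coproduct_partsI[of p P S T x y Delta l] vector_space_axioms basis_independent assms xy Q_in_P by blast
  then show ?thesis using xy by (simp add: basis_left_def basis_right_def)
qed

sublocale blocks: block_hopf_monoid "subspecies p P" "sp_one p" basis_mul basis_left basis_right "subspecies p Q"
proof (unfold_locales, unfold subspecies_def species.select_convs)
  fix S T :: "'u set" and x y assume "finite S" "finite T" "S \<inter> T = {}" "x \<in> P S" "y \<in> P T"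
  then show "basis_mul S T x y = basis_mul T S y x"
    using commutative[unfolded commutative_product_def, rule_format, of S T x y]
    by (simp add: basis_mul_def basis_obj)
next
  fix S :: "'u set" and \<sigma> :: "'u \<Rightarrow> 'u" and x assume S: "finite S" and x: "x \<in> Q S"
  note x' = basis_obj[OF S Q_in_P[OF x]]
  show "sp_map p S id x = x" by (rule map_id[OF S x'])
  assume \<sigma>: "inj_on \<sigma> S"
  show "sp_map p S \<sigma> x \<in> Q (\<sigma> ` S)" by (rule Q_map[OF S \<sigma> x])
  show "sp_map p S \<sigma> x = sp_map p S \<rho> x" if "\<And>a. a \<in> S \<Longrightarrow> \<sigma> a = \<rho> a" for \<rho>
    by (rule map_cong[OF S \<sigma> that x'])
  show "sp_map p S (\<tau> \<circ> \<sigma>) x = sp_map p (\<sigma> ` S) \<tau> (sp_map p S \<sigma> x)" if "inj_on \<tau> (\<sigma> ` S)" for \<tau>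
    by (rule map_comp[OF S \<sigma> that x'])
next
  fix I :: "'u set" and x assume I: "finite I" "I \<noteq> {}" and x: "x \<in> P I"
  show "x \<in> Q I \<longleftrightarrow> (\<forall>S T. S \<union> T = I \<and> S \<inter> T = {} \<and> S \<noteq> {} \<and> T \<noteq> {} \<longrightarrow>
        (\<forall>a\<in>P S. \<forall>b\<in>P T. x \<noteq> basis_mul S T a b))"
    using indecomposable_basis[OF I, of x] x by simp
qed (simp_all add: Q_in_P Q_restricts)

lemma Qo_simps: "Qo {} = {sp_one p}" "S \<noteq> {} \<Longrightarrow> Qo S = Q S"
  by (simp_all add: connected_basis_def)

lemma Qo_in_P: "x \<in> Qo S \<Longrightarrow> x \<in> P S"
  by (cases "S = {}") (auto simp: Qo_simps basis_empty Q_in_P)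

lemma Qo_map:
  assumes "finite S" "inj_on \<sigma> S" "x \<in> Qo S"
  shows "sp_map p S \<sigma> x \<in> Qo (\<sigma> ` S)"
proof (cases "S = {}")
  case True
  then show ?thesis
    using basis_map[OF assms(1,2) Qo_in_P[OF assms(3)]] by (simp add: Qo_simps basis_empty)
next
  case False
  then show ?thesis using Q_map[OF assms(1,2)] assms(3) by (simp add: Qo_simps)
qed

lemma Qo_restricts:
  assumes "finite S" "finite T" "S \<inter> T = {}" "z \<in> Qo (S \<union> T)"
  shows "basis_left S T z \<in> Qo S" "basis_right S T z \<in> Qo T"
proof -
  have P: "basis_left S T z \<in> P S" "basis_right S T z \<in> P T"
    using Delta_basis[OF assms(1-3) Qo_in_P[OF assms(4)]] by auto
  show "basis_left S T z \<in> Qo S"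
  proof (cases "S = {}")
    case False
    then show ?thesis
      using blocks.d_block_nonempty(1)[OF assms(1-3), of z] assms(4) by (simp add: Qo_simps subspecies_def)
  qed (use P in \<open>simp add: Qo_simps basis_empty\<close>)
  show "basis_right S T z \<in> Qo T"
  proof (cases "T = {}")
    case False
    then show ?thesis
      using blocks.d_block_nonempty(2)[OF assms(1-3), of z] assms(4) by (simp add: Qo_simps subspecies_def)
  qed (use P in \<open>simp add: Qo_simps basis_empty\<close>)
qed

lemma qo_simps:
  "sp_map qo = sp_map p" "sp_scale qo = sp_scale p" "sp_unit qo = sp_unit p" "sp_counit qo = sp_counit p"
  by (simp_all add: span_connected_def)

lemma qo_obj: "sp_obj qo S = span (Qo S)"
proof (cases "S = {}")
  case True
  then show ?thesis
    using basis_span[of "{}"] by (simp add: span_connected_def Qo_simps basis_empty)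
qed (simp add: span_connected_def Qo_simps)

lemma qo_in_p: "finite S \<Longrightarrow> x \<in> sp_obj qo S \<Longrightarrow> x \<in> sp_obj p S"
  unfolding qo_obj using span_mono[of "Qo S" "P S"] Qo_in_P basis_span by blast

lemma qo_subset: "finite S \<Longrightarrow> sp_obj qo S \<subseteq> sp_obj p S"
  using qo_in_p by blast

lemma qo_map_linear:
  assumes "finite S" "inj_on \<sigma> S"
  shows "linear_on (sp_scale p) (sp_scale p) (sp_obj qo S) (sp_obj qo (\<sigma> ` S)) (sp_map p S \<sigma>)"
  using linear_on_mono[OF map_linear[OF assms] qo_subset[OF assms(1)] subset_refl]
  unfolding qo_obj
  by (rule linear_on_span_into[OF vector_space_axioms subspace_of_span[OF vector_space_axioms]])
    (use Qo_map[OF assms] in \<open>auto intro: span_base\<close>)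

lemma Qo_subspecies: "set_subspecies (subspecies p P) Qo"
  using Qo_in_P Qo_map by (auto simp: set_subspecies_def subspecies_def)

lemma subspecies_Qo: "subspecies (subspecies p P) Qo = subspecies p Qo"
  by (simp add: subspecies_def)

lemma Qo_comonoid: "set_comonoid (subspecies p Qo) (sp_one p) basis_left basis_right"
  unfolding subspecies_Qo[symmetric]
  by (rule set_comonoid_subspecies[OF basis.set_comonoid_axioms Qo_subspecies Qo_simps(1)])
    (use Qo_restricts in auto)

lemma spanned_qo: "spanned_species qo (subspecies p Qo) id"
proof (intro spanned_species.intro connected_species.intro)
  show "set_species qo"
  proof (unfold_locales, unfold qo_simps)
    fix S :: "'u set" and \<sigma> :: "'u \<Rightarrow> 'u" and x assume S: "finite S" and x: "x \<in> sp_obj qo S"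
    note x' = qo_in_p[OF S x]
    show "sp_map p S id x = x" by (rule map_id[OF S x'])
    assume \<sigma>: "inj_on \<sigma> S"
    show "sp_map p S \<sigma> x \<in> sp_obj qo (\<sigma> ` S)" by (rule linear_onD(1)[OF qo_map_linear[OF S \<sigma>] x])
    show "sp_map p S \<sigma> x = sp_map p S \<rho> x" if "\<And>a. a \<in> S \<Longrightarrow> \<sigma> a = \<rho> a" for \<rho>
      by (rule map_cong[OF S \<sigma> that x'])
    show "sp_map p S (\<tau> \<circ> \<sigma>) x = sp_map p (\<sigma> ` S) \<tau> (sp_map p S \<sigma> x)" if "inj_on \<tau> (\<sigma> ` S)" for \<tau>
      by (rule map_comp[OF S \<sigma> that x'])
  qed
  show "vector_space (sp_scale qo)" using vector_space_axioms by (simp add: qo_simps)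
  have obj_empty: "sp_obj qo {} = sp_obj p {}" by (simp add: span_connected_def)
  show "connected_species_axioms qo"
    unfolding connected_species_axioms_def qo_simps obj_empty
    using qo_map_linear unit_linear counit_linear counit_unit unit_counit subspace_span
    by (auto simp: qo_obj)
  show "set_species (subspecies p Qo)" using Qo_comonoid by (rule set_comonoid.axioms)
  show "spanned_species_axioms qo (subspecies p Qo) id"
    by unfold_locales (simp_all add: qo_obj qo_simps subspecies_def)
qed

lemma Delta_Qo_linear:
  assumes "finite S" "finite T" "S \<inter> T = {}"
  shows "linear_on (sp_scale qo) tensor_scale (sp_obj qo (S \<union> T)) (sp_tensor qo S T) (Delta S T)"
proof -
  have fin: "finite (S \<union> T)" using assms by simp
  have "linear_on (sp_scale p) tensor_scale (span (Qo (S \<union> T)))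
      (tensor_space (sp_scale p) (sp_scale p) (sp_obj qo S) (sp_obj qo T)) (Delta S T)"
  proof (rule linear_on_span_into[OF vector_space_axioms subspace_of_tensor_space])
    show "linear_on (sp_scale p) tensor_scale (span (Qo (S \<union> T))) (sp_tensor p S T) (Delta S T)"
      using linear_on_mono[OF Delta_linear[OF assms] qo_subset[OF fin] subset_refl] unfolding qo_obj .
    fix z assume z: "z \<in> Qo (S \<union> T)"
    show "Delta S T z \<in> tensor_space (sp_scale p) (sp_scale p) (sp_obj qo S) (sp_obj qo T)"
      using Delta_basis(3)[OF assms Qo_in_P[OF z]] Qo_restricts[OF assms z]
      by (simp add: qo_obj pure_tensor_in_tensor_space span_base)
  qed
  then show ?thesis unfolding qo_simps qo_obj .
qed

text \<open>
  On \<open>Q\<degree>\<close> the comonoid axioms are those of \<open>P\<close>, since \<open>\<Delta>\<close> preserves \<open>Q\<degree>\<close>: by strong linearization for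
  nonempty \<open>S\<close> and \<open>T\<close>, and by the counit laws otherwise.
\<close>

lemma linearized_comonoid_qo: "linearized_comonoid qo Delta Qo"
  unfolding linearized_comonoid_def
proof (intro conjI allI impI)
  interpret q: spanned_species qo "subspecies p Qo" id by (rule spanned_qo)
  show "connected_comonoid qo Delta"
    by (rule q.linear_extension_comonoid[OF Qo_comonoid _ Delta_Qo_linear])
      (use Delta_basis(3) Qo_in_P in \<open>simp_all add: qo_simps subspecies_def\<close>)
  show "species_basis qo Qo"
    unfolding species_basis_def set_subspecies_def qo_simps qo_obj
  proof (intro conjI allI impI)
    fix S :: "'u set" assume S: "finite S"
    show "Qo S \<subseteq> span (Qo S)" by (rule span_superset)
    show "sp_map p S \<sigma> ` Qo S \<subseteq> Qo (\<sigma> ` S)" if "inj_on \<sigma> S" for \<sigma>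
      using Qo_map[OF S that] by blast
    show "independent (Qo S)"
      using basis_independent[OF S] by (rule independent_mono) (use Qo_in_P in blast)
  qed (simp_all add: Qo_simps)
  show "coproduct_restricts qo Delta Qo S T" if "finite S \<and> finite T \<and> S \<inter> T = {}" for S T
    unfolding coproduct_restricts_def qo_simps
    using Delta_basis(3)[of S T] Qo_restricts[of S T] Qo_in_P that by blast
qed

lemma labeled_partitions_Qo: "labeled_partitions (subspecies qo Qo) = L"
proof -
  have "X \<in> sp_obj (labeled_partitions (subspecies qo Qo)) I \<longleftrightarrow> X \<in> sp_obj L I" for X I
    unfolding labeled_partition_iff using Qo_simps(2) by (simp add: subspecies_def) blast
  then have "sp_obj (labeled_partitions (subspecies qo Qo)) = sp_obj L" by blast
  then show ?thesis by (simp add: labeled_partitions_def subspecies_def qo_simps)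
qed

lemma coproduct_parts_Qo:
  assumes "finite S" "finite T" "S \<inter> T = {}" "l \<in> Qo (S \<union> T)"
  shows "coproduct_parts qo Delta Qo S T l = (basis_left S T l, basis_right S T l)"
proof (rule coproduct_partsI)
  have "independent (Qo I)" if "finite I" for I
    using basis_independent[OF that] by (rule independent_mono) (use Qo_in_P in blast)
  then show "\<not> module.dependent (sp_scale qo) (Qo S)" "\<not> module.dependent (sp_scale qo) (Qo T)"
    using assms by (simp_all add: qo_simps)
qed (use assms Qo_restricts Delta_basis(3) Qo_in_P vector_space_axioms in \<open>simp_all add: qo_simps\<close>)

lemma partition_parts:
  assumes "finite S" "finite T" "S \<inter> T = {}" and X: "X \<in> sp_obj L (S \<union> T)"
  shows "partition_left qo Delta Qo S T X = restrict_blocks basis_left S T X"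
    and "partition_right qo Delta Qo S T X = restrict_blocks (\<lambda>T S. basis_right S T) T S X"
proof -
  have parts: "coproduct_parts qo Delta Qo (S \<inter> B) (T \<inter> B) l =
      (basis_left (S \<inter> B) (T \<inter> B) l, basis_right (S \<inter> B) (T \<inter> B) l)" if "(B, l) \<in> X" for B l
  proof (rule coproduct_parts_Qo)
    note B = labeled_partition_block[OF X that]
    have "S \<inter> B \<union> T \<inter> B = B" using B(3) by auto
    then show "l \<in> Qo (S \<inter> B \<union> T \<inter> B)" using B by (simp add: Qo_simps subspecies_def)
  qed (use assms in auto)
  show "partition_left qo Delta Qo S T X = restrict_blocks basis_left S T X"
    unfolding partition_left_def restrict_blocks_def using parts by (intro Collect_cong) (metis fst_conv)
  show "partition_right qo Delta Qo S T X = restrict_blocks (\<lambda>T S. basis_right S T) T S X"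
    unfolding partition_right_def restrict_blocks_def using parts by (intro Collect_cong) (metis snd_conv)
qed

abbreviation SQ :: "('u, ('u set \<times> 'v) set \<Rightarrow>\<^sub>0 'k, 'k) connected_species_data" where
  "SQ \<equiv> partition_species qo Qo"

lemma spanned_SQ: "spanned_species SQ L free_elem"
  unfolding partition_species_def labeled_partitions_Qo
  by (rule spanned_species_free[OF set_species_labeled_partitions[OF blocks.G.set_species_axioms]
        labeled_partitions_empty])

sublocale SQ: spanned_species SQ L free_elem
  by (rule spanned_SQ)

lemma SQ_scale: "sp_scale SQ = free_scale"
  by (simp add: partition_species_def free_connected_def)

lemma SQ_obj: "sp_obj SQ I = {u. Poly_Mapping.keys u \<subseteq> sp_obj L I}"
  by (simp add: partition_species_def free_connected_def labeled_partitions_Qo)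

lemma SQ_one: "sp_one SQ = free_elem {}"
  by (auto simp: partition_species_def free_connected_def lookup_free_scale intro!: poly_mapping_eqI)

lemma SQ_product:
  assumes "S \<inter> T = {}"
  shows "linear_on tensor_scale (sp_scale SQ) (sp_tensor SQ S T) (sp_obj SQ (S \<union> T)) (partition_product qo Qo S T)"
    and "\<lbrakk>X \<in> sp_obj L S; Y \<in> sp_obj L T\<rbrakk> \<Longrightarrow>
      partition_product qo Qo S T (sp_pure SQ (free_elem X) (free_elem Y)) = free_elem (X \<union> Y)"
  using partition_product_linear[OF assms, where q = qo and Q = Qo] by (simp_all add: labeled_partitions_Qo)

lemma SQ_coproduct:
  assumes "finite S" "finite T" "S \<inter> T = {}"
  shows "linear_on (sp_scale SQ) tensor_scale (sp_obj SQ (S \<union> T)) (sp_tensor SQ S T) (partition_coproduct qo Delta Qo S T)"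
    and "Z \<in> sp_obj L (S \<union> T) \<Longrightarrow> partition_coproduct qo Delta Qo S T (free_elem Z) =
      sp_pure SQ (free_elem (restrict_blocks basis_left S T Z))
        (free_elem (restrict_blocks (\<lambda>T S. basis_right S T) T S Z))"
proof -
  have "partition_left qo Delta Qo S T Z \<in> sp_obj (labeled_partitions (subspecies qo Qo)) S \<and>
      partition_right qo Delta Qo S T Z \<in> sp_obj (labeled_partitions (subspecies qo Qo)) T"
    if "Z \<in> sp_obj (labeled_partitions (subspecies qo Qo)) (S \<union> T)" for Z
    using that partition_parts[OF assms] blocks.d_block_product(3,4)[OF assms]
    by (simp add: labeled_partitions_Qo)
  note * = partition_coproduct_linear[OF this]
  show "linear_on (sp_scale SQ) tensor_scale (sp_obj SQ (S \<union> T)) (sp_tensor SQ S T) (partition_coproduct qo Delta Qo S T)"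
    by (rule *(1))
  show "partition_coproduct qo Delta Qo S T (free_elem Z) =
      sp_pure SQ (free_elem (restrict_blocks basis_left S T Z))
        (free_elem (restrict_blocks (\<lambda>T S. basis_right S T) T S Z))" if "Z \<in> sp_obj L (S \<union> T)"
    using *(2)[of Z] partition_parts[OF assms that] by simp
qed

lemma SQ_hopf_monoid:
  "connected_hopf_monoid SQ (partition_product qo Qo) (partition_coproduct qo Delta Qo)"
  by (rule SQ.linear_extension_hopf_monoid[OF blocks.labeled_partitions_hopf_monoid SQ_one[symmetric]])
    (simp_all add: SQ_product SQ_coproduct)

definition \<Phi> :: "'u set \<Rightarrow> (('u set \<times> 'v) set \<Rightarrow>\<^sub>0 'k) \<Rightarrow> 'v" where
  "\<Phi> = (\<lambda>I\<in>Collect finite. \<lambda>u\<in>sp_obj SQ I. free_lift (sp_scale p) blocks.block_product u)"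

lemma \<Phi>_elem: "finite I \<Longrightarrow> X \<in> sp_obj L I \<Longrightarrow> \<Phi> I (free_elem X) = blocks.block_product X"
  by (simp add: \<Phi>_def SQ_obj free_lift_elem[OF vector_space_axioms])

lemma block_product_bij: "finite I \<Longrightarrow> bij_betw blocks.block_product (sp_obj L I) (P I)"
  using blocks.bij_betw_block_product[of I] by (simp add: subspecies_def)

lemma block_product_in_P: "finite I \<Longrightarrow> X \<in> sp_obj L I \<Longrightarrow> blocks.block_product X \<in> P I"
  using bij_betw_apply[OF block_product_bij] .

text \<open>
  \<open>block_product\<close> sends the basis \<open>\<S>(Q)[I]\<close> of the source bijectively to the basis \<open>P[I]\<close> of the target.
\<close>

lemma \<Phi>_bij:
  assumes "finite I"
  shows "bij_betw (\<Phi> I) (sp_obj SQ I) (sp_obj p I)"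
proof -
  note b = block_product_bij[OF assms]
  have img: "blocks.block_product ` sp_obj L I = P I" using b by (rule bij_betw_imp_surj_on)
  have "bij_betw (free_lift (sp_scale p) blocks.block_product) (sp_obj SQ I) (sp_obj p I)"
    unfolding bij_betw_def SQ_obj
  proof
    show "inj_on (free_lift (sp_scale p) blocks.block_product) {u. Poly_Mapping.keys u \<subseteq> sp_obj L I}"
      by (rule inj_on_free_lift[OF vector_space_axioms])
        (use img b basis_independent[OF assms] in \<open>simp_all add: bij_betw_def\<close>)
    show "free_lift (sp_scale p) blocks.block_product ` {u. Poly_Mapping.keys u \<subseteq> sp_obj L I} = sp_obj p I"
      by (simp add: free_lift_image[OF vector_space_axioms] img basis_span[OF assms])
  qed
  then show ?thesis
    by (rule bij_betw_cong[THEN iffD1, rotated]) (simp add: \<Phi>_def assms)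
qed

lemma \<Phi>_linear:
  assumes "finite I"
  shows "linear_on (sp_scale SQ) (sp_scale p) (sp_obj SQ I) (sp_obj p I) (\<Phi> I)"
proof -
  have "linear_on free_scale (sp_scale p) (sp_obj SQ I) UNIV (free_lift (sp_scale p) blocks.block_product)"
    by (rule linear_on_free_lift[OF vector_space_axioms])
  moreover have "u + w \<in> sp_obj SQ I" "free_scale c u \<in> sp_obj SQ I" if "u \<in> sp_obj SQ I" "w \<in> sp_obj SQ I" for u w c
    using SQ.subspace_add[OF SQ.obj_subspace[OF assms] that] SQ.subspace_scale[OF SQ.obj_subspace[OF assms] that(1)]
    by (simp_all add: SQ_scale)
  ultimately have "linear_on free_scale (sp_scale p) (sp_obj SQ I) UNIV (\<Phi> I)"
    using assms by (simp add: linear_on_def \<Phi>_def)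
  then show ?thesis
    using bij_betw_apply[OF \<Phi>_bij[OF assms]] by (auto simp: linear_on_def SQ_scale)
qed

lemma \<Phi>_species_hom: "connected_species_hom SQ p \<Phi>"
proof (intro connected_species_hom.intro species_hom.intro species_hom_axioms.intro
    connected_species_hom_axioms.intro SQ.connected_species_axioms connected_species_axioms
    SQ.set_species_axioms set_species_axioms)
  show "\<Phi> \<in> (\<Pi>\<^sub>E S\<in>Collect finite. sp_obj SQ S \<rightarrow>\<^sub>E sp_obj p S)"
  proof (intro PiE_I)
    fix S u assume "S \<in> Collect finite" "u \<in> sp_obj SQ S"
    then show "\<Phi> S u \<in> sp_obj p S" using bij_betw_apply[OF \<Phi>_bij] by simp
  qed (auto simp: \<Phi>_def)
  fix S assume S: "finite (S :: 'u set)"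
  show "linear_on (sp_scale SQ) (sp_scale p) (sp_obj SQ S) (sp_obj p S) (\<Phi> S)" by (rule \<Phi>_linear[OF S])
  fix \<sigma> u assume \<sigma>: "inj_on (\<sigma> :: 'u \<Rightarrow> 'u) S" and u: "u \<in> sp_obj SQ S"
  have fin: "finite (\<sigma> ` S)" using S by simp
  show "\<Phi> (\<sigma> ` S) (sp_map SQ S \<sigma> u) = sp_map p S \<sigma> (\<Phi> S u)"
  proof (rule SQ.linear_eq[OF S linear_on_compose[OF SQ.map_linear[OF S \<sigma>] \<Phi>_linear[OF fin]]
        linear_on_compose[OF \<Phi>_linear[OF S] map_linear[OF S \<sigma>]] vector_space_axioms _ u])
    fix X assume X: "X \<in> sp_obj L S"
    show "\<Phi> (\<sigma> ` S) (sp_map SQ S \<sigma> (free_elem X)) = sp_map p S \<sigma> (\<Phi> S (free_elem X))"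
      using blocks.block_product_natural[OF S X \<sigma>] S \<sigma> X fin SQ.F.map_closed[OF S \<sigma> X]
      by (simp add: SQ.map_b \<Phi>_elem subspecies_def)
  qed
next
  show "\<Phi> {} (sp_one SQ) = sp_one p"
    by (simp add: SQ_one \<Phi>_elem labeled_partitions_empty blocks.block_product_empty)
qed

lemma \<Phi>_iso:
  "connected_hopf_monoid_iso SQ (partition_product qo Qo) (partition_coproduct qo Delta Qo) p nabla Delta \<Phi>"
proof (rule connected_hopf_monoid_isoI)
  show "connected_hopf_monoid_hom SQ (partition_product qo Qo) (partition_coproduct qo Delta Qo) p nabla Delta \<Phi>"
  proof (rule SQ.hopf_monoid_homI[OF \<Phi>_species_hom SQ_hopf_monoid connected_hopf_monoid_axioms])
    fix S T :: "'u set" and X Y assume S: "finite S" "finite T" "S \<inter> T = {}"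
      and X: "X \<in> sp_obj L S" and Y: "Y \<in> sp_obj L T"
    show "\<Phi> (S \<union> T) (partition_product qo Qo S T (sp_pure SQ (free_elem X) (free_elem Y))) =
        nabla S T (sp_pure p (\<Phi> S (free_elem X)) (\<Phi> T (free_elem Y)))"
      using blocks.block_product_Un[OF S(1) X S(2) Y S(3)] labeled_partition_Un[OF X Y S(3)] S X Y
      by (simp add: SQ_product \<Phi>_elem basis_mul_def)
  next
    fix S T :: "'u set" and Z assume S: "finite S" "finite T" "S \<inter> T = {}" and Z: "Z \<in> sp_obj L (S \<union> T)"
    have fin: "finite (S \<union> T)" using S by simp
    note tm = tensor_map[OF SQ.obj_subspace_of[OF S(1)] SQ.obj_subspace_of[OF S(2)] \<Phi>_linear[OF S(1)] \<Phi>_linear[OF S(2)]]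
    note d = blocks.d_block_product[OF S Z]
    show "Delta S T (\<Phi> (S \<union> T) (free_elem Z)) =
      tensor_map (sp_scale SQ) (sp_scale SQ) (sp_scale p) (sp_scale p)
        (sp_obj SQ S) (sp_obj SQ T) (\<Phi> S) (\<Phi> T) (partition_coproduct qo Delta Qo S T (free_elem Z))"
      using Delta_basis(3)[OF S block_product_in_P[OF fin Z]] d S Z fin
      by (simp add: SQ_coproduct tm(2) SQ.b_in_obj \<Phi>_elem)
  qed
  show "\<forall>S. finite S \<longrightarrow> bij_betw (\<Phi> S) (sp_obj SQ S) (sp_obj p S)" using \<Phi>_bij by blast
qed

lemma \<Phi>_basis_iso:
  "species_iso L (subspecies p P) (\<lambda>I\<in>Collect finite. \<lambda>X\<in>sp_obj L I. \<Phi> I (free_elem X))"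
proof -
  let ?f = "\<lambda>I\<in>Collect finite. \<lambda>X\<in>sp_obj L I. \<Phi> I (free_elem X)"
  have f: "?f I X = blocks.block_product X" if "finite I" "X \<in> sp_obj L I" for I X
    using that by (simp add: \<Phi>_elem)
  have bij: "\<forall>S. finite S \<longrightarrow> bij_betw (?f S) (sp_obj L S) (sp_obj (subspecies p P) S)"
  proof (intro allI impI)
    fix S :: "'u set" assume S: "finite S"
    show "bij_betw (?f S) (sp_obj L S) (sp_obj (subspecies p P) S)"
      by (rule bij_betw_cong[THEN iffD2, OF f[OF S] blocks.bij_betw_block_product[OF S]])
  qed
  have hom: "species_hom L (subspecies p P) ?f"
  proof (intro species_hom.intro species_hom_axioms.intro SQ.F.set_species_axioms basis.set_species_axioms)
    show "?f \<in> (\<Pi>\<^sub>E S\<in>Collect finite. sp_obj L S \<rightarrow>\<^sub>E sp_obj (subspecies p P) S)"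
      using block_product_in_P by (auto simp: \<Phi>_elem subspecies_def[of p P])
    fix S X and \<sigma> :: "'u \<Rightarrow> 'u" assume S: "finite S" "inj_on \<sigma> S" and X: "X \<in> sp_obj L S"
    show "?f (\<sigma> ` S) (sp_map L S \<sigma> X) = sp_map (subspecies p P) S \<sigma> (?f S X)"
      using blocks.block_product_natural[OF S(1) X S(2)] SQ.F.map_closed[OF S X] S X
      by (simp add: \<Phi>_elem)
  qed
  from species_hom_inverse[OF this bij] hom show ?thesis
    unfolding species_iso_def by blast
qed

lemma \<Phi>_indecomposable: "finite I \<Longrightarrow> I \<noteq> {} \<Longrightarrow> l \<in> Q I \<Longrightarrow> \<Phi> I (free_elem {(I, l)}) = l"
  using labeled_partition_singleton[of I l "subspecies p Q"] blocks.block_product_singleton[of I l]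
  by (simp add: \<Phi>_elem subspecies_def[of p Q])

text \<open>
  Removing one block at a time expresses a partition as a product of partitions with one block, so
  compatibility with the product and the prescribed values on single blocks fix \<open>\<Psi>\<close> on a basis.
\<close>

lemma \<Phi>_unique:
  assumes "connected_hopf_monoid_hom SQ (partition_product qo Qo) (partition_coproduct qo Delta Qo) p nabla Delta \<Psi>"
    and single: "\<And>I l. finite I \<Longrightarrow> I \<noteq> {} \<Longrightarrow> l \<in> Q I \<Longrightarrow> \<Psi> I (free_elem {(I, l)}) = l"
  shows "\<Psi> = \<Phi>"
proof -
  interpret h: connected_hopf_monoid_hom SQ "partition_product qo Qo" "partition_coproduct qo Delta Qo" p nabla Delta \<Psi>
    by fact
  have elem: "\<Psi> I (free_elem X) = blocks.block_product X" if "finite I" "X \<in> sp_obj L I" for I X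
    using that
  proof (induction I X rule: labeled_partition_induct)
    case empty
    then show ?case using h.hom_one by (simp add: SQ_one blocks.block_product_empty)
  next
    case (insert B l I X)
    have s: "{(B, l)} \<in> sp_obj L B" by (rule labeled_partition_singleton[OF insert.hyps(2,3)])
    note tm = tensor_map[OF SQ.obj_subspace_of[OF insert.hyps(1)] SQ.obj_subspace_of[OF insert.hyps(4)]
        h.hom_linear[OF insert.hyps(1)] h.hom_linear[OF insert.hyps(4)]]
    have o: "free_elem {(B, l)} \<in> sp_obj SQ B" "free_elem X \<in> sp_obj SQ I"
      using SQ.b_in_obj s insert.hyps by auto
    have "\<Psi> (B \<union> I) (free_elem (insert (B, l) X)) =
        \<Psi> (B \<union> I) (partition_product qo Qo B I (sp_pure SQ (free_elem {(B, l)}) (free_elem X)))"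
      using SQ_product(2)[OF insert.hyps(5) s insert.hyps(6)] by simp
    also have "\<dots> = nabla B I (sp_pure p (\<Psi> B (free_elem {(B, l)})) (\<Psi> I (free_elem X)))"
      using h.hom_nabla[OF insert.hyps(1,4,5) pure_tensor_in_tensor_space[OF o]] tm(2)[OF o] by simp
    also have "\<Psi> B (free_elem {(B, l)}) = l"
      using single insert.hyps by (simp add: subspecies_def)
    also have "nabla B I (sp_pure p l (\<Psi> I (free_elem X))) = basis_mul B I l (\<Psi> I (free_elem X))"
      by (simp only: basis_mul_def)
    also have "\<dots> = blocks.block_product (insert (B, l) X)"
      using blocks.block_product_insert[OF insert.hyps] insert.IH by simp
    finally show ?case .
  qed
  have eq: "\<Psi> I u = \<Phi> I u" if "finite I" "u \<in> sp_obj SQ I" for I u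
    by (rule SQ.linear_eq[OF that(1) h.hom_linear[OF that(1)] \<Phi>_linear[OF that(1)] vector_space_axioms _ that(2)])
      (use elem \<Phi>_elem that(1) in simp)
  have ext: "\<Psi> \<in> (\<Pi>\<^sub>E S\<in>Collect finite. sp_obj SQ S \<rightarrow>\<^sub>E sp_obj p S)"
    "\<Phi> \<in> (\<Pi>\<^sub>E S\<in>Collect finite. sp_obj SQ S \<rightarrow>\<^sub>E sp_obj p S)"
    using h.hom_PiE \<Phi>_species_hom species_hom.hom_PiE connected_species_hom.axioms(1) by blast+
  show ?thesis
  proof (rule PiE_ext[OF ext])
    fix I assume "I \<in> Collect (finite :: 'u set \<Rightarrow> bool)"
    then show "\<Psi> I = \<Phi> I"
      using eq by (intro PiE_ext[OF PiE_mem[OF ext(1)] PiE_mem[OF ext(2)]]) auto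
  qed
qed

end

theorem theorem4p3:
  fixes p :: "('u::infinite, 'v::ab_group_add, 'k::field_char_0) connected_species_data"
    and nabla :: "('u, 'v, 'k) product"
    and Delta :: "('u, 'v, 'k) coproduct"
    and P Q Qo :: "'u set \<Rightarrow> 'v set"
    and qo :: "('u, 'v, 'k) connected_species_data"
  assumes "connected_hopf_monoid p nabla Delta"
    and "commutative_product p nabla"
    and "finite_species_basis p P"
    and "strongly_linearized p nabla Delta P"
    and "Q = indecomposables p nabla P"
    and "qo = span_connected p Q"
    and "Qo = connected_basis p Q"
  shows "linearized_comonoid qo Delta Qo \<and>
    (\<exists>!\<Phi>. connected_hopf_monoid_iso
        (partition_species qo Qo) (partition_product qo Qo) (partition_coproduct qo Delta Qo)
        p nabla Delta \<Phi> \<and>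
      species_iso (labeled_partitions (subspecies p Q)) (subspecies p P)
        (\<lambda>I\<in>Collect finite. \<lambda>X\<in>sp_obj (labeled_partitions (subspecies p Q)) I. \<Phi> I (free_elem X)) \<and>
      (\<forall>I. finite I \<and> I \<noteq> {} \<longrightarrow> (\<forall>l\<in>Q I. \<Phi> I (free_elem {(I, l)}) = l)))"
proof -
  have "linearized p nabla Delta P" using assms(4) by (simp add: strongly_linearized_def)
  with assms(1,2,4) interpret s: strongly_linearized_hopf_monoid p nabla Delta P
    by (intro strongly_linearized_hopf_monoid.intro linearized_hopf_monoid.intro
        linearized_hopf_monoid_axioms.intro strongly_linearized_hopf_monoid_axioms.intro)
  show ?thesis
    unfolding assms(5-7)
  proof (intro conjI ex1I[of _ s.\<Phi>])
    show "linearized_comonoid s.qo Delta s.Qo" by (rule s.linearized_comonoid_qo)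
  qed (use s.\<Phi>_iso s.\<Phi>_basis_iso s.\<Phi>_indecomposable s.\<Phi>_unique in
      \<open>auto simp: connected_hopf_monoid_iso_def\<close>)
qed

end
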